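(* Let $(\star)$ be a linear system over $\mathbb{F}_q$ with coefficient matrix $A\in\mathbb{F}_q^{m\times k}$ which is of type (RC), non-degenerate and irreducible, with $\ell$ column equivalence classes. Then there exist constants $\beta,\gamma>0$ with $\gamma<q$ such that for every $n$, every subset $S\subseteq\mathbb{F}_q^n$ with $|S|\ge\beta\gamma^n$ contains a solution $(x_1,\dots,x_k)\in S^k$ of $(\star)$ such that: (i) every balanced linear equation satisfied by $(x_1,\dots,x_k)$ preserves the column equivalence classes of $(\star)$; (ii) $\dim(\mathrm{aff}(x_1,\dots,x_k))\ge\min(k-\ell,\,k-2)$.
   Context: Let $\mathbb{F}_q$ be a finite field. A linear system $(\star)$ with coefficient matrix $A=(a_{ij})\in\mathbb{F}_q^{m\times k}$ is the system $\sum_j a_{ij}x_j=0$ ($i\in[m]$), with solutions $(x_1,\dots,x_k)\in(\mathbb{F}_q^n)^k$. A linear equation $b_1x_1+\dots+b_kx_k=0$ is balanced if $b_1+\dots+b_k=0$; the system is balanced if every row of $A$ sums to $0$. Two indices $j,j'\in[k]$ are equivalent if columns $j,j'$ of $A$ are nonzero scalar multiples of one another; the classes are the column equivalence classes. An equation with coefficient vector $b$ preserves the column equivalence classes of $(\star)$ if the matrix obtained by appending $b$ as an extra row to $A$ has the same column equivalence classes as $A$. Type (RC): balanced with at most one column equivalence class of size $1$. Non-degenerate: rows of $A$ linearly independent and no zero column. Two systems are equivalent if each equation of one is a linear combination of those of the other. Reducible: equivalent to a system whose variables can be partitioned into at least two classes with each equation only using (nonzero coefficients on) variables of one class; otherwise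 irreducible. $\mathrm{aff}(\cdot)$ denotes affine hull and $\dim$ its affine dimension. *)

theory Defs
  imports Complex_Main "HOL-Library.Disjoint_Sets"
begin

text \<open>Conventions. The finite field F_q is a type 'a of class field and finite, q = CARD('a).
A coefficient matrix A in F_q^(m x k) is a function A :: nat => nat => 'a, used on rows i < m
and columns j < k. A vector of F_q^n is a function v :: nat => 'a with v t = 0 for t >= n.
A k-tuple of vectors is x :: nat => (nat => 'a), used on indices j < k.\<close>

definition Fqn :: "nat \<Rightarrow> (nat \<Rightarrow> 'a::zero) set" where
  "Fqn n = {v. \<forall>t\<ge>n. v t = 0}"

definition satisfies_eq :: "nat \<Rightarrow> (nat \<Rightarrow> 'a::comm_ring_1) \<Rightarrow> (nat \<Rightarrow> nat \<Rightarrow> 'a) \<Rightarrow> bool" where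
  "satisfies_eq k b x \<longleftrightarrow> (\<forall>t. (\<Sum>j<k. b j * x j t) = 0)"

definition is_solution :: "nat \<Rightarrow> nat \<Rightarrow> (nat \<Rightarrow> nat \<Rightarrow> 'a::comm_ring_1) \<Rightarrow> (nat \<Rightarrow> nat \<Rightarrow> 'a) \<Rightarrow> bool" where
  "is_solution m k A x \<longleftrightarrow> (\<forall>i<m. satisfies_eq k (A i) x)"

definition balanced_eq :: "nat \<Rightarrow> (nat \<Rightarrow> 'a::comm_ring_1) \<Rightarrow> bool" where
  "balanced_eq k b \<longleftrightarrow> (\<Sum>j<k. b j) = 0"

definition balanced_sys :: "nat \<Rightarrow> nat \<Rightarrow> (nat \<Rightarrow> nat \<Rightarrow> 'a::comm_ring_1) \<Rightarrow> bool" where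
  "balanced_sys m k A \<longleftrightarrow> (\<forall>i<m. balanced_eq k (A i))"

definition col_equiv :: "nat \<Rightarrow> (nat \<Rightarrow> nat \<Rightarrow> 'a::field) \<Rightarrow> nat \<Rightarrow> nat \<Rightarrow> bool" where
  "col_equiv m A j j' \<longleftrightarrow> (\<exists>c. c \<noteq> 0 \<and> (\<forall>i<m. A i j = c * A i j'))"

definition col_classes :: "nat \<Rightarrow> nat \<Rightarrow> (nat \<Rightarrow> nat \<Rightarrow> 'a::field) \<Rightarrow> nat set set" where
  "col_classes m k A = (\<lambda>j. {j'. j' < k \<and> col_equiv m A j j'}) ` {..<k}"

definition append_row :: "nat \<Rightarrow> (nat \<Rightarrow> nat \<Rightarrow> 'a) \<Rightarrow> (nat \<Rightarrow> 'a) \<Rightarrow> nat \<Rightarrow> nat \<Rightarrow> 'a" where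
  "append_row m A b = (\<lambda>i. if i = m then b else A i)"

definition preserves_classes :: "nat \<Rightarrow> nat \<Rightarrow> (nat \<Rightarrow> nat \<Rightarrow> 'a::field) \<Rightarrow> (nat \<Rightarrow> 'a) \<Rightarrow> bool" where
  "preserves_classes m k A b \<longleftrightarrow> col_classes (Suc m) k (append_row m A b) = col_classes m k A"

definition type_RC :: "nat \<Rightarrow> nat \<Rightarrow> (nat \<Rightarrow> nat \<Rightarrow> 'a::field) \<Rightarrow> bool" where
  "type_RC m k A \<longleftrightarrow> balanced_sys m k A \<and> card {C \<in> col_classes m k A. card C = 1} \<le> 1"

definition non_degenerate :: "nat \<Rightarrow> nat \<Rightarrow> (nat \<Rightarrow> nat \<Rightarrow> 'a::field) \<Rightarrow> bool" where
  "non_degenerate m k A \<longleftrightarrow>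
     (\<forall>c. (\<forall>j<k. (\<Sum>i<m. c i * A i j) = 0) \<longrightarrow> (\<forall>i<m. c i = 0)) \<and>
     (\<forall>j<k. \<exists>i<m. A i j \<noteq> 0)"

definition lin_comb_of :: "nat \<Rightarrow> nat \<Rightarrow> (nat \<Rightarrow> nat \<Rightarrow> 'a::field) \<Rightarrow> (nat \<Rightarrow> 'a) \<Rightarrow> bool" where
  "lin_comb_of m k A b \<longleftrightarrow> (\<exists>c. \<forall>j<k. b j = (\<Sum>i<m. c i * A i j))"

definition equiv_sys :: "nat \<Rightarrow> nat \<Rightarrow> (nat \<Rightarrow> nat \<Rightarrow> 'a::field) \<Rightarrow> nat \<Rightarrow> (nat \<Rightarrow> nat \<Rightarrow> 'a) \<Rightarrow> bool" where
  "equiv_sys k m A m' B \<longleftrightarrow> (\<forall>i<m'. lin_comb_of m k A (B i)) \<and> (\<forall>i<m. lin_comb_of m' k B (A i))"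

definition reducible :: "nat \<Rightarrow> nat \<Rightarrow> (nat \<Rightarrow> nat \<Rightarrow> 'a::field) \<Rightarrow> bool" where
  "reducible m k A \<longleftrightarrow> (\<exists>m' B P. equiv_sys k m A m' B \<and> partition_on {..<k} P \<and> card P \<ge> 2 \<and>
      (\<forall>i<m'. \<exists>C\<in>P. \<forall>j<k. B i j \<noteq> 0 \<longrightarrow> j \<in> C))"

definition irreducible_sys :: "nat \<Rightarrow> nat \<Rightarrow> (nat \<Rightarrow> nat \<Rightarrow> 'a::field) \<Rightarrow> bool" where
  "irreducible_sys m k A \<longleftrightarrow> \<not> reducible m k A"

definition aff_indep :: "nat set \<Rightarrow> (nat \<Rightarrow> nat \<Rightarrow> 'a::field) \<Rightarrow> bool" where
  "aff_indep J x \<longleftrightarrow> (\<forall>c. (\<Sum>j\<in>J. c j) = 0 \<and> (\<forall>t. (\<Sum>j\<in>J. c j * x j t) = 0) \<longrightarrow> (\<forall>j\<in>J. c j = 0))"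

definition aff_dim_pts :: "nat \<Rightarrow> (nat \<Rightarrow> nat \<Rightarrow> 'a::field) \<Rightarrow> int" where
  "aff_dim_pts k x = Max (insert (-1) {int (card J) - 1 | J. J \<subseteq> {..<k} \<and> J \<noteq> {} \<and> aff_indep J x})"

end

theory Submission
  imports Defs "HOL-Library.Cardinality" "HOL-Library.FuncSet" "HOL-Library.Function_Algebras" "HOL-Analysis.Convex"
begin

text \<open>
  Write \<open>y\<^sub>C = \<Sum>\<^sub>j\<^sub>\<in>\<^sub>C c\<^sub>j x\<^sub>j\<close> for a column class \<open>C\<close> whose columns are \<open>c\<^sub>j a\<^sub>C\<close>; the system reads
  \<open>\<Sum>\<^sub>C a\<^sub>C y\<^sub>C = 0\<close>. It suffices to find values \<open>h\<^sub>C\<close> with \<open>\<Sum>\<^sub>C a\<^sub>C h\<^sub>C = 0\<close> such that every equation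
  \<open>y\<^sub>C = h\<^sub>C\<close> has at least \<open>\<tau> q\<^bsup>n(|C| - 1)\<^esup>\<close> solutions in \<open>S\<close>, where \<open>\<tau>\<close> is polynomial in the density of
  \<open>S\<close>: an equation not proportional to \<open>c\<close> on some class costs a further factor \<open>q\<^sup>n\<close>, and there are
  only \<open>q\<^sup>k\<close> equations, so some tuple satisfies none of them.

  If some class has a nonzero coefficient sum \<open>s\<^sub>C\<close> (or there is only one class), take
  \<open>h\<^sub>C = s\<^sub>C z\<close> for a common \<open>z \<in> S\<close>: most \<open>z\<close> have many representations \<open>y\<^sub>C = s\<^sub>C z\<close>, as
  otherwise the set of bad \<open>z\<close> would contradict the slice rank bound for three-variable equations,
  amplified to a supersaturation statement by restricting to random affine subspaces. If all
  \<open>s\<^sub>C\<close> vanish, irreducibility makes the \<open>a\<^sub>C\<close> linearly dependent, \<open>\<Sum>\<^sub>C r\<^sub>C a\<^sub>C = 0\<close>, and one takes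
  \<open>h\<^sub>C = r\<^sub>C e\<close> for a nonzero \<open>e\<close> that is a popular difference for all classes at once.
\<close>

section \<open>Slice rank\<close>

text \<open>Everything is measured against the generic order: a class equation has about
  \<open>q^(n(|C|-1))\<close> solutions in the whole space, and an unwanted equation costs a factor
  \<open>q^n\<close>. Losses polynomial in the density \<delta> are therefore affordable: with p
  classes the count survives once \<open>\<tau>^p q^n > q^k\<close>, and for
  \<open>\<tau> = \<kappa> \<delta>^L\<close> this holds down to densities of order
  \<open>q^(-n/M)\<close> with M fixed, whence \<open>\<gamma> = q^(1-1/M) < q\<close>. This is why
  the auxiliary bounds have the form \<open>\<kappa> \<delta>^L\<close> times the generic order,
  with \<open>\<kappa>\<close> and \<open>L\<close> independent of n and the set; mere existence of
  solutions would be too weak.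

  The case split comes from the affine dimension. Removing one point from each of p - 1 classes
  leaves k - p + 1 points; they are affinely independent if the intact class C admits no affine
  relation proportional to c, which holds when its coefficient sum or its value h_C is nonzero. If
  all coefficient sums vanish, a common point z only yields h = 0, so a nonzero h must come from
  elsewhere. With a single class a point is removed from it as well, which gives k - 2.\<close>

lemma exists_nonzero_orthogonal:
  fixes f :: "'i \<Rightarrow> 'u \<Rightarrow> 'a::{field,finite}"
  assumes U: "finite U" and I: "finite I" and less: "card I < card U"
  obtains v where "\<exists>x\<in>U. v x \<noteq> 0" "\<And>x. x \<notin> U \<Longrightarrow> v x = 0" "\<And>i. i \<in> I \<Longrightarrow> (\<Sum>x\<in>U. v x * f i x) = 0"
proof -
  define F where "F = (\<lambda>v. \<lambda>i\<in>I. \<Sum>x\<in>U. v x * f i x)"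
  let ?V = "U \<rightarrow>\<^sub>E (UNIV :: 'a set)"
  have q: "card (UNIV :: 'a set) \<ge> 2"
    using card_mono[of "UNIV :: 'a set" "{0, 1}"] by simp
  \<comment> \<open>Pigeonhole in place of a dimension count: two vectors with the same pairings
    exist, and their difference is the vector sought.\<close>
  have "card (I \<rightarrow>\<^sub>E (UNIV :: 'a set)) < card ?V"
    using q by (auto simp: card_funcsetE U I intro!: power_strict_increasing less)
  moreover have "F ` ?V \<subseteq> I \<rightarrow>\<^sub>E UNIV"
    by (auto simp: F_def)
  ultimately have "\<not> inj_on F ?V"
    by (metis card_inj_on_le finite_PiE I finite leD)
  then obtain v w where vw: "v \<in> ?V" "w \<in> ?V" "F v = F w" "v \<noteq> w"
    by (auto simp: inj_on_def)
  show ?thesis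
  proof
    show "\<exists>x\<in>U. v x - w x \<noteq> 0"
      using vw by (metis PiE_ext eq_iff_diff_eq_0)
    show "v x - w x = 0" if "x \<notin> U" for x
      using vw that by (auto simp: PiE_def extensional_def)
    show "(\<Sum>x\<in>U. (v x - w x) * f i x) = 0" if "i \<in> I" for i
      using fun_cong[OF vw(3), of i] that by (simp add: F_def algebra_simps sum_subtractf)
  qed
qed

text \<open>A solution of maximal support works: if its zeros in \<open>T\<close> outnumbered
  \<open>I\<close>, a nonzero solution supported on these zeros could be added and would enlarge the
  support.\<close>

lemma exists_large_support_orthogonal:
  fixes f :: "'i \<Rightarrow> 'u \<Rightarrow> 'a::{field,finite}"
  assumes T: "finite T" and I: "finite I"
  obtains h where "\<And>i. i \<in> I \<Longrightarrow> (\<Sum>x\<in>T. h x * f i x) = 0" "card T \<le> card {x \<in> T. h x \<noteq> 0} + card I"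
proof -
  define P where "P h \<longleftrightarrow> (\<forall>i\<in>I. (\<Sum>x\<in>T. h x * f i x) = 0)" for h
  let ?supp = "\<lambda>h. {x \<in> T. h x \<noteq> 0}"
  have "P (\<lambda>_. 0)"
    by (simp add: P_def)
  moreover have "\<forall>h. P h \<longrightarrow> card (?supp h) < Suc (card T)"
    by (auto simp: less_Suc_eq_le T intro!: card_mono)
  ultimately obtain h where h: "P h" "\<And>g. P g \<Longrightarrow> card (?supp g) \<le> card (?supp h)"
    using ex_has_greatest_nat[of P "\<lambda>_. 0" "\<lambda>h. card (?supp h)" "Suc (card T)"] by auto
  have "card T \<le> card (?supp h) + card I"
  proof (rule ccontr)
    assume "\<not> ?thesis"
    moreover have "card (T - ?supp h) = card T - card (?supp h)"
      by (intro card_Diff_subset) (auto simp: T)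
    ultimately have "card I < card (T - ?supp h)"
      by linarith
    then obtain v where v: "\<exists>x\<in>T - ?supp h. v x \<noteq> 0" "\<And>x. x \<notin> T - ?supp h \<Longrightarrow> v x = 0"
        "\<And>i. i \<in> I \<Longrightarrow> (\<Sum>x\<in>T - ?supp h. v x * f i x) = 0"
      using exists_nonzero_orthogonal[of "T - ?supp h" I f] T I by auto
    have "(\<Sum>x\<in>T. v x * f i x) = 0" if "i \<in> I" for i
    proof -
      have "(\<Sum>x\<in>T. v x * f i x) = (\<Sum>x\<in>T - ?supp h. v x * f i x)"
        using T v(2) by (intro sum.mono_neutral_right) auto
      then show ?thesis
        using v(3)[OF that] by simp
    qed
    then have "P (\<lambda>x. h x + v x)"
      using h(1) by (auto simp: P_def algebra_simps sum.distrib)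
    then have "card (?supp (\<lambda>x. h x + v x)) \<le> card (?supp h)"
      by (rule h(2))
    moreover have "?supp h \<subset> ?supp (\<lambda>x. h x + v x)"
    proof -
      obtain x where "x \<in> T - ?supp h" "v x \<noteq> 0"
        using v(1) by auto
      then have "x \<in> ?supp (\<lambda>x. h x + v x)" "x \<notin> ?supp h"
        by auto
      moreover have "?supp h \<subseteq> ?supp (\<lambda>x. h x + v x)"
        using v(2) by auto
      ultimately show ?thesis
        by blast
    qed
    ultimately show False
      using psubset_card_mono[of "?supp (\<lambda>x. h x + v x)" "?supp h"] T by auto
  qed
  then show ?thesis
    using h(1) that by (auto simp: P_def)
qed

lemma sum_mult_sum_swap:
  fixes h :: "'b \<Rightarrow> 'c::comm_semiring_0"
  shows "(\<Sum>z\<in>T. h z * (\<Sum>i\<in>I. a i * g i z)) = (\<Sum>i\<in>I. a i * (\<Sum>z\<in>T. h z * g i z))"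
  unfolding sum_distrib_left by (subst sum.swap) (simp only: mult.left_commute)

text \<open>Tao's bound for the diagonal tensor. Contracting the third variable with an
  \<open>h\<close> orthogonal to every \<open>f i\<close> removes the third sum and leaves a
  diagonal matrix with at least \<open>card T - card I\<close> nonzero diagonal entries, written
  with only \<open>2 * card I\<close> rank-one terms.\<close>

lemma slice_rank_diagonal:
  fixes f :: "'i \<Rightarrow> 'u \<Rightarrow> 'a::{field,finite}"
  assumes T: "finite T" and I: "finite I"
    and eq: "\<And>x y z. \<lbrakk>x \<in> T; y \<in> T; z \<in> T\<rbrakk> \<Longrightarrow>
      (if x = y \<and> y = z then 1 else 0) =
      (\<Sum>i\<in>I. f i x * g1 i y z) + (\<Sum>i\<in>I. f i y * g2 i x z) + (\<Sum>i\<in>I. f i z * g3 i x y)"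
  shows "card T \<le> 3 * card I"
proof (rule ccontr)
  assume less: "\<not> ?thesis"
  obtain h where h: "\<And>i. i \<in> I \<Longrightarrow> (\<Sum>x\<in>T. h x * f i x) = 0" "card T \<le> card {x \<in> T. h x \<noteq> 0} + card I"
    using exists_large_support_orthogonal[OF T I, of f] by blast
  define U where "U = {x \<in> T. h x \<noteq> 0}"
  define G where "G i y = (\<Sum>z\<in>T. h z * g1 i y z)" for i y
  define H where "H i x = (\<Sum>z\<in>T. h z * g2 i x z)" for i x
  have diag: "(if x = y then h x else 0) = (\<Sum>i\<in>I. f i x * G i y) + (\<Sum>i\<in>I. f i y * H i x)"
    if "x \<in> T" "y \<in> T" for x y
  proof -
    have comm: "(\<Sum>i\<in>I. f i z * g3 i x y) = (\<Sum>i\<in>I. g3 i x y * f i z)" for z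
      by (rule sum.cong[OF refl mult.commute])
    have "(if x = y then h x else 0) = (\<Sum>z\<in>T. if z = y then (if x = y then h z else 0) else 0)"
      using that T by simp
    also have "\<dots> = (\<Sum>z\<in>T. h z * (if x = y \<and> y = z then 1 else 0))"
      by (intro sum.cong) auto
    also have "\<dots> = (\<Sum>z\<in>T. h z * ((\<Sum>i\<in>I. f i x * g1 i y z) + (\<Sum>i\<in>I. f i y * g2 i x z)
        + (\<Sum>i\<in>I. g3 i x y * f i z)))"
      by (rule sum.cong[OF refl]) (simp only: eq[OF that] comm)
    also have "\<dots> = (\<Sum>i\<in>I. f i x * G i y) + (\<Sum>i\<in>I. f i y * H i x) + (\<Sum>i\<in>I. g3 i x y * (\<Sum>z\<in>T. h z * f i z))"
      by (simp only: distrib_left sum.distrib sum_mult_sum_swap[of h] G_def H_def)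
    also have "(\<Sum>i\<in>I. g3 i x y * (\<Sum>z\<in>T. h z * f i z)) = 0"
      using h(1) by simp
    finally show ?thesis by simp
  qed
  have finU: "finite U"
    using T by (simp add: U_def)
  \<comment> \<open>A nonzero vector on \<open>U\<close> orthogonal to all \<open>f i\<close> and
    all \<open>H i\<close> lies in the left kernel of the matrix, whose diagonal has no zero on
    \<open>U\<close>.\<close>
  have card_less: "card (I <+> I) < card U"
    unfolding card_Plus[OF I I] U_def using less h(2) by linarith
  obtain v where v: "\<exists>x\<in>U. v x \<noteq> 0" "\<And>x. x \<notin> U \<Longrightarrow> v x = 0"
      "\<And>j. j \<in> I <+> I \<Longrightarrow> (\<Sum>x\<in>U. v x * case_sum f H j x) = 0"
    by (rule exists_nonzero_orthogonal[OF finU finite_Plus[OF I I] card_less, of "case_sum f H"]) (rule that)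
  have f0: "(\<Sum>x\<in>U. v x * f i x) = 0" and H0: "(\<Sum>x\<in>U. v x * H i x) = 0" if "i \<in> I" for i
    using v(3)[of "Inl i"] v(3)[of "Inr i"] that by auto
  obtain y where y: "y \<in> U" "v y \<noteq> 0"
    using v(1) by blast
  have "v y * h y = (\<Sum>x\<in>U. if x = y then v x * h x else 0)"
    using y finU by simp
  also have "\<dots> = (\<Sum>x\<in>U. v x * (if x = y then h x else 0))"
    by (intro sum.cong) auto
  also have "\<dots> = (\<Sum>x\<in>U. v x * ((\<Sum>i\<in>I. G i y * f i x) + (\<Sum>i\<in>I. f i y * H i x)))"
  proof (rule sum.cong[OF refl])
    fix x assume "x \<in> U"
    have "(\<Sum>i\<in>I. f i x * G i y) = (\<Sum>i\<in>I. G i y * f i x)"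
      by (rule sum.cong[OF refl mult.commute])
    then show "v x * (if x = y then h x else 0) = v x * ((\<Sum>i\<in>I. G i y * f i x) + (\<Sum>i\<in>I. f i y * H i x))"
      using diag[of x y] \<open>x \<in> U\<close> y by (simp only: U_def mem_Collect_eq)
  qed
  also have "\<dots> = (\<Sum>i\<in>I. G i y * (\<Sum>x\<in>U. v x * f i x)) + (\<Sum>i\<in>I. f i y * (\<Sum>x\<in>U. v x * H i x))"
    by (simp only: distrib_left sum.distrib sum_mult_sum_swap[of v])
  also have "\<dots> = 0"
    using f0 H0 by simp
  finally show False
    using y by (auto simp: U_def)
qed

text \<open>The coefficients must not depend on \<open>x\<close>, \<open>y\<close>,
  \<open>z\<close>, since such expansions are later multiplied over all coordinates.\<close>

lemma trinomial_expansion: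
  fixes a b c :: "'a::comm_ring_1"
  obtains \<kappa> :: "nat \<times> nat \<times> nat \<Rightarrow> 'a" where
    "\<And>x y z. 1 - (a * x + b * y + c * z) ^ d =
      (\<Sum>e \<in> {(i, j, l). i + j + l \<le> d}. \<kappa> e * (x ^ fst e * y ^ fst (snd e) * z ^ snd (snd e)))"
proof
  define E where "E = {(i :: nat, j, l). i + j + l \<le> d}"
  define D where "D = Sigma {..d} (\<lambda>i. {..d - i})"
  \<comment> \<open>\<open>\<mu>\<close> is the trinomial coefficient on exponents of degree exactly
    \<open>d\<close>; \<open>\<delta>\<close> contributes the constant 1.\<close>
  define \<mu> where "\<mu> = (\<lambda>(i, j, l). if i + j + l = d
    then of_nat (d choose i) * of_nat ((d - i) choose j) * a ^ i * b ^ j * c ^ l else 0)"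
  define \<delta> :: "nat \<times> nat \<times> nat \<Rightarrow> 'a" where "\<delta> e = (if e = (0, 0, 0) then 1 else 0)" for e
  fix x y z :: 'a
  define m where "m e = x ^ fst e * y ^ fst (snd e) * z ^ snd (snd e)" for e :: "nat \<times> nat \<times> nat"
  have fin: "finite E"
    unfolding E_def by (rule finite_subset[of _ "{..d} \<times> {..d} \<times> {..d}"]) auto
  have "(a * x + b * y + c * z) ^ d = (a * x + (b * y + c * z)) ^ d"
    by (simp add: add.assoc)
  also have "\<dots> = (\<Sum>i\<le>d. of_nat (d choose i) * (a * x) ^ i *
      (\<Sum>j\<le>d - i. of_nat ((d - i) choose j) * (b * y) ^ j * (c * z) ^ (d - i - j)))"
    by (simp add: binomial_ring)
  also have "\<dots> = (\<Sum>i\<le>d. \<Sum>j\<le>d - i. of_nat (d choose i) * of_nat ((d - i) choose j) * a ^ i * b ^ j * c ^ (d - i - j)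
      * (x ^ i * y ^ j * z ^ (d - i - j)))"
    by (simp add: sum_distrib_left power_mult_distrib mult_ac)
  also have "\<dots> = (\<Sum>(i, j)\<in>D. of_nat (d choose i) * of_nat ((d - i) choose j) * a ^ i * b ^ j * c ^ (d - i - j)
      * (x ^ i * y ^ j * z ^ (d - i - j)))"
    unfolding D_def by (simp add: sum.Sigma)
  also have "\<dots> = (\<Sum>e\<in>{(i, j, l). i + j + l = d}. \<mu> e * m e)"
    by (rule sum.reindex_bij_witness[of _ "\<lambda>(i, j, l). (i, j)" "\<lambda>(i, j). (i, j, d - i - j)"])
      (auto simp: D_def \<mu>_def m_def)
  also have "\<dots> = (\<Sum>e\<in>E. \<mu> e * m e)"
    using fin by (intro sum.mono_neutral_left) (auto simp: \<mu>_def E_def split: if_splits)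
  finally have power: "(a * x + b * y + c * z) ^ d = (\<Sum>e\<in>E. \<mu> e * m e)" .
  have "(\<Sum>e\<in>E. \<delta> e * m e) = (\<Sum>e\<in>{(0, 0, 0)}. \<delta> e * m e)"
    using fin by (intro sum.mono_neutral_right) (auto simp: \<delta>_def E_def)
  then have "1 = (\<Sum>e\<in>E. \<delta> e * m e)"
    by (simp add: \<delta>_def m_def)
  then have "1 - (a * x + b * y + c * z) ^ d = (\<Sum>e\<in>E. \<delta> e * m e) - (\<Sum>e\<in>E. \<mu> e * m e)"
    using power by simp
  also have "\<dots> = (\<Sum>e\<in>E. (\<delta> e - \<mu> e) * m e)"
    by (simp only: sum_subtractf left_diff_distrib)
  finally show "1 - (a * x + b * y + c * z) ^ d =
      (\<Sum>e\<in>{(i, j, l). i + j + l \<le> d}. (\<delta> e - \<mu> e) * (x ^ fst e * y ^ fst (snd e) * z ^ snd (snd e)))"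
    by (simp only: E_def m_def)
qed

section \<open>Sets without nontrivial solutions of a three-variable equation\<close>

text \<open>Multiplication by \<open>x\<close> permutes the nonzero elements, so it preserves their
  product.\<close>

lemma finite_field_power_card_minus_one:
  fixes x :: "'a::{field,finite}"
  assumes "x \<noteq> 0"
  shows "x ^ (CARD('a) - 1) = 1"
proof -
  have "x ^ (CARD('a) - 1) * \<Prod>(UNIV - {0}) = (\<Prod>y\<in>UNIV - {0}. x * y)"
    by (simp add: prod.distrib)
  also have "\<dots> = \<Prod>(UNIV - {0})"
    by (rule prod.reindex_bij_witness[of _ "\<lambda>y. y / x" "\<lambda>y. x * y"]) (use assms in auto)
  finally show ?thesis
    by simp
qed

lemma card_field_ge_2: "CARD('a::{field,finite}) \<ge> 2"
  using card_mono[of "UNIV :: 'a set" "{0, 1}"] by simp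

text \<open>At \<open>u = 1\<close> both sides equal \<open>q\<close>, and there right minus left
  has derivative \<open>q(q-1) - 3q(q-1)/2 < 0\<close>; hence some \<open>u\<close> slightly below 1
  works. The strictness makes the growth rate of solution-free sets smaller than
  \<open>q\<close>.\<close>

lemma sum_powers_less:
  fixes q :: nat
  assumes "q \<ge> 2"
  obtains u :: real where "0 < u" "u < 1" "(\<Sum>i<q. u ^ (3 * i)) < q * u ^ (q - 1)"
proof -
  define g where "g u = q * u ^ (q - 1) - (\<Sum>i<q. u ^ (3 * i))" for u :: real
  have gauss: "(\<Sum>i<q. real i) = real q * (real q - 1) / 2"
    by (induction q) (auto simp: field_simps)
  have "(g has_real_derivative (q * (real (q - 1) * 1 ^ (q - 1 - 1)) - (\<Sum>i<q. real (3 * i) * 1 ^ (3 * i - 1)))) (at 1)"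
    unfolding g_def by (auto intro!: derivative_eq_intros)
  moreover have "q * (real (q - 1) * 1 ^ (q - 1 - 1)) - (\<Sum>i<q. real (3 * i) * 1 ^ (3 * i - 1)) = - (real q * (real q - 1) / 2)"
  proof -
    have "(\<Sum>i<q. real (3 * i) * 1 ^ (3 * i - 1)) = 3 * (\<Sum>i<q. real i)"
      by (simp add: sum_distrib_left)
    then show ?thesis
      using assms gauss by (simp add: of_nat_diff field_simps)
  qed
  ultimately have "(g has_real_derivative - (real q * (real q - 1) / 2)) (at 1)"
    by metis
  then obtain d where d: "d > 0" "\<And>h. 0 < h \<Longrightarrow> h < d \<Longrightarrow> g 1 < g (1 - h)"
    using DERIV_neg_dec_left[of g "- (real q * (real q - 1) / 2)" 1] assms by auto
  define h where "h = min (d / 2) (1 / 2)"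
  have "g 1 < g (1 - h)" "0 < h" "h < 1"
    using d(1) by (auto simp: h_def intro!: d(2))
  then show ?thesis
    using that[of "1 - h"] by (simp add: g_def)
qed

text \<open>Exponential Markov bound: as \<open>u < 1\<close>, every vector counted has weight
  \<open>u ^ (3 * (\<Sum>t<n. \<alpha> t))\<close> at least \<open>u ^ ((q - 1) * n)\<close>, while
  the weights of all vectors add up to a product over the coordinates.\<close>

lemma card_low_weight_exponents:
  fixes q n :: nat and u :: real
  assumes u: "0 < u" "u < 1"
  shows "real (card {\<alpha> \<in> {..<n} \<rightarrow>\<^sub>E {..<q}. 3 * (\<Sum>t<n. \<alpha> t) \<le> (q - 1) * n}) \<le>
    ((\<Sum>i<q. u ^ (3 * i)) / u ^ (q - 1)) ^ n"
proof -
  let ?P = "{..<n} \<rightarrow>\<^sub>E {..<q}"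
  let ?I = "{\<alpha> \<in> ?P. 3 * (\<Sum>t<n. \<alpha> t) \<le> (q - 1) * n}"
  have fin: "finite ?P"
    by (simp add: finite_PiE)
  have "real (card ?I) * u ^ ((q - 1) * n) = (\<Sum>\<alpha>\<in>?I. u ^ ((q - 1) * n))"
    by simp
  also have "\<dots> \<le> (\<Sum>\<alpha>\<in>?I. u ^ (3 * (\<Sum>t<n. \<alpha> t)))"
    using u by (intro sum_mono power_decreasing) auto
  also have "\<dots> \<le> (\<Sum>\<alpha>\<in>?P. u ^ (3 * (\<Sum>t<n. \<alpha> t)))"
    using u fin by (intro sum_mono2) auto
  also have "\<dots> = (\<Sum>\<alpha>\<in>?P. \<Prod>t<n. u ^ (3 * \<alpha> t))"
    by (simp add: sum_distrib_left power_sum)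
  also have "\<dots> = (\<Prod>t<n. \<Sum>i<q. u ^ (3 * i))"
    by (rule prod_sum_PiE[symmetric]) auto
  also have "\<dots> = (\<Sum>i<q. u ^ (3 * i)) ^ n"
    by simp
  finally have "real (card ?I) * (u ^ (q - 1)) ^ n \<le> (\<Sum>i<q. u ^ (3 * i)) ^ n"
    by (simp add: power_mult)
  then show ?thesis
    using u by (simp add: power_divide pos_le_divide_eq)
qed

text \<open>Collecting the terms that share a factor \<open>f \<alpha>\<close> turns a polynomial
  expansion into one slice per element of \<open>I\<close>.\<close>

lemma sum_over_low_monomials:
  fixes \<kappa> :: "'e \<Rightarrow> 'b::comm_semiring_1"
  assumes E: "finite E" and I: "finite I" and r: "r ` E \<subseteq> I"
  shows "(\<Sum>e\<in>E. \<kappa> e * f (r e) * g e) = (\<Sum>\<alpha>\<in>I. f \<alpha> * (\<Sum>e | e \<in> E \<and> r e = \<alpha>. \<kappa> e * g e))"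
proof -
  have "(\<Sum>\<alpha>\<in>I. f \<alpha> * (\<Sum>e | e \<in> E \<and> r e = \<alpha>. \<kappa> e * g e)) =
      (\<Sum>\<alpha>\<in>I. \<Sum>e | e \<in> E \<and> r e = \<alpha>. \<kappa> e * f (r e) * g e)"
    by (auto simp: sum_distrib_left mult_ac intro!: sum.cong)
  also have "\<dots> = (\<Sum>e\<in>E. \<kappa> e * f (r e) * g e)"
    by (rule sum.group[OF E I r])
  finally show ?thesis ..
qed

lemma finite_Fqn: "finite (Fqn n :: (nat \<Rightarrow> 'a::{finite,zero}) set)"
  and card_Fqn: "card (Fqn n :: (nat \<Rightarrow> 'a) set) = CARD('a) ^ n"
proof -
  let ?r = "\<lambda>v :: nat \<Rightarrow> 'a. restrict v {..<n}"
  have "bij_betw ?r (Fqn n) ({..<n} \<rightarrow>\<^sub>E UNIV)"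
    by (rule bij_betw_byWitness[where f' = "\<lambda>g t. if t < n then g t else 0"])
      (auto simp: Fqn_def fun_eq_iff PiE_def extensional_def)
  then show "finite (Fqn n :: (nat \<Rightarrow> 'a) set)" "card (Fqn n :: (nat \<Rightarrow> 'a) set) = CARD('a) ^ n"
    by (auto simp: bij_betw_finite finite_PiE bij_betw_same_card card_funcsetE)
qed

text \<open>The Ellenberg-Gijswijt argument. On \<open>T\<close> the product over
  \<open>t < n\<close> of \<open>1 - (a * x t + b * y t + c * z t) ^ (q - 1)\<close> is the diagonal
  tensor, as all solutions are trivial. Its total degree is at most \<open>(q - 1) * n\<close>, so
  every monomial has degree at most a third of that in one of \<open>x\<close>, \<open>y\<close>,
  \<open>z\<close>.\<close>

lemma card_no_nontrivial_solution:
  fixes T :: "(nat \<Rightarrow> 'a::{field,finite}) set"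
  assumes abc: "a \<noteq> 0" "b \<noteq> 0" "c \<noteq> 0" "a + b + c = 0"
    and T: "T \<subseteq> Fqn n"
    and triv: "\<And>x y z. \<lbrakk>x \<in> T; y \<in> T; z \<in> T; \<forall>t. a * x t + b * y t + c * z t = 0\<rbrakk> \<Longrightarrow> x = y \<and> y = z"
  shows "card T \<le> 3 * card {\<alpha> \<in> {..<n} \<rightarrow>\<^sub>E {..<CARD('a)}. 3 * (\<Sum>t<n. \<alpha> t) \<le> (CARD('a) - 1) * n}"
proof -
  define d where "d = CARD('a) - 1"
  have q: "CARD('a) = Suc d"
    unfolding d_def using card_field_ge_2[where 'a = 'a] by linarith
  define I where "I = {\<alpha> \<in> {..<n} \<rightarrow>\<^sub>E {..<Suc d}. 3 * (\<Sum>t<n. \<alpha> t) \<le> d * n}"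
  define M where "M = {(i, j, l). i + j + l \<le> d}"
  define E where "E = {..<n} \<rightarrow>\<^sub>E M"
  define r1 where "r1 e = (\<lambda>t\<in>{..<n}. fst (e t))" for e :: "nat \<Rightarrow> nat \<times> nat \<times> nat"
  define r2 where "r2 e = (\<lambda>t\<in>{..<n}. fst (snd (e t)))" for e :: "nat \<Rightarrow> nat \<times> nat \<times> nat"
  define r3 where "r3 e = (\<lambda>t\<in>{..<n}. snd (snd (e t)))" for e :: "nat \<Rightarrow> nat \<times> nat \<times> nat"
  define mon where "mon \<alpha> x = (\<Prod>t<n. x t ^ \<alpha> t)" for \<alpha> :: "nat \<Rightarrow> nat" and x :: "nat \<Rightarrow> 'a"
  obtain \<kappa> where \<kappa>': "\<And>x y z. 1 - (a * x + b * y + c * z) ^ d =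
      (\<Sum>e \<in> {(i, j, l). i + j + l \<le> d}. \<kappa> e * (x ^ fst e * y ^ fst (snd e) * z ^ snd (snd e)))"
    by (rule trinomial_expansion[of a b c d]) (rule that)
  note \<kappa> = \<kappa>'[folded M_def]
  define K where "K e = (\<Prod>t<n. \<kappa> (e t))" for e
  have finM: "finite M"
    unfolding M_def by (rule finite_subset[of _ "{..d} \<times> {..d} \<times> {..d}"]) auto
  have finE: "finite E" and finI: "finite I"
    using finM by (auto simp: E_def I_def finite_PiE)
  have r_le: "(\<Sum>t<n. r1 e t) + (\<Sum>t<n. r2 e t) + (\<Sum>t<n. r3 e t) \<le> d * n"
    and r_mem: "r1 e \<in> {..<n} \<rightarrow>\<^sub>E {..<Suc d}" "r2 e \<in> {..<n} \<rightarrow>\<^sub>E {..<Suc d}" "r3 e \<in> {..<n} \<rightarrow>\<^sub>E {..<Suc d}"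
    if "e \<in> E" for e
  proof -
    have eM: "fst (e t) + fst (snd (e t)) + snd (snd (e t)) \<le> d" if "t < n" for t
      using PiE_mem[OF \<open>e \<in> E\<close>[unfolded E_def], of t] that by (auto simp: M_def split: prod.splits)
    have "(\<Sum>t<n. r1 e t) + (\<Sum>t<n. r2 e t) + (\<Sum>t<n. r3 e t) =
        (\<Sum>t<n. fst (e t) + fst (snd (e t)) + snd (snd (e t)))"
      by (simp add: r1_def r2_def r3_def sum.distrib)
    also have "\<dots> \<le> (\<Sum>t<n. d)"
      by (rule sum_mono) (use eM in auto)
    finally show "(\<Sum>t<n. r1 e t) + (\<Sum>t<n. r2 e t) + (\<Sum>t<n. r3 e t) \<le> d * n"
      by (simp add: mult.commute)
    have lt: "fst (e t) < Suc d \<and> fst (snd (e t)) < Suc d \<and> snd (snd (e t)) < Suc d" if "t < n" for t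
      using eM[OF that] by linarith
    show "r1 e \<in> {..<n} \<rightarrow>\<^sub>E {..<Suc d}" "r2 e \<in> {..<n} \<rightarrow>\<^sub>E {..<Suc d}" "r3 e \<in> {..<n} \<rightarrow>\<^sub>E {..<Suc d}"
      unfolding r1_def r2_def r3_def by (intro restrict_PiE_iff[THEN iffD2] ballI; use lt in simp)+
  qed
  \<comment> \<open>Each monomial is charged to the first of \<open>x\<close>, \<open>y\<close>,
    \<open>z\<close> in which its degree is low, so the three families are disjoint.\<close>
  define E1 where "E1 = {e \<in> E. r1 e \<in> I}"
  define E2 where "E2 = {e \<in> E - E1. r2 e \<in> I}"
  define E3 where "E3 = E - E1 - E2"
  have "r3 e \<in> I" if "e \<in> E3" for e
  proof -
    have e: "e \<in> E" "r1 e \<notin> I" "r2 e \<notin> I"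
      using that by (auto simp: E1_def E2_def E3_def)
    then have "d * n < 3 * (\<Sum>t<n. r1 e t)" "d * n < 3 * (\<Sum>t<n. r2 e t)"
      using r_mem[OF e(1)] unfolding I_def by auto
    then have "3 * (\<Sum>t<n. r3 e t) \<le> d * n"
      using r_le[OF e(1)] by linarith
    then show ?thesis
      using r_mem[OF e(1)] unfolding I_def by blast
  qed
  then have r_img: "r1 ` E1 \<subseteq> I" "r2 ` E2 \<subseteq> I" "r3 ` E3 \<subseteq> I"
    by (auto simp: E1_def E2_def)
  have fins: "finite E1" "finite E2" "finite E3"
    using finE by (auto simp: E1_def E2_def E3_def)
  have expand: "(\<Prod>t<n. 1 - (a * x t + b * y t + c * z t) ^ d) =
      (\<Sum>e\<in>E. K e * mon (r1 e) x * mon (r2 e) y * mon (r3 e) z)" for x y z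
  proof -
    have "(\<Prod>t<n. 1 - (a * x t + b * y t + c * z t) ^ d) =
        (\<Prod>t<n. \<Sum>e\<in>M. \<kappa> e * x t ^ fst e * y t ^ fst (snd e) * z t ^ snd (snd e))"
      by (simp add: \<kappa> mult.assoc)
    also have "\<dots> = (\<Sum>e\<in>E. \<Prod>t<n. \<kappa> (e t) * x t ^ fst (e t) * y t ^ fst (snd (e t)) * z t ^ snd (snd (e t)))"
      unfolding E_def by (rule prod_sum_PiE) (use finM in auto)
    also have "\<dots> = (\<Sum>e\<in>E. K e * mon (r1 e) x * mon (r2 e) y * mon (r3 e) z)"
      by (simp add: K_def mon_def r1_def r2_def r3_def prod.distrib)
    finally show ?thesis .
  qed
  have split: "(\<Sum>e\<in>E. F e) = (\<Sum>e\<in>E1. F e) + (\<Sum>e\<in>E2. F e) + (\<Sum>e\<in>E3. F e)" for F :: "_ \<Rightarrow> 'a"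
  proof -
    have "E1 \<union> E2 \<union> E3 = E" "(E1 \<union> E2) \<inter> E3 = {}" "E1 \<inter> E2 = {}"
      by (auto simp: E1_def E2_def E3_def)
    then show ?thesis
      using fins by (metis finite_Un sum.union_disjoint)
  qed
  have "card T \<le> 3 * card I"
  proof (rule slice_rank_diagonal[where f = mon and
        ?g1.0 = "\<lambda>\<alpha> y z. \<Sum>e | e \<in> E1 \<and> r1 e = \<alpha>. K e * (mon (r2 e) y * mon (r3 e) z)" and
        ?g2.0 = "\<lambda>\<alpha> x z. \<Sum>e | e \<in> E2 \<and> r2 e = \<alpha>. K e * (mon (r1 e) x * mon (r3 e) z)" and
        ?g3.0 = "\<lambda>\<alpha> x y. \<Sum>e | e \<in> E3 \<and> r3 e = \<alpha>. K e * (mon (r1 e) x * mon (r2 e) y)"])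
    show "finite T"
      using T finite_Fqn finite_subset by blast
    show "finite I" by fact
    fix x y z assume xyz: "x \<in> T" "y \<in> T" "z \<in> T"
    have "(if x = y \<and> y = z then 1 else 0) = (\<Prod>t<n. 1 - (a * x t + b * y t + c * z t) ^ d)"
    proof (cases "\<forall>t. a * x t + b * y t + c * z t = 0")
      case True
      moreover have "d > 0"
        unfolding d_def using card_field_ge_2[where 'a = 'a] by linarith
      ultimately show ?thesis
        using triv[OF xyz True] by (simp add: power_0_left)
    next
      case False
      then obtain t where t: "a * x t + b * y t + c * z t \<noteq> 0"
        by blast
      have "x t = 0 \<and> y t = 0 \<and> z t = 0" if "n \<le> t"
        using xyz T that unfolding Fqn_def by blast
      then have "t < n"
        using t by (cases "t < n") (auto simp: not_less)
      moreover have "1 - (a * x t + b * y t + c * z t) ^ d = 0"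
        using finite_field_power_card_minus_one[OF t] by (simp add: d_def)
      ultimately have "(\<Prod>t<n. 1 - (a * x t + b * y t + c * z t) ^ d) = 0"
        by (meson finite_lessThan lessThan_iff prod_zero)
      moreover have "\<not> (x = y \<and> y = z)"
        using t abc(4) by (metis distrib_right mult_zero_left)
      ultimately show ?thesis
        by auto
    qed
    also have "\<dots> = (\<Sum>e\<in>E1. K e * mon (r1 e) x * (mon (r2 e) y * mon (r3 e) z))
        + (\<Sum>e\<in>E2. K e * mon (r2 e) y * (mon (r1 e) x * mon (r3 e) z))
        + (\<Sum>e\<in>E3. K e * mon (r3 e) z * (mon (r1 e) x * mon (r2 e) y))"
      unfolding expand split by (simp add: mult_ac)
    finally show "(if x = y \<and> y = z then 1 else 0) =
        (\<Sum>\<alpha>\<in>I. mon \<alpha> x * (\<Sum>e | e \<in> E1 \<and> r1 e = \<alpha>. K e * (mon (r2 e) y * mon (r3 e) z)))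
        + (\<Sum>\<alpha>\<in>I. mon \<alpha> y * (\<Sum>e | e \<in> E2 \<and> r2 e = \<alpha>. K e * (mon (r1 e) x * mon (r3 e) z)))
        + (\<Sum>\<alpha>\<in>I. mon \<alpha> z * (\<Sum>e | e \<in> E3 \<and> r3 e = \<alpha>. K e * (mon (r1 e) x * mon (r2 e) y)))"
      unfolding sum_over_low_monomials[OF fins(1) finI r_img(1), of K "\<lambda>\<alpha>. mon \<alpha> x"]
        sum_over_low_monomials[OF fins(2) finI r_img(2), of K "\<lambda>\<alpha>. mon \<alpha> y"]
        sum_over_low_monomials[OF fins(3) finI r_img(3), of K "\<lambda>\<alpha>. mon \<alpha> z"] .
  qed
  then show ?thesis
    unfolding I_def q by simp
qed

section \<open>Supersaturation\<close>

definition smult :: "'a::times \<Rightarrow> (nat \<Rightarrow> 'a) \<Rightarrow> nat \<Rightarrow> 'a" (infixr \<open>*v\<close> 75) where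
  "c *v x = (\<lambda>t. c * x t)"

lemma smult_apply [simp]: "(c *v x) t = c * x t"
  by (simp add: smult_def)

lemma sum_fun_apply: "(\<Sum>i\<in>I. f i) t = (\<Sum>i\<in>I. f i t)" for f :: "'i \<Rightarrow> 'b \<Rightarrow> 'c::comm_monoid_add"
  by (induction I rule: infinite_finite_induct) auto

lemma Fqn_closed [simp]:
  fixes x y :: "nat \<Rightarrow> 'a::field"
  shows "0 \<in> Fqn n" "x \<in> Fqn n \<Longrightarrow> y \<in> Fqn n \<Longrightarrow> x + y \<in> Fqn n"
    "x \<in> Fqn n \<Longrightarrow> y \<in> Fqn n \<Longrightarrow> x - y \<in> Fqn n" "x \<in> Fqn n \<Longrightarrow> c *v x \<in> Fqn n"
  by (auto simp: Fqn_def)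

lemma Fqn_sum [simp]:
  fixes f :: "'i \<Rightarrow> nat \<Rightarrow> 'a::field"
  shows "(\<And>i. i \<in> I \<Longrightarrow> f i \<in> Fqn n) \<Longrightarrow> (\<Sum>i\<in>I. f i) \<in> Fqn n"
  by (induction I rule: infinite_finite_induct) auto

lemma sum_card_swap:
  assumes "finite A" "finite B"
  shows "(\<Sum>a\<in>A. card {b \<in> B. R a b}) = (\<Sum>b\<in>B. card {a \<in> A. R a b})"
proof -
  have "(\<Sum>a\<in>A. card {b \<in> B. R a b}) = (\<Sum>a\<in>A. \<Sum>b\<in>B. if R a b then 1 else 0)"
    using assms by (intro sum.cong) (auto simp: sum.If_cases Int_def)
  also have "\<dots> = (\<Sum>b\<in>B. \<Sum>a\<in>A. if R a b then 1 else 0)"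
    by (rule sum.swap)
  also have "\<dots> = (\<Sum>b\<in>B. card {a \<in> A. R a b})"
    using assms by (intro sum.cong) (auto simp: sum.If_cases Int_def)
  finally show ?thesis .
qed

definition sols :: "'a \<Rightarrow> 'a \<Rightarrow> 'a \<Rightarrow> (nat \<Rightarrow> 'a::field) set \<Rightarrow> ((nat \<Rightarrow> 'a) \<times> (nat \<Rightarrow> 'a) \<times> (nat \<Rightarrow> 'a)) set" where
  "sols a b c T = {(x, y, z). x \<in> T \<and> y \<in> T \<and> z \<in> T \<and> a *v x + b *v y + c *v z = 0}"

lemma finite_sols: "finite T \<Longrightarrow> finite (sols a b c T)"
  by (rule finite_subset[of _ "T \<times> T \<times> T"]) (auto simp: sols_def)

lemma smult_sum3_eq_0_iff: "a *v x + b *v y + c *v z = 0 \<longleftrightarrow> (\<forall>t. a * x t + b * y t + c * z t = 0)"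
  for a :: "'a::field"
  by (simp add: fun_eq_iff)

text \<open>Deleting the first entry of every nontrivial solution costs at most one element per
  solution and leaves only trivial ones.\<close>

lemma deletion_bound:
  fixes T :: "(nat \<Rightarrow> 'a::{field,finite}) set" and B :: real
  assumes bound: "\<And>T'. \<lbrakk>T' \<subseteq> T; \<And>x y z. (x, y, z) \<in> sols a b c T' \<Longrightarrow> x = y \<and> y = z\<rbrakk> \<Longrightarrow> real (card T') \<le> B"
    and T: "finite T"
  shows "card T \<le> B + card {(x, y, z) \<in> sols a b c T. \<not> (x = y \<and> y = z)}"
proof -
  define X where "X = {(x, y, z) \<in> sols a b c T. \<not> (x = y \<and> y = z)}"
  have finX: "finite X"
    using finite_sols[OF T] by (auto simp: X_def intro: finite_subset)
  have "x = y \<and> y = z" if "(x, y, z) \<in> sols a b c (T - fst ` X)" for x y z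
  proof (rule ccontr)
    assume "\<not> (x = y \<and> y = z)"
    with that have "(x, y, z) \<in> X"
      by (auto simp: X_def sols_def)
    then have "x \<in> fst ` X"
      by force
    with that show False
      by (simp add: sols_def)
  qed
  then have "real (card (T - fst ` X)) \<le> B"
    by (intro bound) auto
  moreover have "card T \<le> card (T - fst ` X) + card (fst ` X)"
    using finX T by (metis card_Un_le card_mono finite_Diff finite_UnI finite_imageI Un_Diff_cancel2 Un_upper1 order_trans)
  moreover have "card (fst ` X) \<le> card X"
    by (rule card_image_le[OF finX])
  ultimately show ?thesis
    unfolding X_def by linarith
qed

text \<open>An affine map from \<open>Fqn d\<close> to \<open>Fqn n\<close> given by
  \<open>d + 1\<close> free vectors: \<open>p d\<close> is the translation and \<open>p i\<close>
  the image of the i-th unit vector. It need not be injective, so averages run over all choices of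
  \<open>p\<close> independently.\<close>

definition aff_map :: "nat \<Rightarrow> (nat \<Rightarrow> nat \<Rightarrow> 'a::field) \<Rightarrow> (nat \<Rightarrow> 'a) \<Rightarrow> nat \<Rightarrow> 'a" where
  "aff_map d p u = p d + (\<Sum>i<d. u i *v p i)"

lemma aff_map_sol:
  assumes "a + b + c = 0" "a *v u + b *v v + c *v w = 0"
  shows "a *v aff_map d p u + b *v aff_map d p v + c *v aff_map d p w = 0"
proof
  fix t
  have eq: "a * u i + b * v i + c * w i = 0" for i
    using assms(2) by (simp add: fun_eq_iff)
  have "(a *v aff_map d p u + b *v aff_map d p v + c *v aff_map d p w) t =
      (a + b + c) * p d t + (\<Sum>i<d. (a * u i + b * v i + c * w i) * p i t)"
    by (simp add: aff_map_def sum_fun_apply algebra_simps sum.distrib sum_distrib_left)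
  also have "\<dots> = 0"
    by (simp only: assms(1) eq) simp
  finally show "(a *v aff_map d p u + b *v aff_map d p v + c *v aff_map d p w) t = 0 t"
    by simp
qed

text \<open>Once the directions and the image of \<open>u\<close> in \<open>T\<close> are fixed, the
  translation \<open>p d\<close> is forced.\<close>

lemma card_aff_map_ge:
  fixes T :: "(nat \<Rightarrow> 'a::{field,finite}) set"
  assumes T: "T \<subseteq> Fqn n"
  shows "card T * (CARD('a) ^ n) ^ d \<le> card {p \<in> {..d} \<rightarrow>\<^sub>E Fqn n. aff_map d p u \<in> T}"
proof -
  let ?G = "{..<d} \<rightarrow>\<^sub>E (Fqn n :: (nat \<Rightarrow> 'a) set)"
  let ?f = "\<lambda>(y, g). g(d := y - (\<Sum>i<d. u i *v g i))"
  have "inj_on ?f (T \<times> ?G)"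
  proof (rule inj_onI, clarify)
    fix y g y' g'
    assume g: "g \<in> ?G" "g' \<in> ?G"
      and eq: "g(d := y - (\<Sum>i<d. u i *v g i)) = g'(d := y' - (\<Sum>i<d. u i *v g' i))"
    have "g i = g' i" if "i < d" for i
      using fun_cong[OF eq, of i] that by simp
    then have "g = g'"
      using g by (intro PiE_ext[of g _ _ g']) auto
    moreover have "y = y'"
      using fun_cong[OF eq, of d] \<open>g = g'\<close> by (simp add: fun_eq_iff)
    ultimately show "y = y' \<and> g = g'" by simp
  qed
  moreover have "?f ` (T \<times> ?G) \<subseteq> {p \<in> {..d} \<rightarrow>\<^sub>E Fqn n. aff_map d p u \<in> T}"
  proof clarify
    fix y g assume y: "y \<in> T" and g: "g \<in> ?G"
    let ?p = "g(d := y - (\<Sum>i<d. u i *v g i))"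
    have "g i \<in> Fqn n" if "i < d" for i
      using g that by auto
    then have "y - (\<Sum>i<d. u i *v g i) \<in> Fqn n"
      using y T by (intro Fqn_closed Fqn_sum) auto
    then have "?p \<in> insert d {..<d} \<rightarrow>\<^sub>E Fqn n"
      using g by (intro PiE_fun_upd) auto
    moreover have "insert d {..<d} = {..d}"
      by auto
    moreover have "aff_map d ?p u = y"
      by (simp add: aff_map_def)
    ultimately show "?p \<in> {..d} \<rightarrow>\<^sub>E Fqn n \<and> aff_map d ?p u \<in> T"
      using y by simp
  qed
  moreover have "finite {p \<in> {..d} \<rightarrow>\<^sub>E (Fqn n :: (nat \<Rightarrow> 'a) set). aff_map d p u \<in> T}"
    by (intro finite_subset[OF _ finite_PiE[of "{..d}" "\<lambda>_. Fqn n"]]) (auto simp: finite_Fqn)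
  ultimately have "card (T \<times> ?G) \<le> card {p \<in> {..d} \<rightarrow>\<^sub>E Fqn n. aff_map d p u \<in> T}"
    by (rule card_inj_on_le)
  then show ?thesis
    by (simp add: card_cartesian_product card_funcsetE card_Fqn)
qed

text \<open>Pairwise independence of a random affine map: with the other directions fixed, the
  images of \<open>u\<close> and \<open>v\<close> give two equations for \<open>p d\<close> and
  \<open>p i\<close>, with determinant \<open>u i - v i\<close> up to sign. So each solution in
  \<open>T\<close> fixes \<open>p d\<close> and \<open>p i\<close>.\<close>

lemma card_aff_map_sols_le:
  fixes T :: "(nat \<Rightarrow> 'a::{field,finite}) set"
  assumes T: "T \<subseteq> Fqn n" and i: "i < d" "u i \<noteq> v i"
  shows "card {p \<in> {..d} \<rightarrow>\<^sub>E Fqn n. (aff_map d p u, aff_map d p v, aff_map d p w) \<in> sols a b c T}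
    \<le> card (sols a b c T) * (CARD('a) ^ n) ^ (d - 1)"
proof -
  let ?P = "{p \<in> {..d} \<rightarrow>\<^sub>E Fqn n. (aff_map d p u, aff_map d p v, aff_map d p w) \<in> sols a b c T}"
  let ?G = "({..<d} - {i}) \<rightarrow>\<^sub>E (Fqn n :: (nat \<Rightarrow> 'a) set)"
  let ?f = "\<lambda>p. ((aff_map d p u, aff_map d p v, aff_map d p w), restrict p ({..<d} - {i}))"
  have fin: "finite (sols a b c T)"
    using T finite_Fqn finite_subset by (blast intro: finite_sols)
  have diff: "aff_map d p u t - aff_map d p' u t = (p d t - p' d t) + u i * (p i t - p' i t)"
    if "\<And>j. j < d \<Longrightarrow> j \<noteq> i \<Longrightarrow> p j = p' j" for p p' :: "nat \<Rightarrow> nat \<Rightarrow> 'a" and u t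
  proof -
    have "aff_map d p u t - aff_map d p' u t = (p d t - p' d t) + (\<Sum>j<d. u j * (p j t - p' j t))"
      by (simp add: aff_map_def sum_fun_apply algebra_simps sum_subtractf)
    also have "(\<Sum>j<d. u j * (p j t - p' j t)) = (\<Sum>j\<in>{i}. u j * (p j t - p' j t))"
      using i that by (intro sum.mono_neutral_right) auto
    finally show ?thesis by simp
  qed
  have "inj_on ?f ?P"
  proof (rule inj_onI)
    fix p p' assume p: "p \<in> ?P" "p' \<in> ?P" and eq: "?f p = ?f p'"
    have eq': "aff_map d p u = aff_map d p' u" "aff_map d p v = aff_map d p' v"
        "restrict p ({..<d} - {i}) = restrict p' ({..<d} - {i})"
      using eq by (simp_all only: prod.inject)
    have other: "p j = p' j" if "j < d" "j \<noteq> i" for j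
      using fun_cong[OF eq'(3), of j] that by simp
    have zero: "(p d t - p' d t) + u i * (p i t - p' i t) = 0" "(p d t - p' d t) + v i * (p i t - p' i t) = 0" for t
    proof -
      have "aff_map d p u t - aff_map d p' u t = (p d t - p' d t) + u i * (p i t - p' i t)"
        "aff_map d p v t - aff_map d p' v t = (p d t - p' d t) + v i * (p i t - p' i t)"
        by (rule diff, erule (1) other)+
      then show "(p d t - p' d t) + u i * (p i t - p' i t) = 0" "(p d t - p' d t) + v i * (p i t - p' i t) = 0"
        using eq'(1,2) by simp_all
    qed
    have "p i t = p' i t \<and> p d t = p' d t" for t
    proof -
      have "(u i - v i) * (p i t - p' i t) = ((p d t - p' d t) + u i * (p i t - p' i t)) - ((p d t - p' d t) + v i * (p i t - p' i t))"
        by (simp add: algebra_simps)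
      also have "\<dots> = 0"
        by (simp only: zero diff_self)
      finally have "(u i - v i) * (p i t - p' i t) = 0" .
      then have "p i t = p' i t"
        using i(2) by simp
      then show ?thesis
        using zero(1)[of t] by simp
    qed
    then have "p i = p' i" "p d = p' d"
      by auto
    then have "p j = p' j" if "j \<in> {..d}" for j
      using other[of j] that by (cases "j = d"; cases "j = i") auto
    then show "p = p'"
      using p by (intro PiE_ext[of p "{..d}" "\<lambda>_. Fqn n" p']) auto
  qed
  moreover have "?f ` ?P \<subseteq> sols a b c T \<times> ?G"
    by (auto intro!: restrict_PiE_iff[THEN iffD2])
  moreover have "finite (sols a b c T \<times> ?G)"
    using fin by (simp add: finite_PiE finite_Fqn)
  ultimately have "card ?P \<le> card (sols a b c T \<times> ?G)"
    by (rule card_inj_on_le)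
  also have "\<dots> = card (sols a b c T) * (CARD('a) ^ n) ^ (d - 1)"
    using i by (simp add: card_cartesian_product card_funcsetE card_Fqn)
  finally show ?thesis .
qed

text \<open>The deletion bound is averaged over the pullbacks of \<open>T\<close> along all affine
  maps from \<open>Fqn d\<close>. A pullback has on average at least \<open>q ^ d\<close> times the
  density of \<open>T\<close> many points, and each of the at most \<open>q ^ (2 * d)\<close>
  nontrivial solutions lands in \<open>sols a b c T\<close> with probability at most
  \<open>card (sols a b c T) / Q ^ 2\<close>, where \<open>Q = q ^ n\<close>.\<close>

lemma supersaturation_step:
  fixes T :: "(nat \<Rightarrow> 'a::{field,finite}) set" and B :: real
  assumes abc: "a \<noteq> 0" "b \<noteq> 0" "c \<noteq> 0" "a + b + c = 0" and T: "T \<subseteq> Fqn n" and d: "d \<ge> 1"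
    and bound: "\<And>T'. \<lbrakk>T' \<subseteq> Fqn d; \<And>x y z. (x, y, z) \<in> sols a b c T' \<Longrightarrow> x = y \<and> y = z\<rbrakk> \<Longrightarrow> real (card T') \<le> B"
  shows "real CARD('a) ^ d * (card T / real CARD('a) ^ n) \<le> B + (real CARD('a) ^ d)\<^sup>2 * card (sols a b c T) / (real CARD('a) ^ n)\<^sup>2"
proof -
  define Q where "Q = CARD('a) ^ n"
  define q where "q = CARD('a)"
  define F where "F = (Fqn d :: (nat \<Rightarrow> 'a) set)"
  define P where "P = ({..d} \<rightarrow>\<^sub>E Fqn n :: (nat \<Rightarrow> nat \<Rightarrow> 'a) set)"
  define NT where "NT = {(x, y, z) \<in> sols a b c F. \<not> (x = y \<and> y = z)}"
  define \<Theta> where "\<Theta> p = (\<lambda>(u, v, w). (aff_map d p u, aff_map d p v, aff_map d p w))" for p :: "nat \<Rightarrow> nat \<Rightarrow> 'a"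
  have q: "q > 0" and Q: "Q > 0"
    by (simp_all add: q_def Q_def)
  have finF: "finite F" and finP: "finite P"
    by (auto simp: F_def P_def finite_Fqn finite_PiE)
  have cardF: "card F = q ^ d" and cardP: "card P = Q ^ Suc d"
    by (simp_all add: F_def P_def q_def Q_def card_Fqn card_funcsetE)
  have finNT: "finite NT"
    using finite_sols[OF finF] by (auto simp: NT_def intro: finite_subset)
  \<comment> \<open>Nontriviality already shows in the first two entries: \<open>u = v\<close>
    forces \<open>w = u\<close> because \<open>a + b = - c\<close>.\<close>
  have NT_ne: "\<exists>i<d. u i \<noteq> v i" if "(u, v, w) \<in> NT" for u v w
  proof (rule ccontr)
    assume "\<not> ?thesis"
    moreover have "u i = 0 \<and> v i = 0" if "i \<ge> d" for i
      using \<open>(u, v, w) \<in> NT\<close> that by (auto simp: NT_def sols_def F_def Fqn_def)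
    ultimately have uv: "u = v"
      by (metis ext not_less)
    have "u t = w t" for t
    proof -
      have "a * u t + b * u t + c * w t = 0"
        using that uv by (auto simp: NT_def sols_def smult_sum3_eq_0_iff)
      moreover have "c * (u t - w t) = (a + b + c) * u t - (a * u t + b * u t + c * w t)"
        by (simp only: distrib_right right_diff_distrib) simp
      ultimately have "c * (u t - w t) = 0"
        by (simp only: abc mult_zero_left diff_self)
      then show ?thesis
        using abc by simp
    qed
    then have "u = w"
      by auto
    then show False
      using that uv by (auto simp: NT_def)
  qed
  have cardNT: "card NT \<le> (q ^ d)\<^sup>2"
  proof -
    have "inj_on (\<lambda>(u, v, w). (u, v)) NT"
    proof (rule inj_onI)
      fix s s' assume s: "s \<in> NT" "s' \<in> NT" and eq: "(\<lambda>(u, v, w). (u, v)) s = (\<lambda>(u, v, w). (u, v)) s'"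
      obtain u v w w' where uvw: "s = (u, v, w)" "s' = (u, v, w')"
        using eq by (cases s; cases s') auto
      from s[unfolded uvw] have "a * u t + b * v t + c * w t = 0" "a * u t + b * v t + c * w' t = 0" for t
        by (auto simp: NT_def sols_def smult_sum3_eq_0_iff)
      then have "c * w t = c * w' t" for t
        by (metis add_left_imp_eq)
      then show "s = s'"
        using abc by (auto simp: fun_eq_iff uvw)
    qed
    moreover have "(\<lambda>(u, v, w). (u, v)) ` NT \<subseteq> F \<times> F"
      by (auto simp: NT_def sols_def)
    ultimately have "card NT \<le> card (F \<times> F)"
      using finF by (intro card_inj_on_le) auto
    then show ?thesis
      by (simp add: card_cartesian_product cardF power2_eq_square)
  qed
  have "q ^ d * (card T * Q ^ d) = (\<Sum>u\<in>F. card T * Q ^ d)"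
    by (simp add: cardF)
  also have "\<dots> \<le> (\<Sum>u\<in>F. card {p \<in> P. aff_map d p u \<in> T})"
    unfolding P_def Q_def by (intro sum_mono card_aff_map_ge[OF T])
  also have "\<dots> = (\<Sum>p\<in>P. card {u \<in> F. aff_map d p u \<in> T})"
    by (rule sum_card_swap[OF finF finP])
  finally have "real (q ^ d * (card T * Q ^ d)) \<le> (\<Sum>p\<in>P. real (card {u \<in> F. aff_map d p u \<in> T}))"
    unfolding of_nat_sum[symmetric] of_nat_le_iff .
  also have "\<dots> \<le> (\<Sum>p\<in>P. B + card {s \<in> NT. \<Theta> p s \<in> sols a b c T})"
  proof (rule sum_mono)
    fix p
    define Tp where "Tp = {u \<in> F. aff_map d p u \<in> T}"
    have TpF: "Tp \<subseteq> F"
      by (auto simp: Tp_def)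
    have "card Tp \<le> B + card {(x, y, z) \<in> sols a b c Tp. \<not> (x = y \<and> y = z)}"
    proof (rule deletion_bound)
      show "finite Tp"
        using TpF finF by (rule finite_subset)
      fix T' assume T': "T' \<subseteq> Tp" and triv: "\<And>x y z. (x, y, z) \<in> sols a b c T' \<Longrightarrow> x = y \<and> y = z"
      show "real (card T') \<le> B"
        by (rule bound) (use T' TpF triv in \<open>auto simp: F_def\<close>)
    qed
    also have "{(x, y, z) \<in> sols a b c Tp. \<not> (x = y \<and> y = z)} \<subseteq> {s \<in> NT. \<Theta> p s \<in> sols a b c T}"
      using aff_map_sol[OF abc(4)] by (auto simp: NT_def \<Theta>_def sols_def Tp_def)
    then have "card {(x, y, z) \<in> sols a b c Tp. \<not> (x = y \<and> y = z)} \<le> card {s \<in> NT. \<Theta> p s \<in> sols a b c T}"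
      using finNT by (intro card_mono) auto
    finally show "real (card {u \<in> F. aff_map d p u \<in> T}) \<le> B + card {s \<in> NT. \<Theta> p s \<in> sols a b c T}"
      unfolding Tp_def by simp
  qed
  also have "\<dots> = B * Q ^ Suc d + real (\<Sum>p\<in>P. card {s \<in> NT. \<Theta> p s \<in> sols a b c T})"
    by (simp add: sum.distrib cardP)
  also have "(\<Sum>p\<in>P. card {s \<in> NT. \<Theta> p s \<in> sols a b c T}) = (\<Sum>s\<in>NT. card {p \<in> P. \<Theta> p s \<in> sols a b c T})"
    by (rule sum_card_swap[OF finP finNT])
  also have "\<dots> \<le> (\<Sum>s\<in>NT. card (sols a b c T) * Q ^ (d - 1))"
  proof (rule sum_mono)
    fix s assume s: "s \<in> NT"
    obtain u v w where uvw: "s = (u, v, w)"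
      by (cases s) auto
    obtain i where i: "i < d" "u i \<noteq> v i"
      using NT_ne s uvw by blast
    show "card {p \<in> P. \<Theta> p s \<in> sols a b c T} \<le> card (sols a b c T) * Q ^ (d - 1)"
      using card_aff_map_sols_le[where u = u and v = v, OF T i] by (simp add: uvw \<Theta>_def P_def Q_def)
  qed
  also have "\<dots> \<le> (q ^ d)\<^sup>2 * (card (sols a b c T) * Q ^ (d - 1))"
    using cardNT by simp
  finally have "real (q ^ d * (card T * Q ^ d)) \<le> B * Q ^ Suc d + real ((q ^ d)\<^sup>2 * (card (sols a b c T) * Q ^ (d - 1)))"
    by simp
  \<comment> \<open>Division by the number \<open>Q ^ Suc d\<close> of affine maps turns counts into
    averages.\<close>
  then have "real (q ^ d * (card T * Q ^ d)) / real Q ^ Suc d \<le>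
      (B * Q ^ Suc d + real ((q ^ d)\<^sup>2 * (card (sols a b c T) * Q ^ (d - 1)))) / real Q ^ Suc d"
    by (rule divide_right_mono) simp
  moreover have "real (q ^ d * (card T * Q ^ d)) / real Q ^ Suc d = real q ^ d * (card T / Q)"
    using Q by simp
  moreover have "real Q ^ Suc d = real Q ^ (d - 1) * (real Q)\<^sup>2"
    using d by (cases d) (simp_all add: power2_eq_square mult_ac)
  then have "(B * Q ^ Suc d + real ((q ^ d)\<^sup>2 * (card (sols a b c T) * Q ^ (d - 1)))) / real Q ^ Suc d
      = B + (real q ^ d)\<^sup>2 * card (sols a b c T) / (real Q)\<^sup>2"
    using Q by (simp add: add_divide_distrib)
  ultimately show ?thesis
    by (simp add: q_def Q_def)
qed

definition dens :: "nat \<Rightarrow> (nat \<Rightarrow> 'a) set \<Rightarrow> real" where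
  "dens n T = card T / real CARD('a) ^ n"

lemma dens_nonneg [simp]: "0 \<le> dens n T"
  by (simp add: dens_def)

lemma dens_le_1:
  assumes "T \<subseteq> (Fqn n :: (nat \<Rightarrow> 'a::{field,finite}) set)"
  shows "dens n T \<le> 1"
proof -
  have "card T \<le> CARD('a) ^ n"
    using card_mono[OF finite_Fqn assms] by (simp add: card_Fqn)
  then have "real (card T) \<le> real CARD('a) ^ n"
    by (metis of_nat_le_iff of_nat_power)
  then show ?thesis
    by (simp add: dens_def)
qed

lemma card_eq_dens: "real (card T) = dens n T * real CARD('a) ^ n"
  for T :: "(nat \<Rightarrow> 'a::{field,finite}) set"
  by (simp add: dens_def)

text \<open>The rate comes from counting exponents alone, so one \<open>\<gamma>\<close> serves all
  coefficient triples.\<close>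

theorem solution_free_bound:
  "\<exists>\<gamma> :: real. 0 < \<gamma> \<and> \<gamma> < CARD('a::{field,finite}) \<and>
    (\<forall>n (T :: (nat \<Rightarrow> 'a) set) a b c.
      a \<noteq> 0 \<longrightarrow> b \<noteq> 0 \<longrightarrow> c \<noteq> 0 \<longrightarrow> a + b + c = 0 \<longrightarrow> T \<subseteq> Fqn n \<longrightarrow>
      (\<forall>x y z. (x, y, z) \<in> sols a b c T \<longrightarrow> x = y \<and> y = z) \<longrightarrow> card T \<le> 3 * \<gamma> ^ n)"
proof -
  define q where "q = CARD('a)"
  have q: "q \<ge> 2"
    using card_field_ge_2[where 'a = 'a] by (simp add: q_def)
  obtain u :: real where u: "0 < u" "u < 1" "(\<Sum>i<q. u ^ (3 * i)) < q * u ^ (q - 1)"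
    using sum_powers_less[OF q] .
  show ?thesis
  proof (intro exI[of _ "(\<Sum>i<q. u ^ (3 * i)) / u ^ (q - 1)"] conjI allI impI)
    show "0 < (\<Sum>i<q. u ^ (3 * i)) / u ^ (q - 1)"
      using u q by (intro divide_pos_pos sum_pos) (auto simp: lessThan_empty_iff)
    show "(\<Sum>i<q. u ^ (3 * i)) / u ^ (q - 1) < CARD('a)"
      using u by (simp add: pos_divide_less_eq q_def)
    fix n and T :: "(nat \<Rightarrow> 'a) set" and a b c
    assume abc: "a \<noteq> 0" "b \<noteq> 0" "c \<noteq> 0" "a + b + c = 0" and T: "T \<subseteq> Fqn n"
      and triv: "\<forall>x y z. (x, y, z) \<in> sols a b c T \<longrightarrow> x = y \<and> y = z"
    have "card T \<le> 3 * card {\<alpha> \<in> {..<n} \<rightarrow>\<^sub>E {..<CARD('a)}. 3 * (\<Sum>t<n. \<alpha> t) \<le> (CARD('a) - 1) * n}"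
      by (rule card_no_nontrivial_solution[OF abc T]) (use triv in \<open>simp add: sols_def smult_sum3_eq_0_iff\<close>)
    then have "real (card T) \<le> 3 * real (card {\<alpha> \<in> {..<n} \<rightarrow>\<^sub>E {..<q}. 3 * (\<Sum>t<n. \<alpha> t) \<le> (q - 1) * n})"
      unfolding q_def by linarith
    also have "\<dots> \<le> 3 * ((\<Sum>i<q. u ^ (3 * i)) / u ^ (q - 1)) ^ n"
      using card_low_weight_exponents[OF u(1,2), of n q] by linarith
    finally show "card T \<le> 3 * ((\<Sum>i<q. u ^ (3 * i)) / u ^ (q - 1)) ^ n" .
  qed
qed

text \<open>Because solution-free sets obey a power saving, a dimension \<open>d\<close> logarithmic
  in \<open>1 / dens n T\<close> already forces nontrivial solutions, and the loss caused by
  \<open>q ^ d\<close> stays polynomial in the density.\<close>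

theorem supersaturation:
  fixes a b c :: "'a::{field,finite}"
  assumes abc: "a \<noteq> 0" "b \<noteq> 0" "c \<noteq> 0" "a + b + c = 0"
  shows "\<exists>\<kappa>>0. \<exists>L. \<forall>n T. T \<subseteq> Fqn n \<longrightarrow> \<kappa> * dens n T ^ L * (real CARD('a) ^ n)\<^sup>2 \<le> card (sols a b c T)"
proof -
  define q where "q = real CARD('a)"
  have q: "q \<ge> 2"
    using card_field_ge_2[where 'a = 'a] unfolding q_def by simp
  obtain \<gamma> :: real where \<gamma>: "0 < \<gamma>" "\<gamma> < CARD('a)"
    and bound: "\<forall>n (T :: (nat \<Rightarrow> 'a) set) a b c.
      a \<noteq> 0 \<longrightarrow> b \<noteq> 0 \<longrightarrow> c \<noteq> 0 \<longrightarrow> a + b + c = 0 \<longrightarrow> T \<subseteq> Fqn n \<longrightarrow>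
      (\<forall>x y z. (x, y, z) \<in> sols a b c T \<longrightarrow> x = y \<and> y = z) \<longrightarrow> card T \<le> 3 * \<gamma> ^ n"
    using solution_free_bound[where 'a = 'a] by (elim exE conjE) (rule that)
  \<comment> \<open>\<open>L\<close> measures the saving: for \<open>d = L * e\<close> the ratio of
    \<open>\<gamma> ^ d\<close> to \<open>q ^ d\<close> is at most \<open>1 / q ^ e\<close>.\<close>
  obtain L where L: "(\<gamma> / q) ^ L < 1 / q"
    using real_arch_pow_inv[of "1 / q" "\<gamma> / q"] \<gamma> q by (auto simp: q_def)
  have "L \<noteq> 0"
    using L q by (intro notI) simp
  define \<kappa> where "\<kappa> = 1 / (2 * (6 * q) ^ L)"
  have "\<kappa> > 0"
    using q by (simp add: \<kappa>_def)
  moreover have "\<kappa> * dens n T ^ Suc L * (real CARD('a) ^ n)\<^sup>2 \<le> card (sols a b c T)"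
    if T: "T \<subseteq> Fqn n" for n and T :: "(nat \<Rightarrow> 'a) set"
  proof (cases "dens n T = 0")
    case False
    define \<delta> where "\<delta> = dens n T"
    define N where "N = card (sols a b c T) / (q ^ n)\<^sup>2"
    have \<delta>: "0 < \<delta>" "\<delta> \<le> 1"
      using False dens_le_1[OF T] by (auto simp: \<delta>_def less_le)
    \<comment> \<open>The dimension \<open>d\<close> below makes \<open>q ^ d * \<delta>\<close> twice as large as the bound \<open>3 * \<gamma> ^ d\<close>,
      while \<open>q ^ d\<close> stays polynomial in \<open>1 / \<delta>\<close>.\<close>
    define e where "e = (LEAST e. 6 / \<delta> \<le> q ^ e)"
    have "\<exists>e. 6 / \<delta> \<le> q ^ e"
      using real_arch_pow[of q "6 / \<delta>"] q by (auto intro: less_imp_le)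
    then have e: "6 / \<delta> \<le> q ^ e"
      unfolding e_def by (rule LeastI_ex)
    have "6 \<le> 6 / \<delta>"
      using \<delta> by (simp add: pos_le_divide_eq)
    then have "e \<noteq> 0"
      using e by (intro notI) simp
    then obtain e' where e': "e = Suc e'"
      by (cases e) auto
    then have "\<not> 6 / \<delta> \<le> q ^ e'"
      unfolding e_def by (intro not_less_Least) simp
    then have e_le: "q ^ e \<le> 6 * q / \<delta>"
      using q mult_left_mono[of "q ^ e'" "6 / \<delta>" q] by (simp add: e' mult.commute)
    define d where "d = L * e"
    have d: "d \<ge> 1"
      using \<open>L \<noteq> 0\<close> \<open>e \<noteq> 0\<close> by (simp add: d_def Suc_le_eq)
    have "q ^ d * \<delta> \<le> 3 * \<gamma> ^ d + (q ^ d)\<^sup>2 * card (sols a b c T) / (q ^ n)\<^sup>2"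
      unfolding q_def \<delta>_def dens_def
    proof (rule supersaturation_step[OF abc T d])
      fix T' :: "(nat \<Rightarrow> 'a) set"
      assume T': "T' \<subseteq> Fqn d" and triv: "\<And>x y z. (x, y, z) \<in> sols a b c T' \<Longrightarrow> x = y \<and> y = z"
      show "real (card T') \<le> 3 * \<gamma> ^ d"
        by (intro bound[rule_format, OF abc T'] triv)
    qed
    then have main: "q ^ d * \<delta> \<le> 3 * \<gamma> ^ d + (q ^ d)\<^sup>2 * N"
      by (simp add: N_def)
    have "3 * \<gamma> ^ d = 3 * q ^ d * ((\<gamma> / q) ^ L) ^ e"
      using q by (simp add: d_def power_divide flip: power_mult)
    also have "\<dots> \<le> 3 * q ^ d * (1 / q) ^ e"
      using L q \<gamma> by (intro mult_left_mono power_mono) auto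
    also have "\<dots> = q ^ d * (3 / q ^ e)"
      by (simp add: power_divide)
    also have "\<dots> \<le> q ^ d * (\<delta> / 2)"
      using e \<delta> q by (intro mult_left_mono) (auto simp: field_simps)
    finally have "q ^ d * (\<delta> / 2) \<le> (q ^ d)\<^sup>2 * N"
      using main by (simp add: algebra_simps)
    then have "q ^ d * (\<delta> / 2) \<le> q ^ d * (q ^ d * N)"
      by (simp add: power2_eq_square mult.assoc)
    then have half: "\<delta> / 2 \<le> q ^ d * N"
      using q by simp
    have N: "0 \<le> N"
      by (simp add: N_def)
    have "q ^ d = (q ^ e) ^ L"
      by (simp add: d_def mult.commute flip: power_mult)
    also have "\<dots> \<le> (6 * q / \<delta>) ^ L"
      using e_le q by (intro power_mono) auto
    finally have "\<delta> / 2 \<le> (6 * q / \<delta>) ^ L * N"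
      using half mult_right_mono[OF _ N] by (meson order_trans)
    then have "\<delta> / 2 * \<delta> ^ L \<le> (6 * q) ^ L * N"
      using \<delta> by (simp add: power_divide field_simps)
    then have "\<kappa> * \<delta> ^ Suc L \<le> N"
      using q by (simp add: \<kappa>_def field_simps)
    then show ?thesis
      using q by (simp add: N_def \<delta>_def field_simps q_def)
  qed simp
  ultimately show ?thesis
    by blast
qed

text \<open>Cauchy-Schwarz for the fibre sizes of \<open>f\<close>; it supplies the additive energy
  bound needed when a partial coefficient sum vanishes.\<close>

lemma card_collisions_ge:
  assumes A: "finite A" and B: "finite B" and f: "f ` A \<subseteq> B"
  shows "(real (card A))\<^sup>2 \<le> card B * card {(a, a') \<in> A \<times> A. f a = f a'}"
proof -
  let ?n = "\<lambda>b. real (card {a \<in> A. f a = b})"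
  have "real (card A) = (\<Sum>b\<in>B. ?n b)"
    using sum.group[OF A B f, of "\<lambda>_. 1 :: real"] by simp
  moreover have "card {(a, a') \<in> A \<times> A. f a = f a'} = (\<Sum>b\<in>B. (card {a \<in> A. f a = b})\<^sup>2)"
  proof -
    have "{(a, a') \<in> A \<times> A. f a = f a'} = (\<Union>b\<in>B. {a \<in> A. f a = b} \<times> {a \<in> A. f a = b})"
      using f by auto
    moreover have "card \<dots> = (\<Sum>b\<in>B. card ({a \<in> A. f a = b} \<times> {a \<in> A. f a = b}))"
      using A B by (intro card_UN_disjoint) auto
    ultimately show ?thesis
      by (simp add: card_cartesian_product power2_eq_square)
  qed
  ultimately show ?thesis
    using sum_squared_le_sum_of_squares[of ?n B] by (simp add: mult.commute)
qed

section \<open>Representation counts of linear forms\<close>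

definition reps :: "'j set \<Rightarrow> ('j \<Rightarrow> 'a::field) \<Rightarrow> (nat \<Rightarrow> 'a) set \<Rightarrow> (nat \<Rightarrow> 'a) \<Rightarrow> nat" where
  "reps J c T h = card {x \<in> J \<rightarrow>\<^sub>E T. (\<Sum>j\<in>J. c j *v x j) = h}"

text \<open>Fixing the value \<open>y\<close> at the index \<open>j\<close> gives the recursion on
  which all popularity steps rest.\<close>

lemma reps_insert:
  assumes J: "finite J" "j \<notin> J" and T: "finite T"
  shows "reps (insert j J) c T h = (\<Sum>y\<in>T. reps J c T (h - c j *v y))"
proof -
  let ?X = "\<lambda>y. {x \<in> J \<rightarrow>\<^sub>E T. (\<Sum>j\<in>J. c j *v x j) = h - c j *v y}"
  let ?f = "\<lambda>(y, x). x(j := y)"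
  have sum: "(\<Sum>i\<in>insert j J. c i *v (x(j := y)) i) = c j *v y + (\<Sum>i\<in>J. c i *v x i)" for x y
  proof -
    have "(\<Sum>i\<in>J. c i *v (x(j := y)) i) = (\<Sum>i\<in>J. c i *v x i)"
      using J by (intro sum.cong) auto
    then show ?thesis
      using J by simp
  qed
  have "bij_betw ?f (SIGMA y:T. ?X y) {x \<in> insert j J \<rightarrow>\<^sub>E T. (\<Sum>j\<in>insert j J. c j *v x j) = h}"
  proof (rule bij_betw_imageI)
    show "inj_on ?f (SIGMA y:T. ?X y)"
    proof (rule inj_onI)
      fix s s' assume s: "s \<in> (SIGMA y:T. ?X y)" "s' \<in> (SIGMA y:T. ?X y)" and eq: "?f s = ?f s'"
      obtain y x y' x' where yx: "s = (y, x)" "s' = (y', x')"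
        by (cases s; cases s')
      have upd: "x(j := y) = x'(j := y')"
        using eq by (simp add: yx)
      have "x i = x' i" if "i \<in> J" for i
        using fun_cong[OF upd, of i] that J by (cases "i = j") auto
      then have "x = x'"
        using s by (intro PiE_ext[of x J "\<lambda>_. T" x']) (auto simp: yx)
      then show "s = s'"
        using fun_cong[OF upd, of j] by (simp add: yx)
    qed
    show "?f ` (SIGMA y:T. ?X y) = {x \<in> insert j J \<rightarrow>\<^sub>E T. (\<Sum>j\<in>insert j J. c j *v x j) = h}"
    proof (intro subset_antisym subsetI)
      fix g assume "g \<in> ?f ` (SIGMA y:T. ?X y)"
      then obtain y x where g: "g = x(j := y)" "y \<in> T" "x \<in> ?X y"
        by auto
      then have "g \<in> insert j J \<rightarrow>\<^sub>E T"
        by (simp only: g(1)) (intro PiE_fun_upd, auto)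
      moreover have "(\<Sum>i\<in>insert j J. c i *v g i) = h"
        unfolding g(1) sum using g(3) by simp
      ultimately show "g \<in> {x \<in> insert j J \<rightarrow>\<^sub>E T. (\<Sum>j\<in>insert j J. c j *v x j) = h}"
        by simp
    next
      fix g assume g: "g \<in> {x \<in> insert j J \<rightarrow>\<^sub>E T. (\<Sum>j\<in>insert j J. c j *v x j) = h}"
      let ?x = "restrict g J"
      have eq: "g = ?x(j := g j)"
        using g by (auto simp: fun_eq_iff PiE_def extensional_def)
      then have "c j *v g j + (\<Sum>i\<in>J. c i *v ?x i) = h"
        using g sum[of ?x "g j"] by simp
      then have "?x \<in> ?X (g j)"
        using g by (auto simp: algebra_simps)
      then have "(g j, ?x) \<in> (SIGMA y:T. ?X y)"
        using g by auto
      then show "g \<in> ?f ` (SIGMA y:T. ?X y)"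
        using eq by (intro image_eqI[of _ _ "(g j, ?x)"]) auto
    qed
  qed
  then have "reps (insert j J) c T h = card (SIGMA y:T. ?X y)"
    unfolding reps_def by (simp add: bij_betw_same_card)
  also have "\<dots> = (\<Sum>y\<in>T. reps J c T (h - c j *v y))"
    unfolding reps_def using J T by (intro card_SigmaI) (auto simp: finite_PiE)
  finally show ?thesis .
qed

section \<open>Popular values of a linear form\<close>

text \<open>The value \<open>(\<Sum>j\<in>J. c j) *v z\<close> is the one taken by the constant
  tuple \<open>z\<close>, and \<open>(q ^ n) ^ (card J - 1)\<close> is the generic number of
  representations. \<open>\<kappa>\<close> and \<open>L\<close> may depend on \<open>J\<close> and
  \<open>c\<close> but not on \<open>n\<close> or \<open>T\<close>. A single point is demanded,
  since this weak form improves itself to most points of \<open>T\<close>.\<close>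

definition popular :: "'j set \<Rightarrow> ('j \<Rightarrow> 'a::{field,finite}) \<Rightarrow> bool" where
  "popular J c \<longleftrightarrow> (\<exists>\<kappa>>0. \<exists>L. \<forall>n T. T \<subseteq> Fqn n \<longrightarrow> T \<noteq> {} \<longrightarrow>
    (\<exists>z\<in>T. \<kappa> * dens n T ^ L * (real CARD('a) ^ n) ^ (card J - 1) \<le> reps J c T ((\<Sum>j\<in>J. c j) *v z)))"

lemma finite_subset_Fqn: "T \<subseteq> Fqn n \<Longrightarrow> finite T"
  for T :: "(nat \<Rightarrow> 'a::{field,finite}) set"
  by (rule finite_subset[OF _ finite_Fqn])

lemma card_le_Fqn: "T \<subseteq> Fqn n \<Longrightarrow> real (card T) \<le> real CARD('a) ^ n"
  for T :: "(nat \<Rightarrow> 'a::{field,finite}) set"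
  using dens_le_1[of T n] by (simp add: dens_def)

lemma reps_mono:
  assumes "T' \<subseteq> T" "finite T" "finite J"
  shows "reps J c T' h \<le> reps J c T h"
  unfolding reps_def
proof (rule card_mono)
  show "finite {x \<in> J \<rightarrow>\<^sub>E T. (\<Sum>j\<in>J. c j *v x j) = h}"
    using assms by (simp add: finite_PiE)
  have "J \<rightarrow>\<^sub>E T' \<subseteq> J \<rightarrow>\<^sub>E T"
    using assms(1) by (intro PiE_mono)
  then show "{x \<in> J \<rightarrow>\<^sub>E T'. (\<Sum>j\<in>J. c j *v x j) = h} \<subseteq> {x \<in> J \<rightarrow>\<^sub>E T. (\<Sum>j\<in>J. c j *v x j) = h}"
    by blast
qed

lemma reps_empty: "reps {} c T h = (if h = 0 then 1 else 0)"
  by (simp add: reps_def)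

text \<open>Popularity, applied to the set of bad points itself, contradicts their badness.\<close>
lemma popular_abundant:
  fixes c :: "'j \<Rightarrow> 'a::{field,finite}" and \<eta> :: real
  assumes pop: "popular J c" and J: "finite J" and \<eta>: "0 < \<eta>"
  shows "\<exists>\<kappa>>0. \<exists>L. \<forall>n T. T \<subseteq> Fqn n \<longrightarrow>
    card {z \<in> T. reps J c T ((\<Sum>j\<in>J. c j) *v z) < \<kappa> * dens n T ^ L * (real CARD('a) ^ n) ^ (card J - 1)} \<le> \<eta> * card T"
proof -
  obtain \<kappa> L where \<kappa>: "\<kappa> > 0" and main: "\<forall>n T. T \<subseteq> Fqn n \<longrightarrow> T \<noteq> {} \<longrightarrow>
      (\<exists>z\<in>T. \<kappa> * dens n T ^ L * (real CARD('a) ^ n) ^ (card J - 1) \<le> reps J c T ((\<Sum>j\<in>J. c j) *v z))"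
    using pop unfolding popular_def by blast
  \<comment> \<open>The factor \<open>\<eta> ^ L\<close> pays for passing from \<open>T\<close> to
    the bad set, whose density would exceed \<open>\<eta> * dens n T\<close>.\<close>
  have "card {z \<in> T. reps J c T ((\<Sum>j\<in>J. c j) *v z) < \<kappa> * \<eta> ^ L * dens n T ^ L * (real CARD('a) ^ n) ^ (card J - 1)} \<le> \<eta> * card T"
    (is "real (card ?B) \<le> _") if T: "T \<subseteq> Fqn n" for n T
  proof (rule ccontr)
    assume "\<not> card ?B \<le> \<eta> * card T"
    then have less: "\<eta> * card T < card ?B"
      by simp
    moreover have "0 \<le> \<eta> * card T"
      using \<eta> by simp
    ultimately have "card ?B \<noteq> 0"
      by linarith
    then have "?B \<noteq> {}"
      by (metis card.empty)
    moreover have "?B \<subseteq> Fqn n"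
      using T by auto
    ultimately obtain z where z: "z \<in> ?B"
      and ge: "\<kappa> * dens n ?B ^ L * (real CARD('a) ^ n) ^ (card J - 1) \<le> reps J c ?B ((\<Sum>j\<in>J. c j) *v z)"
      using main by blast
    have "real (reps J c ?B ((\<Sum>j\<in>J. c j) *v z)) \<le> reps J c T ((\<Sum>j\<in>J. c j) *v z)"
      using finite_subset_Fqn[OF T] J by (intro of_nat_mono reps_mono) auto
    also have "\<dots> < \<kappa> * \<eta> ^ L * dens n T ^ L * (real CARD('a) ^ n) ^ (card J - 1)"
      using z by simp
    also have "\<dots> = \<kappa> * (\<eta> * dens n T) ^ L * (real CARD('a) ^ n) ^ (card J - 1)"
      by (simp add: power_mult_distrib)
    also have "\<dots> \<le> \<kappa> * dens n ?B ^ L * (real CARD('a) ^ n) ^ (card J - 1)"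
    proof -
      have "\<eta> * dens n T \<le> dens n ?B"
        using less unfolding dens_def times_divide_eq_right by (intro divide_right_mono) auto
      then have "(\<eta> * dens n T) ^ L \<le> dens n ?B ^ L"
        using \<eta> by (intro power_mono) auto
      then show ?thesis
        using \<kappa> by (intro mult_right_mono mult_left_mono) auto
    qed
    finally show False
      using ge by linarith
  qed
  then show ?thesis
    using \<kappa> \<eta> by (intro exI[of _ "\<kappa> * \<eta> ^ L"] conjI exI[of _ L]) auto
qed

lemma popular_half:
  fixes c :: "'j \<Rightarrow> 'a::{field,finite}"
  assumes pop: "popular J c" and J: "finite J"
  shows "\<exists>\<kappa>>0. \<exists>L. \<forall>n T. T \<subseteq> Fqn n \<longrightarrow> (\<exists>G\<subseteq>T. dens n T / 2 \<le> dens n G \<and>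
    (\<forall>z\<in>G. \<kappa> * dens n T ^ L * (real CARD('a) ^ n) ^ (card J - 1) \<le> reps J c T ((\<Sum>j\<in>J. c j) *v z)))"
proof -
  obtain \<kappa> L where \<kappa>: "\<kappa> > 0" and main: "\<forall>n T. T \<subseteq> Fqn n \<longrightarrow>
    card {z \<in> T. reps J c T ((\<Sum>j\<in>J. c j) *v z) < \<kappa> * dens n T ^ L * (real CARD('a) ^ n) ^ (card J - 1)} \<le> 1 / 2 * card T"
    using popular_abundant[OF pop J, of "1 / 2"] by auto
  have "\<exists>G\<subseteq>T. dens n T / 2 \<le> dens n G \<and>
    (\<forall>z\<in>G. \<kappa> * dens n T ^ L * (real CARD('a) ^ n) ^ (card J - 1) \<le> reps J c T ((\<Sum>j\<in>J. c j) *v z))"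
    if T: "T \<subseteq> Fqn n" for n T
  proof -
    let ?B = "{z \<in> T. reps J c T ((\<Sum>j\<in>J. c j) *v z) < \<kappa> * dens n T ^ L * (real CARD('a) ^ n) ^ (card J - 1)}"
    have "card (T - ?B) = card T - card ?B" "card ?B \<le> card T"
      using finite_subset_Fqn[OF T] by (auto intro!: card_Diff_subset card_mono)
    moreover have "card ?B \<le> 1 / 2 * card T"
      using main T by blast
    ultimately have "card T / 2 \<le> card (T - ?B)"
      by (simp add: of_nat_diff)
    then have "dens n T / 2 \<le> dens n (T - ?B)"
      using divide_right_mono[of "card T / 2" "card (T - ?B)" "real CARD('a) ^ n"] by (simp add: dens_def)
    then show ?thesis
      by (intro exI[of _ "T - ?B"]) (auto simp: not_less)
  qed
  then show ?thesis
    using \<kappa> by blast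
qed

lemma exists_ge_average:
  fixes f :: "'z \<Rightarrow> real" and K :: real
  assumes Z: "finite Z" "Z \<noteq> {}" and M: "M \<le> (\<Sum>z\<in>Z. f z)" and f: "\<And>z. z \<in> Z \<Longrightarrow> 0 \<le> f z" and K: "card Z \<le> K"
  shows "\<exists>z\<in>Z. M \<le> K * f z"
proof -
  have "Max (f ` Z) \<in> f ` Z"
    using Z by (intro Max_in) auto
  then obtain z where "z \<in> Z" "f z = Max (f ` Z)"
    by auto
  then have z: "z \<in> Z" "\<And>y. y \<in> Z \<Longrightarrow> f y \<le> f z"
    using Z by auto
  have "M \<le> card Z * f z"
    using M sum_bounded_above[of Z f "f z"] z by simp
  also have "\<dots> \<le> K * f z"
    using K f[OF z(1)] by (intro mult_right_mono) auto
  finally show ?thesis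
    using z by blast
qed

lemma dens_pos: "T \<subseteq> Fqn n \<Longrightarrow> T \<noteq> {} \<Longrightarrow> 0 < dens n T"
  for T :: "(nat \<Rightarrow> 'a::{field,finite}) set"
  using finite_subset_Fqn[of T n] by (simp add: dens_def card_gt_0_iff)

lemma dens_empty [simp]: "dens n {} = 0"
  by (simp add: dens_def)

lemma popular_singleton:
  fixes c :: "'j \<Rightarrow> 'a::{field,finite}"
  shows "popular {j} c"
proof -
  have "1 * dens n T ^ 0 * (real CARD('a) ^ n) ^ (card {j} - 1) \<le> reps {j} c T ((\<Sum>j\<in>{j}. c j) *v z)"
    if "T \<subseteq> Fqn n" "z \<in> T" for n z and T :: "(nat \<Rightarrow> 'a) set"
  proof -
    have "reps {j} c T (c j *v z) = (\<Sum>y\<in>T. reps {} c T (c j *v z - c j *v y))"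
      using finite_subset_Fqn[OF that(1)] by (intro reps_insert) auto
    also have "\<dots> \<ge> (\<Sum>y\<in>{z}. reps {} c T (c j *v z - c j *v y))"
      using that finite_subset_Fqn[OF that(1)] by (intro sum_mono2) auto
    finally show ?thesis
      by (simp add: reps_empty zero_fun_def)
  qed
  then show ?thesis
    unfolding popular_def by (intro exI[of _ "1 :: real"] exI[of _ "0 :: nat"] conjI) (simp, blast)
qed

lemma smult_eq_iff: "a \<noteq> 0 \<Longrightarrow> a *v x = a *v y \<longleftrightarrow> x = y" for a :: "'a::field"
  by (auto simp: fun_eq_iff)

text \<open>The target is 0 whatever \<open>z\<close> is. Each of the many popular points
  \<open>y\<close> of \<open>J\<close> can be put at the index \<open>j\<close>: it leaves the value
  \<open>- c j *v y\<close>, which is the popular value of \<open>y\<close> for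
  \<open>J\<close>.\<close>

lemma popular_insert_zero_sum:
  fixes c :: "'j \<Rightarrow> 'a::{field,finite}"
  assumes J: "finite J" "j \<notin> J" "J \<noteq> {}" and pop: "popular J c" and zero: "c j + (\<Sum>i\<in>J. c i) = 0"
  shows "popular (insert j J) c"
proof -
  obtain \<kappa> L where \<kappa>: "\<kappa> > 0" and half: "\<forall>n T. T \<subseteq> Fqn n \<longrightarrow> (\<exists>G\<subseteq>T. dens n T / 2 \<le> dens n G \<and>
    (\<forall>z\<in>G. \<kappa> * dens n T ^ L * (real CARD('a) ^ n) ^ (card J - 1) \<le> reps J c T ((\<Sum>j\<in>J. c j) *v z)))"
    using popular_half[OF pop J(1)] by blast
  have "\<exists>z\<in>T. \<kappa> / 2 * dens n T ^ Suc L * (real CARD('a) ^ n) ^ (card (insert j J) - 1) \<le> reps (insert j J) c T ((\<Sum>j\<in>insert j J. c j) *v z)"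
    if T: "T \<subseteq> Fqn n" "T \<noteq> {}" for n T
  proof -
    define Q where "Q = real CARD('a) ^ n"
    have finT: "finite T"
      by (rule finite_subset_Fqn[OF T(1)])
    obtain G where G: "G \<subseteq> T" "dens n T / 2 \<le> dens n G"
      "\<forall>z\<in>G. \<kappa> * dens n T ^ L * Q ^ (card J - 1) \<le> reps J c T ((\<Sum>j\<in>J. c j) *v z)"
      using half[rule_format, OF T(1), folded Q_def] by (elim exE conjE) (rule that)
    obtain z where z: "z \<in> T"
      using T by blast
    have Q: "Q > 0"
      by (simp add: Q_def)
    have neg: "(\<Sum>i\<in>J. c i) = - c j"
      using zero by (simp add: eq_neg_iff_add_eq_0 add.commute)
    have card: "card (insert j J) - 1 = Suc (card J - 1)"
      using J by (simp add: card_gt_0_iff)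
    have "\<kappa> / 2 * dens n T ^ Suc L * Q ^ Suc (card J - 1) = (dens n T / 2 * Q) * (\<kappa> * dens n T ^ L * Q ^ (card J - 1))"
      by simp
    also have "\<dots> \<le> card G * (\<kappa> * dens n T ^ L * Q ^ (card J - 1))"
      unfolding card_eq_dens[of G n] Q_def using G(2) \<kappa> by (intro mult_right_mono) auto
    also have "\<dots> \<le> (\<Sum>y\<in>G. real (reps J c T ((\<Sum>j\<in>J. c j) *v y)))"
      using G(3) by (intro sum_bounded_below) auto
    also have "\<dots> \<le> (\<Sum>y\<in>T. real (reps J c T ((\<Sum>j\<in>J. c j) *v y)))"
      using finT G by (intro sum_mono2) auto
    also have "\<dots> = (\<Sum>y\<in>T. real (reps J c T ((\<Sum>j\<in>insert j J. c j) *v z - c j *v y)))"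
    proof -
      have "(\<Sum>j\<in>J. c j) *v y = (\<Sum>j\<in>insert j J. c j) *v z - c j *v y" for y
        using J zero by (simp add: neg fun_eq_iff)
      then show ?thesis by simp
    qed
    also have "\<dots> = reps (insert j J) c T ((\<Sum>j\<in>insert j J. c j) *v z)"
      using J finT by (simp add: reps_insert)
    finally show ?thesis
      using z unfolding card Q_def by blast
  qed
  moreover have "\<kappa> / 2 > 0"
    using \<kappa> by simp
  ultimately show ?thesis
    unfolding popular_def by blast
qed

text \<open>With \<open>s\<close> the sum over \<open>J\<close>, supersaturation of
  \<open>c j y + s w = (c j + s) z\<close> on the popular points of \<open>J\<close> gives a
  \<open>z\<close> that occurs with many \<open>y\<close>; for these the remaining value
  \<open>(c j + s) z - c j y\<close> equals \<open>s w\<close> with \<open>w\<close> popular. The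
  hypotheses \<open>nz\<close> are those of the supersaturation bound.\<close>

lemma popular_insert:
  fixes c :: "'j \<Rightarrow> 'a::{field,finite}"
  assumes J: "finite J" "j \<notin> J" "J \<noteq> {}" and pop: "popular J c"
    and nz: "c j \<noteq> 0" "(\<Sum>i\<in>J. c i) \<noteq> 0" "c j + (\<Sum>i\<in>J. c i) \<noteq> 0"
  shows "popular (insert j J) c"
proof -
  define s where "s = (\<Sum>i\<in>J. c i)"
  obtain \<kappa> L where \<kappa>: "\<kappa> > 0" and half: "\<forall>n T. T \<subseteq> Fqn n \<longrightarrow> (\<exists>G\<subseteq>T. dens n T / 2 \<le> dens n G \<and>
    (\<forall>z\<in>G. \<kappa> * dens n T ^ L * (real CARD('a) ^ n) ^ (card J - 1) \<le> reps J c T (s *v z)))"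
    using popular_half[OF pop J(1)] unfolding s_def by blast
  obtain \<kappa>' L' where \<kappa>': "\<kappa>' > 0"
    and sat: "\<forall>n T. T \<subseteq> Fqn n \<longrightarrow> \<kappa>' * dens n T ^ L' * (real CARD('a) ^ n)\<^sup>2 \<le> card (sols (c j) s (- (c j + s)) T)"
    using supersaturation[of "c j" s "- (c j + s)"] nz unfolding s_def by (metis add.right_inverse neg_equal_0_iff_equal)
  define \<mu> where "\<mu> = \<kappa>' / 2 ^ L' * \<kappa>"
  have "\<mu> > 0"
    using \<kappa> \<kappa>' by (simp add: \<mu>_def)
  moreover have "\<exists>z\<in>T. \<mu> * dens n T ^ (L' + L) * (real CARD('a) ^ n) ^ (card (insert j J) - 1)
      \<le> reps (insert j J) c T ((\<Sum>j\<in>insert j J. c j) *v z)"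
    if T: "T \<subseteq> Fqn n" "T \<noteq> {}" for n T
  proof -
    define Q where "Q = real CARD('a) ^ n"
    define r where "r = \<kappa> * dens n T ^ L * Q ^ (card J - 1)"
    have Q: "Q > 0"
      by (simp add: Q_def)
    have r: "r \<ge> 0"
      using \<kappa> Q by (simp add: r_def)
    have finT: "finite T"
      by (rule finite_subset_Fqn[OF T(1)])
    obtain G where G: "G \<subseteq> T" "dens n T / 2 \<le> dens n G"
      "\<forall>z\<in>G. r \<le> reps J c T (s *v z)"
      using half[rule_format, OF T(1), folded Q_def, folded r_def] by (elim exE conjE) (rule that)
    have "G \<noteq> {}"
      using G(2) dens_pos[OF T] by auto
    have finG: "finite G"
      using G finT finite_subset by blast
    have GF: "G \<subseteq> Fqn n"
      using G T by blast
    \<comment> \<open>Only \<open>y\<close> is recorded: as \<open>s\<close> is nonzero,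
      \<open>w\<close> is determined by \<open>y\<close> and \<open>z\<close>.\<close>
    define Y where "Y z = {y \<in> G. \<exists>w\<in>G. c j *v y + s *v w + (- (c j + s)) *v z = 0}" for z
    have finY: "finite (Y z)" for z
      using finG by (simp add: Y_def)
    let ?S = "sols (c j) s (- (c j + s)) G"
    have "card ?S \<le> card (Sigma G Y)"
    proof (rule card_inj_on_le)
      show "inj_on (\<lambda>(y, w, z). (z, y)) ?S"
      proof (rule inj_onI)
        fix t t' assume t: "t \<in> ?S" "t' \<in> ?S" and eq: "(\<lambda>(y, w, z). (z, y)) t = (\<lambda>(y, w, z). (z, y)) t'"
        obtain y w z w' where yw: "t = (y, w, z)" "t' = (y, w', z)"
          using eq by (cases t; cases t') auto
        have "c j *v y + s *v w + (- (c j + s)) *v z = c j *v y + s *v w' + (- (c j + s)) *v z"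
          using t by (simp add: yw sols_def)
        then have "s *v w = s *v w'"
          by simp
        then show "t = t'"
          using nz by (simp add: yw s_def smult_eq_iff)
      qed
      show "(\<lambda>(y, w, z). (z, y)) ` ?S \<subseteq> Sigma G Y"
        by (auto simp: sols_def Y_def)
      show "finite (Sigma G Y)"
        using finG finY by simp
    qed
    also have "\<dots> = (\<Sum>z\<in>G. card (Y z))"
      using finG finY by simp
    finally have "real (card ?S) \<le> (\<Sum>z\<in>G. real (card (Y z)))"
      unfolding of_nat_sum[symmetric] of_nat_le_iff .
    then have "\<kappa>' * dens n G ^ L' * Q\<^sup>2 \<le> (\<Sum>z\<in>G. real (card (Y z)))"
      using sat[rule_format, OF GF] unfolding Q_def by linarith
    then obtain z where z: "z \<in> G" "\<kappa>' * dens n G ^ L' * Q\<^sup>2 \<le> Q * card (Y z)"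
      using exists_ge_average[OF finG \<open>G \<noteq> {}\<close>, of "\<kappa>' * dens n G ^ L' * Q\<^sup>2" "\<lambda>z. real (card (Y z))" Q]
        card_le_Fqn[OF GF] unfolding Q_def by auto
    then have Yz: "\<kappa>' * dens n G ^ L' * Q \<le> card (Y z)"
      using Q by (simp add: power2_eq_square)
    have "(dens n T / 2) ^ L' \<le> dens n G ^ L'"
      using G(2) by (intro power_mono) auto
    then have "\<kappa>' * (dens n T / 2) ^ L' * Q \<le> \<kappa>' * dens n G ^ L' * Q"
      using \<kappa>' Q by (intro mult_right_mono mult_left_mono) auto
    then have "\<kappa>' * (dens n T / 2) ^ L' * Q \<le> card (Y z)"
      using Yz by linarith
    then have "\<kappa>' * (dens n T / 2) ^ L' * Q * r \<le> card (Y z) * r"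
      using r by (intro mult_right_mono)
    also have "\<dots> \<le> (\<Sum>y\<in>Y z. real (reps J c T ((c j + s) *v z - c j *v y)))"
    proof (rule sum_bounded_below)
      fix y assume "y \<in> Y z"
      then obtain w where w: "w \<in> G" "c j *v y + s *v w + (- (c j + s)) *v z = 0"
        by (auto simp: Y_def)
      have "(c j + s) *v z - c j *v y = s *v w"
      proof
        fix t
        have "c j * y t + s * w t + (- (c j + s)) * z t = 0"
          using fun_cong[OF w(2), of t] by simp
        moreover have "((c j + s) *v z - c j *v y) t = s * w t - (c j * y t + s * w t + (- (c j + s)) * z t)"
          by (simp add: algebra_simps)
        ultimately show "((c j + s) *v z - c j *v y) t = (s *v w) t"
          by simp
      qed
      then show "r \<le> reps J c T ((c j + s) *v z - c j *v y)"
        using G(3) w(1) by simp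
    qed
    also have "\<dots> \<le> (\<Sum>y\<in>T. real (reps J c T ((c j + s) *v z - c j *v y)))"
      using finT G by (intro sum_mono2) (auto simp: Y_def)
    also have "\<dots> = reps (insert j J) c T ((\<Sum>j\<in>insert j J. c j) *v z)"
      using J finT by (simp add: reps_insert s_def)
    finally have "\<kappa>' * (dens n T / 2) ^ L' * Q * r \<le> reps (insert j J) c T ((\<Sum>j\<in>insert j J. c j) *v z)" .
    moreover have "\<kappa>' * (dens n T / 2) ^ L' * Q * r = \<mu> * dens n T ^ (L' + L) * Q ^ Suc (card J - 1)"
      by (simp add: r_def \<mu>_def power_add power_divide)
    moreover have "card (insert j J) - 1 = Suc (card J - 1)"
      using J by (simp add: card_gt_0_iff)
    ultimately show ?thesis
      using z G(1) unfolding Q_def by auto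
  qed
  ultimately show ?thesis
    unfolding popular_def by blast
qed

text \<open>Here the coefficient sum without \<open>j\<close> vanishes, so the three-variable
  equation degenerates, and \<open>j\<close> and \<open>i\<close> are split off together.
  Cauchy-Schwarz yields at least \<open>card G ^ 4 / q ^ n\<close> coincidences
  \<open>c j x + c i y = c j z + c i w\<close> among the popular points, and
  \<open>- c i *v w\<close> is a popular value for \<open>J\<close>.\<close>

lemma popular_insert2:
  fixes c :: "'j \<Rightarrow> 'a::{field,finite}"
  assumes J: "finite J" "j \<notin> J" "i \<notin> J" "i \<noteq> j" "J \<noteq> {}" and pop: "popular J c"
    and nz: "c j \<noteq> 0" "c i \<noteq> 0" and zero: "c i + (\<Sum>i\<in>J. c i) = 0"
  shows "popular (insert j (insert i J)) c"
proof -
  have neg: "(\<Sum>i\<in>J. c i) = - c i"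
    using zero by (simp add: eq_neg_iff_add_eq_0 add.commute)
  have sum: "(\<Sum>l\<in>insert j (insert i J). c l) = c j"
    using J zero by simp
  obtain \<kappa> L where \<kappa>: "\<kappa> > 0" and half: "\<forall>n T. T \<subseteq> Fqn n \<longrightarrow> (\<exists>G\<subseteq>T. dens n T / 2 \<le> dens n G \<and>
    (\<forall>z\<in>G. \<kappa> * dens n T ^ L * (real CARD('a) ^ n) ^ (card J - 1) \<le> reps J c T ((- c i) *v z)))"
    using popular_half[OF pop J(1)] unfolding neg by blast
  \<comment> \<open>The constant 16 and the extra exponent 4 stem from \<open>card G ^ 4\<close>,
    where \<open>G\<close> has at least half the density of \<open>T\<close>.\<close>
  have "\<exists>z\<in>T. \<kappa> / 16 * dens n T ^ (4 + L) * (real CARD('a) ^ n) ^ (card (insert j (insert i J)) - 1)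
      \<le> reps (insert j (insert i J)) c T ((\<Sum>l\<in>insert j (insert i J). c l) *v z)"
    if T: "T \<subseteq> Fqn n" "T \<noteq> {}" for n T
  proof -
    define Q where "Q = real CARD('a) ^ n"
    define r where "r = \<kappa> * dens n T ^ L * Q ^ (card J - 1)"
    have Q: "Q > 0"
      by (simp add: Q_def)
    have r: "r \<ge> 0"
      using \<kappa> Q by (simp add: r_def)
    have finT: "finite T"
      by (rule finite_subset_Fqn[OF T(1)])
    obtain G where G: "G \<subseteq> T" "dens n T / 2 \<le> dens n G"
      "\<forall>z\<in>G. r \<le> reps J c T ((- c i) *v z)"
      using half[rule_format, OF T(1), folded Q_def, folded r_def] by (elim exE conjE) (rule that)
    have "G \<noteq> {}"
      using G(2) dens_pos[OF T] by auto
    have finG: "finite G"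
      using G finT finite_subset by blast
    have GF: "G \<subseteq> Fqn n"
      using G T by blast
    define f where "f = (\<lambda>(x, y). c j *v x + c i *v y)"
    define Y where "Y z = {p \<in> G \<times> G. \<exists>w\<in>G. f p = f (z, w)}" for z
    have finY: "finite (Y z)" for z
      using finG by (simp add: Y_def)
    let ?S = "{(p, p') \<in> (G \<times> G) \<times> (G \<times> G). f p = f p'}"
    have "f ` (G \<times> G) \<subseteq> Fqn n"
      using GF by (auto simp: f_def intro!: Fqn_closed)
    then have "(real (card (G \<times> G)))\<^sup>2 \<le> card (Fqn n :: (nat \<Rightarrow> 'a) set) * card ?S"
      using finG by (intro card_collisions_ge) (auto simp: finite_Fqn)
    then have energy: "real (card G) ^ 4 \<le> Q * card ?S"
      by (simp add: card_cartesian_product card_Fqn Q_def power2_eq_square eval_nat_numeral mult.assoc)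
    have "card ?S \<le> card (Sigma G Y)"
    proof (rule card_inj_on_le)
      show "inj_on (\<lambda>(p, (z, w)). (z, p)) ?S"
      proof (rule inj_onI)
        fix t t' assume t: "t \<in> ?S" "t' \<in> ?S" and eq: "(\<lambda>(p, (z, w)). (z, p)) t = (\<lambda>(p, (z, w)). (z, p)) t'"
        obtain p z w w' where pw: "t = (p, (z, w))" "t' = (p, (z, w'))"
          using eq by (cases t; cases t') auto
        have "c j *v z + c i *v w = c j *v z + c i *v w'"
          using t by (simp add: pw f_def split: prod.splits)
        then show "t = t'"
          using nz by (simp add: pw smult_eq_iff)
      qed
      show "(\<lambda>(p, (z, w)). (z, p)) ` ?S \<subseteq> Sigma G Y"
        by (auto simp: Y_def)
      show "finite (Sigma G Y)"
        using finG finY by simp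
    qed
    also have "\<dots> = (\<Sum>z\<in>G. card (Y z))"
      using finG finY by simp
    finally have "real (card ?S) \<le> (\<Sum>z\<in>G. real (card (Y z)))"
      unfolding of_nat_sum[symmetric] of_nat_le_iff .
    then obtain z where z: "z \<in> G" "card ?S \<le> Q * card (Y z)"
      using exists_ge_average[OF finG \<open>G \<noteq> {}\<close>, of "card ?S" "\<lambda>z. real (card (Y z))" Q]
        card_le_Fqn[OF GF] unfolding Q_def by auto
    have "real (card G) ^ 4 \<le> Q * (Q * card (Y z))"
      using energy z(2) Q by (meson mult_left_mono less_imp_le order_trans)
    then have "(dens n G * Q) ^ 4 \<le> Q * (Q * card (Y z))"
      unfolding card_eq_dens[of G n] Q_def .
    then have "Q\<^sup>2 * (dens n G ^ 4 * Q\<^sup>2) \<le> Q\<^sup>2 * card (Y z)"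
      by (simp add: power_mult_distrib power2_eq_square eval_nat_numeral mult_ac)
    then have Yz: "dens n G ^ 4 * Q\<^sup>2 \<le> card (Y z)"
      using Q by simp
    have "(dens n T / 2) ^ 4 \<le> dens n G ^ 4"
      using G(2) by (intro power_mono) auto
    then have "(dens n T / 2) ^ 4 * Q\<^sup>2 \<le> card (Y z)"
      using Yz mult_right_mono[of _ _ "Q\<^sup>2"] by (meson order_trans zero_le_power2)
    then have "(dens n T / 2) ^ 4 * Q\<^sup>2 * r \<le> card (Y z) * r"
      using r by (intro mult_right_mono)
    also have "\<dots> \<le> (\<Sum>p\<in>Y z. real (reps J c T (c j *v z - c j *v fst p - c i *v snd p)))"
    proof (rule sum_bounded_below)
      fix p assume "p \<in> Y z"
      then obtain w where w: "w \<in> G" "c j *v fst p + c i *v snd p = c j *v z + c i *v w"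
        by (auto simp: Y_def f_def)
      have "c j *v z - c j *v fst p - c i *v snd p = (- c i) *v w"
      proof -
        have "c j *v z - c j *v fst p - c i *v snd p = c j *v z - (c j *v fst p + c i *v snd p)"
          by simp
        also have "\<dots> = (- c i) *v w"
          unfolding w(2) by (simp add: fun_eq_iff)
        finally show ?thesis .
      qed
      then show "r \<le> reps J c T (c j *v z - c j *v fst p - c i *v snd p)"
        using G(3) w(1) by simp
    qed
    also have "\<dots> \<le> (\<Sum>p\<in>T \<times> T. real (reps J c T (c j *v z - c j *v fst p - c i *v snd p)))"
      using finT G by (intro sum_mono2) (auto simp: Y_def)
    also have "\<dots> = (\<Sum>x\<in>T. \<Sum>y\<in>T. real (reps J c T (c j *v z - c j *v x - c i *v y)))"
      by (simp add: sum.cartesian_product case_prod_beta)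
    also have "\<dots> = reps (insert j (insert i J)) c T (c j *v z)"
      using J finT by (simp add: reps_insert)
    finally have "(dens n T / 2) ^ 4 * Q\<^sup>2 * r \<le> reps (insert j (insert i J)) c T (c j *v z)" .
    moreover have "(dens n T / 2) ^ 4 * Q\<^sup>2 * r = \<kappa> / 16 * dens n T ^ (4 + L) * Q ^ Suc (Suc (card J - 1))"
      by (simp add: r_def power_add power_divide power2_eq_square)
    moreover have "card (insert j (insert i J)) - 1 = Suc (Suc (card J - 1))"
      using J by (simp add: card_gt_0_iff)
    ultimately show ?thesis
      unfolding sum using z(1) G(1) unfolding Q_def by auto
  qed
  moreover have "\<kappa> / 16 > 0"
    using \<kappa> by simp
  ultimately show ?thesis
    unfolding popular_def by blast
qed

text \<open>Induction by removing one index \<open>j\<close>. With \<open>s\<close> the sum over the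
  other indices, the cases record which of the coefficients \<open>s\<close> and
  \<open>c j + s\<close> of the three-variable equation vanishes.\<close>

theorem popular_nonzero:
  fixes c :: "'j \<Rightarrow> 'a::{field,finite}"
  assumes "finite J" "J \<noteq> {}" "\<And>j. j \<in> J \<Longrightarrow> c j \<noteq> 0"
  shows "popular J c"
  using assms
proof (induction "card J" arbitrary: J rule: less_induct)
  case less
  obtain j where j: "j \<in> J"
    using less.prems by blast
  define J' where "J' = J - {j}"
  have J': "J = insert j J'" "j \<notin> J'" "finite J'"
    using j less.prems by (auto simp: J'_def)
  have IH: "popular K c" if K: "K \<subseteq> J'" "K \<noteq> {}" for K
  proof (rule less.hyps)
    show "card K < card J"
      using card_mono[OF J'(3) K(1)] J' by simp
    show "finite K"
      using K(1) J'(3) by (rule finite_subset)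
    show "c k \<noteq> 0" if "k \<in> K" for k
      using that K(1) less.prems(3) by (auto simp: J'_def)
  qed (rule K(2))
  consider "J' = {}" | "J' \<noteq> {}" "(\<Sum>i\<in>J'. c i) = 0" | "J' \<noteq> {}" "c j + (\<Sum>i\<in>J'. c i) = 0"
    | "J' \<noteq> {}" "(\<Sum>i\<in>J'. c i) \<noteq> 0" "c j + (\<Sum>i\<in>J'. c i) \<noteq> 0"
    by blast
  then show ?case
  proof cases
    case 1
    then show ?thesis
      using J' by (simp add: popular_singleton)
  next
    case 2
    then obtain i where i: "i \<in> J'"
      by blast
    define K where "K = J' - {i}"
    have K: "J' = insert i K" "i \<notin> K" "finite K"
      using i J' by (auto simp: K_def)
    \<comment> \<open>Otherwise the vanishing sum over \<open>J'\<close> would be the single nonzero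
      coefficient \<open>c i\<close>.\<close>
    have "K \<noteq> {}"
      using 2 K less.prems(3)[of i] J' by auto
    then show ?thesis
      unfolding J'(1) K(1) using 2(2) K J' less.prems(3) i
      by (intro popular_insert2 IH) auto
  next
    case 3
    then show ?thesis
      unfolding J'(1) using J' by (intro popular_insert_zero_sum IH) auto
  next
    case 4
    then show ?thesis
      unfolding J'(1) using J' less.prems(3)[OF j] by (intro popular_insert IH) auto
  qed
qed

section \<open>Tuples satisfying no unwanted equation\<close>

text \<open>Disjoint classes involve disjoint variables, so choices made class by class glue to
  distinct tuples.\<close>

lemma prod_reps_le:
  fixes c :: "nat \<Rightarrow> 'a::{field,finite}"
  assumes P: "finite P" "\<And>C. C \<in> P \<Longrightarrow> finite C" "pairwise disjnt P" and S: "finite S"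
  shows "(\<Prod>C\<in>P. reps C c S (h C)) \<le> card {x \<in> \<Union>P \<rightarrow>\<^sub>E S. \<forall>C\<in>P. (\<Sum>j\<in>C. c j *v x j) = h C}"
  using P
proof (induction P rule: finite_induct)
  case empty
  then show ?case by simp
next
  case (insert C P)
  let ?X = "\<lambda>P. {x \<in> \<Union>P \<rightarrow>\<^sub>E S. \<forall>C\<in>P. (\<Sum>j\<in>C. c j *v x j) = h C}"
  let ?Y = "{x \<in> C \<rightarrow>\<^sub>E S. (\<Sum>j\<in>C. c j *v x j) = h C}"
  let ?f = "\<lambda>(g, f). \<lambda>j. if j \<in> C then g j else f j"
  have disj: "C \<inter> D = {}" if "D \<in> P" for D
    using insert.prems(2) insert.hyps(2) that by (auto simp: pairwise_insert disjnt_def)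
  then have disjU: "C \<inter> \<Union>P = {}"
    by blast
  have fin: "finite C" "finite (\<Union>P)"
    using insert by auto
  have "inj_on ?f (?Y \<times> ?X P)"
  proof (rule inj_onI)
    fix p p' assume p: "p \<in> ?Y \<times> ?X P" "p' \<in> ?Y \<times> ?X P" and eq: "?f p = ?f p'"
    obtain g f g' f' where gf: "p = (g, f)" "p' = (g', f')"
      by (cases p; cases p')
    have val: "(if j \<in> C then g j else f j) = (if j \<in> C then g' j else f' j)" for j
      using fun_cong[OF eq, of j] by (simp add: gf)
    have "g j = g' j" if "j \<in> C" for j
      using val[of j] that by simp
    moreover have "g \<in> C \<rightarrow>\<^sub>E S" "g' \<in> C \<rightarrow>\<^sub>E S"
      using p by (auto simp: gf)
    ultimately have "g = g'"
      by (intro PiE_ext[of g C "\<lambda>_. S" g'])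
    moreover have "f j = f' j" if "j \<in> \<Union>P" for j
      using val[of j] that disjU by (auto split: if_splits)
    moreover have "f \<in> \<Union>P \<rightarrow>\<^sub>E S" "f' \<in> \<Union>P \<rightarrow>\<^sub>E S"
      using p by (auto simp: gf)
    ultimately show "p = p'"
      unfolding gf by (metis PiE_ext)
  qed
  moreover have "?f ` (?Y \<times> ?X P) \<subseteq> ?X (insert C P)"
  proof
    fix x assume "x \<in> ?f ` (?Y \<times> ?X P)"
    then obtain g f where x: "x = (\<lambda>j. if j \<in> C then g j else f j)" and g: "g \<in> ?Y" and f: "f \<in> ?X P"
      by auto
    have "x j \<in> S" if "j \<in> \<Union>(insert C P)" for j
      using that g f by (auto simp: x)
    moreover have "x j = undefined" if "j \<notin> \<Union>(insert C P)" for j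
      using that f by (auto simp: x intro: PiE_arb)
    ultimately have "x \<in> \<Union>(insert C P) \<rightarrow>\<^sub>E S"
      by (intro PiE_I)
    moreover have "(\<Sum>j\<in>C. c j *v x j) = h C"
      using g by (simp add: x)
    moreover have "(\<Sum>j\<in>D. c j *v x j) = h D" if "D \<in> P" for D
    proof -
      have "(\<Sum>j\<in>D. c j *v x j) = (\<Sum>j\<in>D. c j *v f j)"
        using disj[OF that] by (intro sum.cong) (auto simp: x)
      then show ?thesis
        using f that by simp
    qed
    ultimately show "x \<in> ?X (insert C P)"
      by simp
  qed
  moreover have "finite (?X (insert C P))"
    using fin S by (simp add: finite_PiE)
  ultimately have "card (?Y \<times> ?X P) \<le> card (?X (insert C P))"
    by (rule card_inj_on_le)
  moreover have "(\<Prod>C\<in>P. reps C c S (h C)) \<le> card (?X P)"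
    using insert.prems by (intro insert.IH) (auto simp: pairwise_insert)
  then have "reps C c S (h C) * (\<Prod>C\<in>P. reps C c S (h C)) \<le> card (?Y \<times> ?X P)"
    by (simp add: card_cartesian_product reps_def)
  ultimately have "reps C c S (h C) * (\<Prod>C\<in>P. reps C c S (h C)) \<le> card (?X (insert C P))"
    by linarith
  then show ?case
    unfolding prod.insert[OF insert.hyps] .
qed

text \<open>The class equations together with \<open>b\<close> have rank \<open>card P + 1\<close>:
  the failed proportionality is a nonzero 2x2 minor on \<open>j0\<close>, \<open>j1\<close>, and
  every other class contributes one pivot. The saved factor stands on the left to avoid the
  truncated exponent \<open>k - card P - 1\<close>.\<close>

lemma card_extra_equation_le:
  fixes c b :: "nat \<Rightarrow> 'a::{field,finite}"
  assumes P: "partition_on {..<k} P" and c: "\<And>j. j < k \<Longrightarrow> c j \<noteq> 0"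
    and C0: "C0 \<in> P" "j0 \<in> C0" "j1 \<in> C0" "b j0 * c j1 \<noteq> b j1 * c j0"
    and S: "S \<subseteq> Fqn n"
  shows "card {x \<in> {..<k} \<rightarrow>\<^sub>E S. (\<forall>C\<in>P. (\<Sum>j\<in>C. c j *v x j) = h C) \<and> satisfies_eq k b x} * CARD('a) ^ n
    \<le> (CARD('a) ^ n) ^ (k - card P)"
proof -
  let ?X = "{x \<in> {..<k} \<rightarrow>\<^sub>E S. (\<forall>C\<in>P. (\<Sum>j\<in>C. c j *v x j) = h C) \<and> satisfies_eq k b x}"
  have fP: "finite P"
    using P finite_elements by blast
  have CP: "C \<subseteq> {..<k}" "finite C" "C \<noteq> {}" if "C \<in> P" for C
    using P that finite_subset[of C "{..<k}"] by (auto simp: partition_on_def)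
  have disj: "C \<inter> D = {}" if "C \<in> P" "D \<in> P" "C \<noteq> D" for C D
    using P that by (auto simp: partition_on_def disjoint_def)
  define \<rho> where "\<rho> C = (SOME j. j \<in> C)" for C :: "nat set"
  have \<rho>: "\<rho> C \<in> C" if "C \<in> P" for C
    using CP(3)[OF that] unfolding \<rho>_def by (auto intro: someI)
  \<comment> \<open>Pivot indices: \<open>V\<close> has one representative of each class other than
    \<open>C0\<close>, while \<open>j0\<close> and \<open>j1\<close> serve \<open>C0\<close> and the
    extra equation.\<close>
  define V where "V = \<rho> ` (P - {C0})"
  define U where "U = {j0, j1} \<union> V"
  have ne: "j0 \<noteq> j1"
    using C0(4) by (auto simp: mult.commute)
  have V0: "V \<inter> C0 = {}"
  proof -
    have "\<rho> C \<notin> C0" if "C \<in> P" "C \<noteq> C0" for C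
      using disj[OF that(1) C0(1) that(2)] \<rho>[OF that(1)] by blast
    then show ?thesis
      by (auto simp: V_def)
  qed
  have "inj_on \<rho> (P - {C0})"
  proof (rule inj_onI, rule ccontr)
    fix C D assume CD: "C \<in> P - {C0}" "D \<in> P - {C0}" "\<rho> C = \<rho> D" "C \<noteq> D"
    then have "\<rho> C \<in> C \<inter> D"
      using \<rho>[of C] \<rho>[of D] by auto
    then show False
      using disj[of C D] CD by auto
  qed
  then have "card V = card P - 1"
    using C0(1) fP by (simp add: V_def card_image)
  moreover have "card P \<noteq> 0"
    using C0(1) fP by auto
  moreover have "card U = card {j0, j1} + card V"
    unfolding U_def using C0 V0 fP by (intro card_Un_disjoint) (auto simp: V_def)
  ultimately have cardU: "card U = card P + 1"
    using ne by simp
  have Uk: "U \<subseteq> {..<k}"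
    using C0(2,3) CP(1)[OF C0(1)] CP(1) \<rho> unfolding U_def V_def by blast
  then have finU: "finite U"
    by (rule finite_subset) simp
  have CU: "C \<inter> U = {\<rho> C}" if "C \<in> P" "C \<noteq> C0" for C
  proof -
    have "\<rho> D \<notin> C" if "D \<in> P" "D \<noteq> C" for D
      using disj[OF that(1) \<open>C \<in> P\<close> that(2)] \<rho>[OF that(1)] by blast
    then show ?thesis
      using disj[OF that(1) C0(1) that(2)] C0(2,3) \<rho>[OF that(1)] that unfolding U_def V_def by blast
  qed
  have C0U: "C0 \<inter> U = {j0, j1}"
    using V0 C0 by (auto simp: U_def)
  have "inj_on (\<lambda>x. restrict x ({..<k} - U)) ?X"
  proof (rule inj_onI)
    fix x x' assume x: "x \<in> ?X" "x' \<in> ?X" and eq: "restrict x ({..<k} - U) = restrict x' ({..<k} - U)"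
    define e where "e j t = x j t - x' j t" for j t
    have e0: "e j t = 0" if "j < k" "j \<notin> U" for j t
      using fun_cong[OF eq, of j] that by (simp add: e_def)
    have eC: "(\<Sum>j\<in>C \<inter> U. c j * e j t) = 0" if "C \<in> P" for C t
    proof -
      have "(\<Sum>j\<in>C. c j *v x j) = (\<Sum>j\<in>C. c j *v x' j)"
        using x that by simp
      then have "(\<Sum>j\<in>C. c j *v x j) t = (\<Sum>j\<in>C. c j *v x' j) t"
        by simp
      then have "(\<Sum>j\<in>C. c j * e j t) = 0"
        by (simp add: sum_fun_apply e_def right_diff_distrib sum_subtractf)
      moreover have "(\<Sum>j\<in>C. c j * e j t) = (\<Sum>j\<in>C \<inter> U. c j * e j t)"
        using CP[OF that] e0 by (intro sum.mono_neutral_right) auto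
      ultimately show ?thesis by simp
    qed
    have e1: "e (\<rho> C) t = 0" if "C \<in> P" "C \<noteq> C0" for C t
      using eC[OF that(1), of t] c[of "\<rho> C"] \<rho>[OF that(1)] CP(1)[OF that(1)] unfolding CU[OF that] by auto
    have eV: "e j t = 0" if "j < k" "j \<noteq> j0" "j \<noteq> j1" for j t
      using e0[OF that(1)] e1 that(2,3) by (auto simp: U_def V_def)
    have 1: "c j0 * e j0 t + c j1 * e j1 t = 0" for t
      using eC[OF C0(1), of t] ne unfolding C0U by simp
    have 2: "b j0 * e j0 t + b j1 * e j1 t = 0" for t
    proof -
      have "(\<Sum>j<k. b j * x j t) = 0" "(\<Sum>j<k. b j * x' j t) = 0"
        using x by (auto simp: satisfies_eq_def)
      then have "(\<Sum>j<k. b j * e j t) = 0"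
        by (simp add: e_def right_diff_distrib sum_subtractf)
      moreover have "(\<Sum>j<k. b j * e j t) = (\<Sum>j\<in>{j0, j1}. b j * e j t)"
        using eV Uk by (intro sum.mono_neutral_right) (auto simp: U_def)
      ultimately show ?thesis
        using ne by simp
    qed
    have "e j0 t = 0 \<and> e j1 t = 0" for t
    proof -
      have "(b j0 * c j1 - b j1 * c j0) * e j0 t =
          c j1 * (b j0 * e j0 t + b j1 * e j1 t) - b j1 * (c j0 * e j0 t + c j1 * e j1 t)"
        by (simp add: algebra_simps)
      also have "\<dots> = 0"
        by (simp only: 1 2 mult_zero_right diff_self)
      finally have "e j0 t = 0"
        using C0(4) by simp
      moreover have "c j1 \<noteq> 0"
        using C0 CP(1) by (intro c) auto
      ultimately show ?thesis
        using 1[of t] by simp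
    qed
    then have "e j t = 0" if "j < k" for j t
      using eV[OF that] by blast
    then have "x j = x' j" if "j < k" for j
      using that by (auto simp: e_def fun_eq_iff)
    then show "x = x'"
      using x by (intro PiE_ext[of x "{..<k}" "\<lambda>_. S" x']) auto
  qed
  moreover have "(\<lambda>x. restrict x ({..<k} - U)) ` ?X \<subseteq> ({..<k} - U) \<rightarrow>\<^sub>E Fqn n"
    using S by (auto intro!: restrict_PiE_iff[THEN iffD2])
  moreover have "finite (({..<k} - U) \<rightarrow>\<^sub>E (Fqn n :: (nat \<Rightarrow> 'a) set))"
    by (simp add: finite_PiE finite_Fqn)
  ultimately have "card ?X \<le> card (({..<k} - U) \<rightarrow>\<^sub>E (Fqn n :: (nat \<Rightarrow> 'a) set))"
    by (rule card_inj_on_le)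
  also have "\<dots> = (CARD('a) ^ n) ^ (k - (card P + 1))"
    using Uk finU by (simp add: card_funcsetE card_Fqn card_Diff_subset cardU)
  finally have "card ?X * CARD('a) ^ n \<le> (CARD('a) ^ n) ^ (k - (card P + 1)) * CARD('a) ^ n"
    by (rule mult_right_mono) simp
  also have "\<dots> = (CARD('a) ^ n) ^ (k - card P)"
  proof -
    have "card P + 1 \<le> k"
      using card_mono[OF _ Uk] cardU by simp
    then have "k - card P = Suc (k - (card P + 1))"
      by simp
    then show ?thesis
      by (simp only: power_Suc2)
  qed
  finally show ?thesis .
qed

text \<open>Union bound with \<open>Q = q ^ n\<close>: at least
  \<open>\<tau> ^ card P * Q ^ (k - card P)\<close> tuples take the prescribed class values, and
  each of the at most \<open>q ^ k\<close> unwanted equations holds for at most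
  \<open>Q ^ (k - card P) / Q\<close> of them.\<close>

theorem exists_generic_tuple:
  fixes c :: "nat \<Rightarrow> 'a::{field,finite}" and \<tau> :: real
  assumes P: "partition_on {..<k} P" and c: "\<And>j. j < k \<Longrightarrow> c j \<noteq> 0" and S: "S \<subseteq> Fqn n"
    and \<tau>: "\<tau> \<ge> 0" "real CARD('a) ^ k < \<tau> ^ card P * real CARD('a) ^ n"
    and reps: "\<And>C. C \<in> P \<Longrightarrow> \<tau> * (real CARD('a) ^ n) ^ (card C - 1) \<le> reps C c S (h C)"
  shows "\<exists>x. (\<forall>j<k. x j \<in> S) \<and> (\<forall>C\<in>P. (\<Sum>j\<in>C. c j *v x j) = h C) \<and>
    (\<forall>b. satisfies_eq k b x \<longrightarrow> (\<forall>C\<in>P. \<forall>j\<in>C. \<forall>j'\<in>C. b j * c j' = b j' * c j))"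
proof (rule ccontr)
  assume neg: "\<not> ?thesis"
  define Q where "Q = real CARD('a) ^ n"
  have Q: "Q > 0"
    by (simp add: Q_def)
  define X where "X = {x \<in> {..<k} \<rightarrow>\<^sub>E S. \<forall>C\<in>P. (\<Sum>j\<in>C. c j *v x j) = h C}"
  \<comment> \<open>Only coefficients below \<open>k\<close> affect an equation, so unwanted ones
    are represented extensionally; this makes the family finite.\<close>
  define B where "B = {b \<in> {..<k} \<rightarrow>\<^sub>E (UNIV :: 'a set). \<exists>C\<in>P. \<exists>j\<in>C. \<exists>j'\<in>C. b j * c j' \<noteq> b j' * c j}"
  have fP: "finite P"
    using P finite_elements by blast
  have CP: "C \<subseteq> {..<k}" "finite C" "C \<noteq> {}" if "C \<in> P" for C
    using P that finite_subset[of C "{..<k}"] by (auto simp: partition_on_def)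
  have UP: "\<Union>P = {..<k}"
    using P by (simp add: partition_on_def)
  have disj: "pairwise disjnt P"
    using P by (auto simp: partition_on_def disjoint_def pairwise_def disjnt_def)
  have finS: "finite S"
    by (rule finite_subset_Fqn[OF S])
  have "k = (\<Sum>C\<in>P. card C)"
    using card_Union_disjoint[of P] disj CP(2) UP by simp
  also have "\<dots> = (\<Sum>C\<in>P. (card C - 1) + 1)"
    using CP by (intro sum.cong) (auto simp: card_gt_0_iff Suc_le_eq)
  also have "\<dots> = (\<Sum>C\<in>P. card C - 1) + card P"
    by (simp only: sum.distrib) simp
  finally have k: "(\<Sum>C\<in>P. card C - 1) = k - card P"
    by linarith
  have "\<tau> ^ card P * Q ^ (k - card P) = (\<Prod>C\<in>P. \<tau> * Q ^ (card C - 1))"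
    by (simp add: prod.distrib power_sum flip: k)
  also have "\<dots> \<le> (\<Prod>C\<in>P. real (reps C c S (h C)))"
    using reps \<tau>(1) Q unfolding Q_def by (intro prod_mono) auto
  also have "\<dots> = real (\<Prod>C\<in>P. reps C c S (h C))"
    by simp
  also have "\<dots> \<le> real (card X)"
    unfolding X_def using prod_reps_le[OF fP CP(2) disj finS, of c h] by (simp only: UP of_nat_le_iff)
  finally have lower: "\<tau> ^ card P * Q ^ (k - card P) \<le> card X" .
  have finB: "finite B"
    unfolding B_def by (simp add: finite_PiE)
  have "X \<subseteq> (\<Union>b\<in>B. {x \<in> X. satisfies_eq k b x})"
  proof
    fix x assume x: "x \<in> X"
    then have "\<forall>j<k. x j \<in> S" "\<forall>C\<in>P. (\<Sum>j\<in>C. c j *v x j) = h C"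
      by (auto simp: X_def)
    then obtain b C j j' where b: "satisfies_eq k b x" "C \<in> P" "j \<in> C" "j' \<in> C" "b j * c j' \<noteq> b j' * c j"
      using neg by blast
    let ?b = "restrict b {..<k}"
    have "satisfies_eq k ?b x"
      using b(1) by (simp add: satisfies_eq_def)
    moreover have "j < k" "j' < k"
      using b CP(1) by auto
    then have "?b j * c j' \<noteq> ?b j' * c j"
      using b(5) by simp
    then have "?b \<in> B"
      unfolding B_def using b(2-4) restrict_PiE_iff[of b "{..<k}" "\<lambda>_. UNIV"] by blast
    ultimately show "x \<in> (\<Union>b\<in>B. {x \<in> X. satisfies_eq k b x})"
      using x by blast
  qed
  moreover have finX: "finite X"
    unfolding X_def using finS by (simp add: finite_PiE)
  ultimately have "card X \<le> card (\<Union>b\<in>B. {x \<in> X. satisfies_eq k b x})"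
    using finB by (intro card_mono) auto
  also have "\<dots> \<le> (\<Sum>b\<in>B. card {x \<in> X. satisfies_eq k b x})"
    by (rule card_UN_le[OF finB])
  finally have "card X * CARD('a) ^ n \<le> (\<Sum>b\<in>B. card {x \<in> X. satisfies_eq k b x}) * CARD('a) ^ n"
    by (rule mult_right_mono) simp
  also have "\<dots> = (\<Sum>b\<in>B. card {x \<in> X. satisfies_eq k b x} * CARD('a) ^ n)"
    by (rule sum_distrib_right)
  also have "\<dots> \<le> (\<Sum>b\<in>B. (CARD('a) ^ n) ^ (k - card P))"
  proof (rule sum_mono)
    fix b assume "b \<in> B"
    then obtain C j j' where "C \<in> P" "j \<in> C" "j' \<in> C" "b j * c j' \<noteq> b j' * c j"
      unfolding B_def by blast
    from card_extra_equation_le[OF P c this S, of h]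
    show "card {x \<in> X. satisfies_eq k b x} * CARD('a) ^ n \<le> (CARD('a) ^ n) ^ (k - card P)"
      by (simp add: X_def conj_assoc)
  qed
  also have "\<dots> = card B * (CARD('a) ^ n) ^ (k - card P)"
    by simp
  also have "\<dots> \<le> CARD('a) ^ k * (CARD('a) ^ n) ^ (k - card P)"
  proof -
    have "card B \<le> card ({..<k} \<rightarrow>\<^sub>E (UNIV :: 'a set))"
      unfolding B_def by (intro card_mono) (auto simp: finite_PiE)
    then show ?thesis
      by (simp add: card_funcsetE)
  qed
  finally have "real (card X * CARD('a) ^ n) \<le> real (CARD('a) ^ k * (CARD('a) ^ n) ^ (k - card P))"
    by (rule of_nat_mono)
  then have "card X * Q \<le> real CARD('a) ^ k * Q ^ (k - card P)"
    by (simp add: Q_def)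
  moreover have "\<tau> ^ card P * Q ^ (k - card P) * Q \<le> card X * Q"
    using lower Q by (intro mult_right_mono) auto
  ultimately have "(\<tau> ^ card P * Q) * Q ^ (k - card P) \<le> real CARD('a) ^ k * Q ^ (k - card P)"
    by (simp add: mult_ac)
  then have "\<tau> ^ card P * Q \<le> real CARD('a) ^ k"
    using Q by simp
  then show False
    using \<tau>(2) by (simp add: Q_def)
qed

section \<open>Common values for all classes\<close>

text \<open>The minimum of the \<open>\<kappa>\<close> and the maximum of the \<open>L\<close> work.
  The thresholds \<open>\<kappa> * dens n T ^ L\<close> have the required monotonicity because
  densities are at most 1.\<close>

lemma uniform_constants:
  fixes R :: "'i \<Rightarrow> real \<Rightarrow> nat \<Rightarrow> bool"
  assumes "finite I" and "\<And>i. i \<in> I \<Longrightarrow> \<exists>\<kappa>>0. \<exists>L. R i \<kappa> L"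
    and mono: "\<And>i \<kappa> L \<kappa>' L'. \<lbrakk>R i \<kappa> L; 0 < \<kappa>'; \<kappa>' \<le> \<kappa>; L \<le> L'\<rbrakk> \<Longrightarrow> R i \<kappa>' L'"
  shows "\<exists>\<kappa>>0. \<exists>L. \<forall>i\<in>I. R i \<kappa> L"
  using assms(1,2)
proof (induction I rule: finite_induct)
  case empty
  show ?case
    by (intro exI[of _ 1]) simp
next
  case (insert i I)
  obtain \<kappa>1 L1 where 1: "\<kappa>1 > 0" "\<forall>i\<in>I. R i \<kappa>1 L1"
    using insert by (metis insertCI)
  obtain \<kappa>2 L2 where 2: "\<kappa>2 > 0" "R i \<kappa>2 L2"
    using insert.prems by blast
  have pos: "min \<kappa>1 \<kappa>2 > 0"
    using 1 2 by simp
  have "R l (min \<kappa>1 \<kappa>2) (max L1 L2)" if "l \<in> insert i I" for l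
  proof (cases "l = i")
    case True
    then show ?thesis
      using mono[OF 2(2) pos] by simp
  next
    case False
    then have "R l \<kappa>1 L1"
      using 1 that by simp
    then show ?thesis
      using mono[OF _ pos] by simp
  qed
  then show ?case
    using pos by blast
qed

lemma threshold_mono:
  fixes \<kappa> \<kappa>' :: real
  assumes "0 < \<kappa>'" "\<kappa>' \<le> \<kappa>" "L \<le> L'" "T \<subseteq> (Fqn n :: (nat \<Rightarrow> 'a::{field,finite}) set)" "0 \<le> Q"
  shows "\<kappa>' * dens n T ^ L' * Q \<le> \<kappa> * dens n T ^ L * Q"
  using assms dens_le_1[OF assms(4)] by (intro mult_right_mono mult_mono power_decreasing) auto

lemma common_popular_point:
  fixes c :: "'j \<Rightarrow> 'a::{field,finite}"
  assumes P: "finite P" "\<And>C. C \<in> P \<Longrightarrow> finite C" and pop: "\<And>C. C \<in> P \<Longrightarrow> popular C c"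
  shows "\<exists>\<kappa>>0. \<exists>L. \<forall>n T. T \<subseteq> Fqn n \<longrightarrow> T \<noteq> {} \<longrightarrow>
    (\<exists>z\<in>T. \<forall>C\<in>P. \<kappa> * dens n T ^ L * (real CARD('a) ^ n) ^ (card C - 1) \<le> reps C c T ((\<Sum>j\<in>C. c j) *v z))"
proof -
  \<comment> \<open>With this \<open>\<eta>\<close> the bad sets of all classes together cannot
    cover a nonempty \<open>T\<close>.\<close>
  define \<eta> where "\<eta> = 1 / (real (card P) + 1)"
  have \<eta>: "\<eta> > 0"
    by (simp add: \<eta>_def)
  define bad where "bad C \<kappa> L n T =
    {z \<in> T. reps C c T ((\<Sum>j\<in>C. c j) *v z) < \<kappa> * dens n T ^ L * (real CARD('a) ^ n) ^ (card C - 1)}"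
    for C \<kappa> L n and T :: "(nat \<Rightarrow> 'a) set"
  define R where "R C \<kappa> L \<longleftrightarrow> (\<forall>n T. T \<subseteq> Fqn n \<longrightarrow> card (bad C \<kappa> L n T) \<le> \<eta> * card T)" for C \<kappa> L
  have "\<exists>\<kappa>>0. \<exists>L. \<forall>C\<in>P. R C \<kappa> L"
  proof (rule uniform_constants[OF P(1)])
    show "\<exists>\<kappa>>0. \<exists>L. R C \<kappa> L" if "C \<in> P" for C
      unfolding R_def bad_def by (rule popular_abundant[OF pop[OF that] P(2)[OF that] \<eta>])
    fix C \<kappa> L \<kappa>' L' assume R: "R C \<kappa> L" and le: "0 < \<kappa>'" "\<kappa>' \<le> \<kappa>" "L \<le> L'"
    show "R C \<kappa>' L'"
      unfolding R_def
    proof (intro allI impI)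
      fix n and T :: "(nat \<Rightarrow> 'a) set" assume T: "T \<subseteq> Fqn n"
      have "bad C \<kappa>' L' n T \<subseteq> bad C \<kappa> L n T"
        unfolding bad_def using threshold_mono[OF le T, of "(real CARD('a) ^ n) ^ (card C - 1)"]
        by (auto simp only: mem_Collect_eq intro: less_le_trans zero_le_power of_nat_0_le_iff)
      then have "card (bad C \<kappa>' L' n T) \<le> card (bad C \<kappa> L n T)"
        using finite_subset_Fqn[OF T] by (intro card_mono) (auto simp: bad_def)
      then show "card (bad C \<kappa>' L' n T) \<le> \<eta> * card T"
        using R[unfolded R_def, rule_format, OF T] by linarith
    qed
  qed
  then obtain \<kappa> L where \<kappa>: "\<kappa> > 0" and R: "\<forall>C\<in>P. R C \<kappa> L"
    by blast
  have "\<exists>z\<in>T. \<forall>C\<in>P. \<kappa> * dens n T ^ L * (real CARD('a) ^ n) ^ (card C - 1) \<le> reps C c T ((\<Sum>j\<in>C. c j) *v z)"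
    if T: "T \<subseteq> Fqn n" "T \<noteq> {}" for n T
  proof -
    have "card (\<Union>C\<in>P. bad C \<kappa> L n T) \<le> (\<Sum>C\<in>P. card (bad C \<kappa> L n T))"
      by (rule card_UN_le[OF P(1)])
    then have "real (card (\<Union>C\<in>P. bad C \<kappa> L n T)) \<le> (\<Sum>C\<in>P. real (card (bad C \<kappa> L n T)))"
      unfolding of_nat_sum[symmetric] of_nat_le_iff .
    also have "\<dots> \<le> (\<Sum>C\<in>P. \<eta> * card T)"
      using R T by (intro sum_mono) (auto simp: R_def)
    also have "\<dots> = real (card P) * \<eta> * card T"
      by simp
    also have "\<dots> < 1 * real (card T)"
      using T finite_subset_Fqn[OF T(1)] by (intro mult_strict_right_mono) (auto simp: \<eta>_def card_gt_0_iff)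
    finally have "(\<Union>C\<in>P. bad C \<kappa> L n T) \<noteq> T"
      by auto
    moreover have "(\<Union>C\<in>P. bad C \<kappa> L n T) \<subseteq> T"
      by (auto simp: bad_def)
    ultimately obtain z where "z \<in> T" "z \<notin> (\<Union>C\<in>P. bad C \<kappa> L n T)"
      by blast
    then show ?thesis
      by (intro bexI[of _ z]) (auto simp: bad_def not_less)
  qed
  then show ?thesis
    using \<kappa> by blast
qed

text \<open>For fixed \<open>d\<close> exactly \<open>\<Prod>C\<in>P. card (D C)\<close> base points
  \<open>y\<close> fit, since translation by \<open>\<sigma> C *v d\<close> is a bijection, also for
  \<open>\<sigma> C = 0\<close>. Averaging over \<open>y\<close> gives one that fits many
  \<open>d\<close>.\<close>

lemma exists_dense_line:
  fixes D :: "'i \<Rightarrow> (nat \<Rightarrow> 'a::{field,finite}) set"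
  assumes P: "finite P" and D: "\<And>C. C \<in> P \<Longrightarrow> D C \<subseteq> Fqn n" and \<delta>: "\<And>C. C \<in> P \<Longrightarrow> \<delta> \<le> dens n (D C)" "0 \<le> \<delta>"
  shows "\<exists>y E. E \<subseteq> Fqn n \<and> \<delta> ^ card P \<le> dens n E \<and> (\<forall>d\<in>E. \<forall>C\<in>P. y C + \<sigma> C *v d \<in> D C)"
proof -
  define N where "N = (Fqn n :: (nat \<Rightarrow> 'a) set)"
  define Q where "Q = real CARD('a) ^ n"
  define Y where "Y = P \<rightarrow>\<^sub>E N"
  have Q: "Q > 0"
    by (simp add: Q_def)
  have finN: "finite N" and finY: "finite Y"
    using P by (auto simp: N_def Y_def finite_Fqn finite_PiE)
  have cardN: "real (card N) = Q"
    by (simp add: N_def Q_def card_Fqn)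
  have "(0 :: nat \<Rightarrow> 'a) \<in> N"
    by (simp add: N_def)
  then have Yne: "Y \<noteq> {}"
    by (auto simp: Y_def PiE_eq_empty_iff)
  have cardY: "real (card Y) = Q ^ card P"
    using P by (simp add: Y_def card_funcsetE cardN)
  have count: "card {y \<in> Y. \<forall>C\<in>P. y C + \<sigma> C *v d \<in> D C} = (\<Prod>C\<in>P. card (D C))" if d: "d \<in> N" for d
  proof -
    have "{y \<in> Y. \<forall>C\<in>P. y C + \<sigma> C *v d \<in> D C} = (\<Pi>\<^sub>E C\<in>P. {v \<in> N. v + \<sigma> C *v d \<in> D C})"
      by (auto simp: Y_def PiE_iff extensional_def)
    also have "card \<dots> = (\<Prod>C\<in>P. card {v \<in> N. v + \<sigma> C *v d \<in> D C})"
      by (rule card_PiE[OF P])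
    also have "\<dots> = (\<Prod>C\<in>P. card (D C))"
    proof (rule prod.cong[OF refl])
      fix C assume C: "C \<in> P"
      have sd: "\<sigma> C *v d \<in> Fqn n"
        using d by (auto simp: N_def intro: Fqn_closed)
      have "bij_betw (\<lambda>v. v + \<sigma> C *v d) {v \<in> N. v + \<sigma> C *v d \<in> D C} (D C)"
      proof (rule bij_betw_byWitness[where f' = "\<lambda>v. v - \<sigma> C *v d"])
        show "(\<lambda>v. v - \<sigma> C *v d) ` D C \<subseteq> {v \<in> N. v + \<sigma> C *v d \<in> D C}"
          using D[OF C] sd by (auto simp: N_def intro: Fqn_closed)
      qed auto
      then show "card {v \<in> N. v + \<sigma> C *v d \<in> D C} = card (D C)"
        by (rule bij_betw_same_card)
    qed
    finally show ?thesis .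
  qed
  have "Q * (\<Prod>C\<in>P. real (card (D C))) = real (\<Sum>d\<in>N. card {y \<in> Y. \<forall>C\<in>P. y C + \<sigma> C *v d \<in> D C})"
    by (simp add: count cardN)
  also have "(\<Sum>d\<in>N. card {y \<in> Y. \<forall>C\<in>P. y C + \<sigma> C *v d \<in> D C}) = (\<Sum>y\<in>Y. card {d \<in> N. \<forall>C\<in>P. y C + \<sigma> C *v d \<in> D C})"
    by (rule sum_card_swap[OF finN finY])
  finally have "Q * (\<Prod>C\<in>P. real (card (D C))) \<le> (\<Sum>y\<in>Y. real (card {d \<in> N. \<forall>C\<in>P. y C + \<sigma> C *v d \<in> D C}))"
    by simp
  then obtain y where y: "Q * (\<Prod>C\<in>P. real (card (D C))) \<le> Q ^ card P * card {d \<in> N. \<forall>C\<in>P. y C + \<sigma> C *v d \<in> D C}"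
    using exists_ge_average[OF finY Yne, of "Q * (\<Prod>C\<in>P. real (card (D C)))"
      "\<lambda>y. real (card {d \<in> N. \<forall>C\<in>P. y C + \<sigma> C *v d \<in> D C})" "Q ^ card P"] cardY by auto
  define E where "E = {d \<in> N. \<forall>C\<in>P. y C + \<sigma> C *v d \<in> D C}"
  have "Q ^ card P * (\<delta> ^ card P * Q) = Q * (\<Prod>C\<in>P. \<delta> * Q)"
    by (simp add: power_mult_distrib)
  also have "\<dots> \<le> Q * (\<Prod>C\<in>P. real (card (D C)))"
  proof (intro mult_left_mono prod_mono conjI)
    fix C assume "C \<in> P"
    then show "\<delta> * Q \<le> card (D C)"
      using \<delta> Q unfolding card_eq_dens[of "D C" n] Q_def by (intro mult_right_mono) auto
  qed (use \<delta>(2) Q in auto)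
  also have "\<dots> \<le> Q ^ card P * card E"
    using y by (simp add: E_def)
  finally have "\<delta> ^ card P * Q \<le> card E"
    using Q by simp
  then have "\<delta> ^ card P \<le> dens n E"
    using Q by (simp add: dens_def Q_def pos_le_divide_eq)
  then show ?thesis
    by (intro exI[of _ y] exI[of _ E]) (auto simp: E_def N_def)
qed

text \<open>Pigeonhole on the ordered pairs of distinct elements, grouped by difference. Equal pairs
  are discarded because \<open>e\<close> must be nonzero; by \<open>card E \<ge> 2\<close> they are
  at most half of all pairs.\<close>

lemma exists_popular_difference:
  fixes E :: "(nat \<Rightarrow> 'a::{field,finite}) set"
  assumes E: "E \<subseteq> Fqn n" and card: "card E \<ge> 2"
  shows "\<exists>e\<in>Fqn n. e \<noteq> 0 \<and> (dens n E)\<^sup>2 * real CARD('a) ^ n / 2 \<le> card {d \<in> E. d + e \<in> E}"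
proof -
  define Q where "Q = real CARD('a) ^ n"
  define Z where "Z = Fqn n - {0 :: nat \<Rightarrow> 'a}"
  have Q: "Q > 0"
    by (simp add: Q_def)
  have finE: "finite E"
    by (rule finite_subset_Fqn[OF E])
  have finZ: "finite Z"
    by (simp add: Z_def finite_Fqn)
  have Zne: "Z \<noteq> {}"
  proof
    assume "Z = {}"
    then have "E \<subseteq> {0}"
      using E by (auto simp: Z_def)
    then have "card E \<le> card {0 :: nat \<Rightarrow> 'a}"
      by (intro card_mono) auto
    then show False
      using card by simp
  qed
  have cardZ: "real (card Z) \<le> Q"
    unfolding Q_def by (rule card_le_Fqn) (auto simp: Z_def)
  let ?O = "E \<times> E - (\<lambda>d. (d, d)) ` E"
  have "card ?O = card E * card E - card E"
    using finE by (subst card_Diff_subset) (auto simp: card_cartesian_product card_image inj_on_def)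
  moreover have "card ?O \<le> card (SIGMA e:Z. {d \<in> E. d + e \<in> E})"
  proof (rule card_inj_on_le[where f = "\<lambda>(d, d'). (d' - d, d)"])
    show "inj_on (\<lambda>(d, d'). (d' - d, d)) ?O"
      by (auto simp: inj_on_def)
    show "(\<lambda>(d, d'). (d' - d, d)) ` ?O \<subseteq> (SIGMA e:Z. {d \<in> E. d + e \<in> E})"
      using E by (auto simp: Z_def image_iff intro!: Fqn_closed)
    show "finite (SIGMA e:Z. {d \<in> E. d + e \<in> E})"
      using finZ finE by simp
  qed
  moreover have "card (SIGMA e:Z. {d \<in> E. d + e \<in> E}) = (\<Sum>e\<in>Z. card {d \<in> E. d + e \<in> E})"
    using finZ finE by simp
  ultimately have "real (card E * card E - card E) \<le> (\<Sum>e\<in>Z. real (card {d \<in> E. d + e \<in> E}))"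
    unfolding of_nat_sum[symmetric] of_nat_le_iff by simp
  moreover have "real (card E * card E - card E) = real (card E) * real (card E) - card E"
    by (simp add: of_nat_diff)
  moreover have "2 * real (card E) \<le> real (card E) * real (card E)"
    using card by (intro mult_right_mono) auto
  ultimately have "(card E)\<^sup>2 / 2 \<le> (\<Sum>e\<in>Z. real (card {d \<in> E. d + e \<in> E}))"
    by (simp add: power2_eq_square)
  then obtain e where e: "e \<in> Z" "(card E)\<^sup>2 / 2 \<le> Q * card {d \<in> E. d + e \<in> E}"
    using exists_ge_average[OF finZ Zne _ _ cardZ, of "(card E)\<^sup>2 / 2" "\<lambda>e. real (card {d \<in> E. d + e \<in> E})"] by auto
  have "real ((card E)\<^sup>2) = Q * ((dens n E)\<^sup>2 * Q)"
    by (simp add: card_eq_dens[of E n] Q_def power2_eq_square)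
  then have "Q * ((dens n E)\<^sup>2 * Q / 2) \<le> Q * card {d \<in> E. d + e \<in> E}"
    using e(2) by simp
  then have "(dens n E)\<^sup>2 * Q / 2 \<le> card {d \<in> E. d + e \<in> E}"
    using Q by (simp only: mult_le_cancel_left_pos)
  then show ?thesis
    using e(1) by (auto simp: Z_def Q_def)
qed

lemma reps_insert_ge:
  fixes c :: "'j \<Rightarrow> 'a::{field,finite}" and \<tau> :: real
  assumes J: "finite J" "j \<notin> J" and T: "finite T" and Z: "Z \<subseteq> T"
    and \<tau>: "\<And>x. x \<in> Z \<Longrightarrow> \<tau> \<le> reps J c T (h - c j *v x)"
  shows "card Z * \<tau> \<le> reps (insert j J) c T h"
proof -
  have "card Z * \<tau> \<le> (\<Sum>x\<in>Z. real (reps J c T (h - c j *v x)))"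
    by (rule sum_bounded_below[OF \<tau>])
  also have "\<dots> \<le> (\<Sum>x\<in>T. real (reps J c T (h - c j *v x)))"
    using T Z by (intro sum_mono2) auto
  finally show ?thesis
    by (simp add: reps_insert[OF J T])
qed

text \<open>
  Each \<open>C\<close> has a dense set \<open>D C\<close> of popular points once one index \<open>\<rho> C\<close> is removed. A line
  \<open>d \<mapsto> (y\<^sub>C + \<sigma>\<^sub>C d)\<^sub>C\<close> meets \<open>\<Prod>\<^sub>C D C\<close> in a dense set of parameters, and a popular difference of that
  set serves all classes at once.
\<close>
lemma common_popular_multiple:
  fixes c :: "'j \<Rightarrow> 'a::{field,finite}"
  assumes P: "finite P" "P \<noteq> {}" "\<And>C. C \<in> P \<Longrightarrow> finite C" "\<And>C. C \<in> P \<Longrightarrow> card C \<ge> 2"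
    and c: "\<And>C j. C \<in> P \<Longrightarrow> j \<in> C \<Longrightarrow> c j \<noteq> 0" and zero: "\<And>C. C \<in> P \<Longrightarrow> (\<Sum>j\<in>C. c j) = 0"
  shows "\<exists>\<kappa>>0. \<exists>L. \<forall>n T. T \<subseteq> Fqn n \<longrightarrow> 2 \<le> (dens n T / 2) ^ card P * real CARD('a) ^ n \<longrightarrow>
    (\<exists>e. e \<noteq> 0 \<and> (\<forall>C\<in>P. \<kappa> * dens n T ^ L * (real CARD('a) ^ n) ^ (card C - 1) \<le> reps C c T (r C *v e)))"
proof -
  define \<rho> where "\<rho> C = (SOME j. j \<in> C)" for C :: "'j set"
  define C' where "C' C = C - {\<rho> C}" for C
  have \<rho>: "\<rho> C \<in> C" if "C \<in> P" for C
  proof -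
    have "C \<noteq> {}"
      using P(4)[OF that] by auto
    then show ?thesis
      by (simp add: \<rho>_def some_in_eq)
  qed
  have C': "C = insert (\<rho> C) (C' C)" "\<rho> C \<notin> C' C" "finite (C' C)" "card C = Suc (card (C' C))"
      "C' C \<noteq> {}" "(\<Sum>j\<in>C' C. c j) = - c (\<rho> C)" if "C \<in> P" for C
  proof -
    show 1: "C = insert (\<rho> C) (C' C)" and 2: "\<rho> C \<notin> C' C" and 3: "finite (C' C)"
      using \<rho>[OF that] P(3)[OF that] by (auto simp: C'_def)
    show 4: "card C = Suc (card (C' C))"
      by (subst 1) (simp add: 2 3)
    then show "C' C \<noteq> {}"
      using P(4)[OF that] by auto
    have "c (\<rho> C) + (\<Sum>j\<in>C' C. c j) = 0"
      using zero[OF that] by (subst (asm) 1) (simp add: 2 3)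
    then show "(\<Sum>j\<in>C' C. c j) = - c (\<rho> C)"
      by (simp add: eq_neg_iff_add_eq_0 add.commute)
  qed
  define R where "R C \<kappa> L \<longleftrightarrow> (\<forall>n T. T \<subseteq> Fqn n \<longrightarrow> (\<exists>G\<subseteq>T. dens n T / 2 \<le> dens n G \<and>
    (\<forall>z\<in>G. \<kappa> * dens n T ^ L * (real CARD('a) ^ n) ^ (card (C' C) - 1) \<le> reps (C' C) c T ((\<Sum>j\<in>C' C. c j) *v z))))"
    for C \<kappa> L
  have "\<exists>\<kappa>>0. \<exists>L. \<forall>C\<in>P. R C \<kappa> L"
  proof (rule uniform_constants[OF P(1)])
    show "\<exists>\<kappa>>0. \<exists>L. R C \<kappa> L" if "C \<in> P" for C
      unfolding R_def
    proof (rule popular_half)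
      show "popular (C' C) c"
        using C'[OF that] c[OF that] by (intro popular_nonzero) auto
      show "finite (C' C)"
        by (rule C'(3)[OF that])
    qed
    fix C \<kappa> L \<kappa>' L' assume R: "R C \<kappa> L" and le: "0 < \<kappa>'" "\<kappa>' \<le> \<kappa>" "L \<le> L'"
    show "R C \<kappa>' L'"
      unfolding R_def
    proof (intro allI impI)
      fix n and T :: "(nat \<Rightarrow> 'a) set" assume T: "T \<subseteq> Fqn n"
      from R[unfolded R_def, rule_format, OF T]
      obtain G where G: "G \<subseteq> T" "dens n T / 2 \<le> dens n G"
        "\<forall>z\<in>G. \<kappa> * dens n T ^ L * (real CARD('a) ^ n) ^ (card (C' C) - 1) \<le> reps (C' C) c T ((\<Sum>j\<in>C' C. c j) *v z)"
        by (elim exE conjE) (rule that)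
      have "\<kappa>' * dens n T ^ L' * (real CARD('a) ^ n) ^ (card (C' C) - 1) \<le> \<kappa> * dens n T ^ L * (real CARD('a) ^ n) ^ (card (C' C) - 1)"
        by (rule threshold_mono[OF le T]) simp
      then have "\<forall>z\<in>G. \<kappa>' * dens n T ^ L' * (real CARD('a) ^ n) ^ (card (C' C) - 1) \<le> reps (C' C) c T ((\<Sum>j\<in>C' C. c j) *v z)"
        using G(3) order_trans by blast
      then show "\<exists>G\<subseteq>T. dens n T / 2 \<le> dens n G \<and>
          (\<forall>z\<in>G. \<kappa>' * dens n T ^ L' * (real CARD('a) ^ n) ^ (card (C' C) - 1) \<le> reps (C' C) c T ((\<Sum>j\<in>C' C. c j) *v z))"
        using G(1,2) by (intro exI[of _ G] conjI)
    qed
  qed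
  then obtain \<kappa> L where \<kappa>: "\<kappa> > 0" and R: "\<forall>C\<in>P. R C \<kappa> L"
    by blast
  define p where "p = card P"
  have p: "p \<ge> 1"
    using P(1,2) by (simp add: p_def Suc_le_eq card_gt_0_iff)
  \<comment> \<open>The count \<open>\<epsilon>\<close> below is the square of
    \<open>(dens n T / 2) ^ p\<close> times \<open>Q / 2\<close>; this explains
    \<open>2 * 4 ^ p\<close> and the exponent \<open>2 * p\<close>.\<close>
  define \<mu> where "\<mu> = \<kappa> / (2 * 4 ^ p)"
  have "\<exists>e. e \<noteq> 0 \<and> (\<forall>C\<in>P. \<mu> * dens n T ^ (2 * p + L) * (real CARD('a) ^ n) ^ (card C - 1) \<le> reps C c T (r C *v e))"
    if T: "T \<subseteq> Fqn n" and large: "2 \<le> (dens n T / 2) ^ p * real CARD('a) ^ n" for n T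
  proof -
    define Q where "Q = real CARD('a) ^ n"
    define \<delta> where "\<delta> = dens n T / 2"
    define \<tau> where "\<tau> C = \<kappa> * dens n T ^ L * Q ^ (card (C' C) - 1)" for C
    have Q: "Q > 0"
      by (simp add: Q_def)
    have \<tau>0: "0 \<le> \<tau> C" for C
      using \<kappa> Q by (simp add: \<tau>_def)
    have \<delta>: "0 \<le> \<delta>" "\<delta> \<le> 1"
      using dens_le_1[OF T] by (auto simp: \<delta>_def)
    have finT: "finite T"
      by (rule finite_subset_Fqn[OF T])
    have "\<forall>C\<in>P. \<exists>G. G \<subseteq> T \<and> \<delta> \<le> dens n G \<and> (\<forall>z\<in>G. \<tau> C \<le> reps (C' C) c T ((\<Sum>j\<in>C' C. c j) *v z))"
      using R T unfolding R_def \<delta>_def \<tau>_def Q_def by blast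
    then obtain D where D: "\<forall>C\<in>P. D C \<subseteq> T \<and> \<delta> \<le> dens n (D C) \<and> (\<forall>z\<in>D C. \<tau> C \<le> reps (C' C) c T ((\<Sum>j\<in>C' C. c j) *v z))"
      by (rule bchoice[THEN exE])
    \<comment> \<open>The slope is chosen so that replacing \<open>d\<close> by \<open>d + e\<close>
      raises \<open>c (\<rho> C) *v (y C + \<sigma> C *v d)\<close> by exactly
      \<open>r C *v e\<close>.\<close>
    define \<sigma> where "\<sigma> C = r C / c (\<rho> C)" for C
    obtain y E where E: "E \<subseteq> Fqn n" "\<delta> ^ p \<le> dens n E" "\<forall>d\<in>E. \<forall>C\<in>P. y C + \<sigma> C *v d \<in> D C"
      using exists_dense_line[OF P(1), of D n \<delta> \<sigma>] D T \<delta>(1) unfolding p_def by blast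
    have "2 \<le> \<delta> ^ p * Q"
      using large by (simp add: \<delta>_def Q_def)
    also have "\<dots> \<le> card E"
      unfolding card_eq_dens[of E n] Q_def using E(2) by (intro mult_right_mono) auto
    finally have "card E \<ge> 2"
      by simp
    then obtain e where e: "e \<noteq> 0" "(dens n E)\<^sup>2 * Q / 2 \<le> card {d \<in> E. d + e \<in> E}"
      using exists_popular_difference[OF E(1)] unfolding Q_def by blast
    define \<epsilon> where "\<epsilon> = (\<delta> ^ p)\<^sup>2 * Q / 2"
    have "(\<delta> ^ p)\<^sup>2 \<le> (dens n E)\<^sup>2"
      using E(2) \<delta> by (intro power_mono) auto
    then have "(\<delta> ^ p)\<^sup>2 * Q \<le> (dens n E)\<^sup>2 * Q"
      using Q by (intro mult_right_mono) auto
    then have \<epsilon>e: "\<epsilon> \<le> card {d \<in> E. d + e \<in> E}"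
      unfolding \<epsilon>_def using e(2) by linarith
    have "\<mu> * dens n T ^ (2 * p + L) * Q ^ (card C - 1) \<le> reps C c T (r C *v e)" if C: "C \<in> P" for C
    proof -
      note C'C = C'[OF C]
      have c\<rho>: "c (\<rho> C) \<noteq> 0"
        using c[OF C \<rho>[OF C]] .
      obtain Z where Z: "Z \<subseteq> T" "\<epsilon> \<le> card Z" "\<And>x. x \<in> Z \<Longrightarrow> \<tau> C \<le> reps (C' C) c T (r C *v e - c (\<rho> C) *v x)"
      proof (cases "r C = 0")
        \<comment> \<open>The line is constant in this class and supplies a single point, but the
          target is 0, so every point of \<open>D C\<close> may take the index
          \<open>\<rho> C\<close>.\<close>
        case True
        show ?thesis
        proof
          show "D C \<subseteq> T"
            using D C by blast
          have "\<delta> ^ (2 * p) \<le> \<delta> ^ 1"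
            using \<delta> p by (intro power_decreasing) auto
          then have "(\<delta> ^ p)\<^sup>2 \<le> dens n (D C)"
            using D C by (auto simp: power_mult mult.commute power_even_eq intro: order_trans)
          then have "(\<delta> ^ p)\<^sup>2 * Q \<le> card (D C)"
            unfolding card_eq_dens[of "D C" n] Q_def by (intro mult_right_mono) auto
          moreover have "0 \<le> (\<delta> ^ p)\<^sup>2 * Q"
            using Q by simp
          ultimately show "\<epsilon> \<le> card (D C)"
            unfolding \<epsilon>_def by linarith
          fix x assume "x \<in> D C"
          then have "\<tau> C \<le> reps (C' C) c T ((- c (\<rho> C)) *v x)"
            using D C C'C(6) by metis
          moreover have "(- c (\<rho> C)) *v x = r C *v e - c (\<rho> C) *v x"
            using True by (simp add: fun_eq_iff)
          ultimately show "\<tau> C \<le> reps (C' C) c T (r C *v e - c (\<rho> C) *v x)"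
            by simp
        qed
      next
        case False
        \<comment> \<open>Both ends of the difference are used: the point at \<open>d + e\<close>
          lies in \<open>T\<close> and takes the index \<open>\<rho> C\<close>, and the point at
          \<open>d\<close> is popular for the remaining indices.\<close>
        let ?f = "\<lambda>d. y C + \<sigma> C *v (d + e)"
        have \<sigma>: "\<sigma> C \<noteq> 0"
          using False c\<rho> by (simp add: \<sigma>_def)
        show ?thesis
        proof
          show "?f ` {d \<in> E. d + e \<in> E} \<subseteq> T"
            using E(3) D C by blast
          have "inj_on ?f {d \<in> E. d + e \<in> E}"
            using \<sigma> by (intro inj_onI) (simp add: smult_eq_iff)
          then show "\<epsilon> \<le> card (?f ` {d \<in> E. d + e \<in> E})"
            using \<epsilon>e by (simp add: card_image)
          fix x assume "x \<in> ?f ` {d \<in> E. d + e \<in> E}"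
          then obtain d where d: "d \<in> E" "x = ?f d"
            by blast
          then have "y C + \<sigma> C *v d \<in> D C"
            using E(3) C by blast
          then have "\<tau> C \<le> reps (C' C) c T ((- c (\<rho> C)) *v (y C + \<sigma> C *v d))"
            using D C C'C(6) by metis
          moreover have "(- c (\<rho> C)) *v (y C + \<sigma> C *v d) = r C *v e - c (\<rho> C) *v x"
            using c\<rho> by (simp add: fun_eq_iff d(2) \<sigma>_def field_simps)
          ultimately show "\<tau> C \<le> reps (C' C) c T (r C *v e - c (\<rho> C) *v x)"
            by simp
        qed
      qed
      have "\<mu> * dens n T ^ (2 * p + L) * Q ^ (card C - 1) = \<epsilon> * \<tau> C"
      proof -
        have "card C - 1 = Suc (card (C' C) - 1)"
          using C'C by (simp add: card_gt_0_iff)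
        moreover have "(\<delta> ^ p)\<^sup>2 = dens n T ^ (2 * p) / 4 ^ p"
          by (simp add: \<delta>_def power_divide power_mult mult.commute[of p] flip: power_mult[of _ p 2])
        ultimately show ?thesis
          by (simp add: \<mu>_def \<epsilon>_def \<tau>_def power_add mult_ac)
      qed
      also have "\<dots> \<le> card Z * \<tau> C"
        using Z(2) \<tau>0 by (rule mult_right_mono)
      also have "\<dots> \<le> reps (insert (\<rho> C) (C' C)) c T (r C *v e)"
        using C'C(3,2) finT Z(1,3) by (rule reps_insert_ge)
      finally show ?thesis
        using C'C(1) by simp
    qed
    then show ?thesis
      using e(1) unfolding Q_def by blast
  qed
  moreover have "\<mu> > 0"
    using \<kappa> by (simp add: \<mu>_def)
  ultimately show ?thesis
    unfolding p_def by blast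
qed

section \<open>Column classes and affine dimension\<close>

lemma col_equiv_refl: "col_equiv m A j j"
  unfolding col_equiv_def by (intro exI[of _ 1]) simp

lemma col_equiv_sym: "col_equiv m A j j' \<Longrightarrow> col_equiv m A j' j"
  unfolding col_equiv_def
proof (elim exE conjE)
  fix c assume "c \<noteq> 0" "\<forall>i<m. A i j = c * A i j'"
  then show "\<exists>c. c \<noteq> 0 \<and> (\<forall>i<m. A i j' = c * A i j)"
    by (intro exI[of _ "inverse c"]) simp
qed

lemma col_equiv_trans: "col_equiv m A j j' \<Longrightarrow> col_equiv m A j' j'' \<Longrightarrow> col_equiv m A j j''"
  unfolding col_equiv_def
proof (elim exE conjE)
  fix c d assume "c \<noteq> 0" "\<forall>i<m. A i j = c * A i j'" "d \<noteq> 0" "\<forall>i<m. A i j' = d * A i j''"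
  then show "\<exists>c. c \<noteq> 0 \<and> (\<forall>i<m. A i j = c * A i j'')"
    by (intro exI[of _ "c * d"]) simp
qed

lemma partition_col_classes: "partition_on {..<k} (col_classes m k A)"
proof -
  have "equiv {..<k} {(j, j'). j < k \<and> j' < k \<and> col_equiv m A j j'}"
    by (auto simp: equiv_def refl_on_def sym_def trans_def col_equiv_refl intro: col_equiv_sym col_equiv_trans)
  then have "partition_on {..<k} ({..<k} // {(j, j'). j < k \<and> j' < k \<and> col_equiv m A j j'})"
    by (rule partition_on_quotient)
  moreover have "{..<k} // {(j, j'). j < k \<and> j' < k \<and> col_equiv m A j j'} = col_classes m k A"
    by (auto simp: quotient_def col_classes_def)
  ultimately show ?thesis
    by simp
qed

lemma col_classes_factor:
  fixes A :: "nat \<Rightarrow> nat \<Rightarrow> 'a::field"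
  obtains c :: "nat \<Rightarrow> 'a" and a :: "nat set \<Rightarrow> nat \<Rightarrow> 'a" where
    "\<And>j. c j \<noteq> 0" "\<And>C j i. C \<in> col_classes m k A \<Longrightarrow> j \<in> C \<Longrightarrow> i < m \<Longrightarrow> A i j = c j * a C i"
proof -
  define \<rho> where "\<rho> C = (SOME j. j \<in> C)" for C :: "nat set"
  have "\<exists>d. d \<noteq> 0 \<and> (\<forall>C\<in>col_classes m k A. j \<in> C \<longrightarrow> (\<forall>i<m. A i j = d * A i (\<rho> C)))" for j
  proof (cases "\<exists>C\<in>col_classes m k A. j \<in> C")
    case True
    then obtain C where C: "C \<in> col_classes m k A" "j \<in> C"
      by blast
    then have "\<rho> C \<in> C"
      unfolding \<rho>_def by (intro someI)
    then have "col_equiv m A j (\<rho> C)"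
      using C by (auto simp: col_classes_def intro: col_equiv_sym col_equiv_trans)
    moreover have "D = C" if "D \<in> col_classes m k A" "j \<in> D" for D
      using partition_col_classes[of k m A] C that by (auto simp: partition_on_def disjoint_def)
    ultimately show ?thesis
      unfolding col_equiv_def by metis
  next
    \<comment> \<open>An index outside all classes gets the scalar 1, so that
      \<open>c j \<noteq> 0\<close> holds without a range condition.\<close>
    case False
    then show ?thesis
      by (intro exI[of _ 1]) auto
  qed
  then obtain d where "\<forall>j. d j \<noteq> 0 \<and> (\<forall>C\<in>col_classes m k A. j \<in> C \<longrightarrow> (\<forall>i<m. A i j = d j * A i (\<rho> C)))"
    by metis
  then show ?thesis
    by (intro that[of d "\<lambda>C i. A i (\<rho> C)"]) auto
qed

lemma sum_over_classes:
  fixes k :: nat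
  assumes "partition_on {..<k} P"
  shows "(\<Sum>j<k. f j) = (\<Sum>C\<in>P. \<Sum>j\<in>C. f j)"
proof -
  have "finite C" if "C \<in> P" for C
  proof (rule finite_subset)
    show "C \<subseteq> {..<k}"
      using that assms by (auto simp: partition_on_def)
  qed simp
  then have "(\<Sum>j\<in>\<Union>P. f j) = (\<Sum>C\<in>P. \<Sum>j\<in>C. f j)"
    using assms by (subst sum.Union_disjoint) (auto simp: partition_on_def disjoint_def)
  then show ?thesis
    using assms by (simp add: partition_on_def)
qed

text \<open>Within a class the factor \<open>c j / c j'\<close> relates the columns of
  \<open>A\<close>, and by proportionality also the new entries. Conversely, an equivalence of the
  longer columns restricts to the shorter ones.\<close>

lemma preserves_classes_if_proportional:
  fixes A :: "nat \<Rightarrow> nat \<Rightarrow> 'a::field"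
  assumes c: "\<And>j. c j \<noteq> 0" and factor: "\<And>C j i. C \<in> col_classes m k A \<Longrightarrow> j \<in> C \<Longrightarrow> i < m \<Longrightarrow> A i j = c j * a C i"
    and proportional: "\<And>C j j'. C \<in> col_classes m k A \<Longrightarrow> j \<in> C \<Longrightarrow> j' \<in> C \<Longrightarrow> b j * c j' = b j' * c j"
  shows "preserves_classes m k A b"
proof -
  have "col_equiv (Suc m) (append_row m A b) j j' \<longleftrightarrow> col_equiv m A j j'" if jk: "j < k" "j' < k" for j j'
  proof
    assume "col_equiv (Suc m) (append_row m A b) j j'"
    then obtain d where d: "d \<noteq> 0" "\<forall>i<Suc m. append_row m A b i j = d * append_row m A b i j'"
      unfolding col_equiv_def by blast
    have "A i j = d * A i j'" if "i < m" for i
      using d(2)[rule_format, of i] that by (simp add: append_row_def)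
    then show "col_equiv m A j j'"
      unfolding col_equiv_def using d(1) by blast
  next
    assume eq: "col_equiv m A j j'"
    define C where "C = {j'. j' < k \<and> col_equiv m A j j'}"
    have C: "C \<in> col_classes m k A" "j \<in> C" "j' \<in> C"
      using jk eq by (auto simp: C_def col_classes_def col_equiv_refl)
    have "append_row m A b i j = c j / c j' * append_row m A b i j'" if "i < Suc m" for i
    proof (cases "i = m")
      case True
      then show ?thesis
        using proportional[OF C] c[of j'] by (simp add: append_row_def field_simps)
    next
      case False
      then show ?thesis
        using that factor[OF C(1,2), of i] factor[OF C(1,3), of i] c[of j'] by (simp add: append_row_def)
    qed
    then show "col_equiv (Suc m) (append_row m A b) j j'"
      unfolding col_equiv_def using c[of j] c[of j'] by (intro exI[of _ "c j / c j'"]) simp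
  qed
  then show ?thesis
    unfolding preserves_classes_def col_classes_def by (intro image_cong) auto
qed

lemma aff_dim_pts_ge:
  shows "- 1 \<le> aff_dim_pts k x"
    and "J \<subseteq> {..<k} \<Longrightarrow> J \<noteq> {} \<Longrightarrow> aff_indep J x \<Longrightarrow> int (card J) - 1 \<le> aff_dim_pts k x"
proof -
  let ?S = "{int (card J) - 1 | J. J \<subseteq> {..<k} \<and> J \<noteq> {} \<and> aff_indep J x}"
  have "?S \<subseteq> (\<lambda>J. int (card J) - 1) ` Pow {..<k}"
    by auto
  then have fin: "finite (insert (- 1) ?S)"
    using finite_subset by auto
  show "- 1 \<le> aff_dim_pts k x"
    unfolding aff_dim_pts_def by (rule Max_ge[OF fin]) simp
  show "int (card J) - 1 \<le> aff_dim_pts k x" if "J \<subseteq> {..<k}" "J \<noteq> {}" "aff_indep J x"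
    unfolding aff_dim_pts_def by (rule Max_ge[OF fin]) (use that in auto)
qed

text \<open>Every relation among the remaining points vanishes on a class from which a point was removed.\<close>
lemma aff_dim_pts_ge_removed:
  fixes c :: "nat \<Rightarrow> 'a::field"
  assumes P: "partition_on {..<k} P" and c: "\<And>j. c j \<noteq> 0"
    and proportional: "\<And>b C j j'. satisfies_eq k b x \<Longrightarrow> C \<in> P \<Longrightarrow> j \<in> C \<Longrightarrow> j' \<in> C \<Longrightarrow> b j * c j' = b j' * c j"
    and P': "P' \<subseteq> P"
    and rest: "\<And>C. C \<in> P - P' \<Longrightarrow> P' = P - {C} \<and> ((\<Sum>j\<in>C. c j) \<noteq> 0 \<or> (\<Sum>j\<in>C. c j *v x j) \<noteq> 0)"
  shows "int k - int (card P') - 1 \<le> aff_dim_pts k x"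
proof -
  have CP: "C \<subseteq> {..<k}" "C \<noteq> {}" "finite C" if "C \<in> P" for C
    using P that finite_subset[of C "{..<k}"] by (auto simp: partition_on_def)
  have disj: "C \<inter> D = {}" if "C \<in> P" "D \<in> P" "C \<noteq> D" for C D
    using P that by (auto simp: partition_on_def disjoint_def)
  define \<rho> where "\<rho> C = (SOME j. j \<in> C)" for C :: "nat set"
  have \<rho>: "\<rho> C \<in> C" if "C \<in> P" for C
    using CP(2)[OF that] unfolding \<rho>_def by (auto intro: someI)
  have fP: "finite P"
    using P finite_elements by blast
  have inj: "inj_on \<rho> P'"
  proof (rule inj_onI, rule ccontr)
    fix C D assume CD: "C \<in> P'" "D \<in> P'" "\<rho> C = \<rho> D" "C \<noteq> D"
    then have "\<rho> C \<in> C \<inter> D"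
      using \<rho>[of C] \<rho>[of D] P' by auto
    then show False
      using disj[of C D] CD P' by auto
  qed
  define J where "J = {..<k} - \<rho> ` P'"
  have Uk: "\<rho> ` P' \<subseteq> {..<k}"
    using \<rho> CP(1) P' by blast
  have "card J = k - card P'"
    using Uk fP P' finite_subset[of P' P] by (simp add: J_def card_Diff_subset card_image[OF inj])
  moreover have "card P' \<le> k"
    using card_mono[OF _ Uk] card_image[OF inj] by simp
  ultimately have cardJ: "int (card J) - 1 = int k - int (card P') - 1"
    by simp
  have "aff_indep J x"
    unfolding aff_indep_def
  proof (intro allI impI ballI)
    fix b j assume b: "(\<Sum>j\<in>J. b j) = 0 \<and> (\<forall>t. (\<Sum>j\<in>J. b j * x j t) = 0)" and j: "j \<in> J"
    \<comment> \<open>Extended by 0, the relation vanishes at every removed point, hence by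
      proportionality on the whole class of that point.\<close>
    define b' where "b' i = (if i \<in> J then b i else 0)" for i
    have sum_b': "(\<Sum>i<k. b' i * f i) = (\<Sum>i\<in>J. b i * f i)" for f :: "nat \<Rightarrow> 'a"
      by (rule sum.mono_neutral_cong_right) (auto simp: b'_def J_def)
    have sat: "satisfies_eq k b' x"
      using b sum_b'[of "\<lambda>j. x j t" for t] by (simp add: satisfies_eq_def)
    have bal: "(\<Sum>i<k. b' i) = 0"
      using b sum_b'[of "\<lambda>_. 1"] by simp
    have zero: "b' i = 0" if "C \<in> P'" "i \<in> C" for C i
    proof -
      have "b' i * c (\<rho> C) = b' (\<rho> C) * c i"
        using proportional[OF sat _ that(2) \<rho>] that P' by auto
      moreover have "b' (\<rho> C) = 0"
        using that by (auto simp: b'_def J_def)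
      ultimately show ?thesis
        using c[of "\<rho> C"] by simp
    qed
    obtain C where C: "C \<in> P" "j \<in> C"
      using j P by (auto simp: J_def partition_on_def)
    have "b' j = 0"
    proof (cases "C \<in> P'")
      case True
      then show ?thesis
        using zero C by blast
    next
      case False
      \<comment> \<open>Only \<open>C\<close> is intact, so \<open>b'\<close> is
        \<open>\<mu> * c\<close> on \<open>C\<close> and 0 elsewhere. The two conditions on the
        relation say that \<open>\<mu>\<close> annihilates both the coefficient sum and the class
        sum of \<open>C\<close>.\<close>
      then have rest': "P' = P - {C}" "(\<Sum>j\<in>C. c j) \<noteq> 0 \<or> (\<Sum>j\<in>C. c j *v x j) \<noteq> 0"
        using rest[of C] C by auto
      define \<mu> where "\<mu> = b' j / c j"
      have bC: "b' i = \<mu> * c i" if "i \<in> C" for i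
        using proportional[OF sat C(1) that C(2)] c[of j] by (simp add: \<mu>_def field_simps)
      have sum_C: "(\<Sum>i<k. b' i * f i) = \<mu> * (\<Sum>i\<in>C. c i * f i)" for f :: "nat \<Rightarrow> 'a"
      proof -
        have "(\<Sum>i<k. b' i * f i) = (\<Sum>D\<in>P. \<Sum>i\<in>D. b' i * f i)"
          by (rule sum_over_classes[OF P])
        also have "\<dots> = (\<Sum>D\<in>{C}. \<Sum>i\<in>D. b' i * f i)"
          using C(1) fP zero rest'(1) by (intro sum.mono_neutral_right) (auto intro!: sum.neutral)
        also have "\<dots> = \<mu> * (\<Sum>i\<in>C. c i * f i)"
          by (simp add: bC sum_distrib_left mult.assoc)
        finally show ?thesis .
      qed
      have "\<mu> * (\<Sum>i\<in>C. c i) = 0"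
        using sum_C[of "\<lambda>_. 1"] bal by simp
      moreover have "\<mu> * (\<Sum>i\<in>C. c i * x i t) = 0" for t
        using sum_C[of "\<lambda>i. x i t"] sat by (simp add: satisfies_eq_def)
      then have "\<mu> * (\<Sum>i\<in>C. c i *v x i) t = 0" for t
        by (simp add: sum_fun_apply)
      ultimately have "\<mu> = 0"
        using rest'(2) by (auto simp: fun_eq_iff)
      then show ?thesis
        using bC[OF C(2)] by simp
    qed
    then show "b j = 0"
      using j by (simp add: b'_def)
  qed
  then have "int (card J) - 1 \<le> aff_dim_pts k x" if "J \<noteq> {}"
    using that by (intro aff_dim_pts_ge) (auto simp: J_def)
  then show ?thesis
    using aff_dim_pts_ge(1)[of k x] cardJ by (cases "J = {}") auto
qed

text \<open>Otherwise the class columns and the rows are both linearly independent; by counting, every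
  class equation is then a combination of rows, and the system splits along the classes.\<close>
lemma irreducible_imp_dependent_class_columns:
  fixes A :: "nat \<Rightarrow> nat \<Rightarrow> 'a::{field,finite}"
  assumes factor: "\<And>C j i. C \<in> col_classes m k A \<Longrightarrow> j \<in> C \<Longrightarrow> i < m \<Longrightarrow> A i j = c j * a C i"
    and nd: "non_degenerate m k A" and irr: "irreducible_sys m k A" and two: "card (col_classes m k A) \<ge> 2"
  shows "\<exists>r. (\<exists>C\<in>col_classes m k A. r C \<noteq> 0) \<and> (\<forall>i<m. (\<Sum>C\<in>col_classes m k A. r C * a C i) = 0)"
proof (rule ccontr)
  assume neg: "\<not> ?thesis"
  define P where "P = col_classes m k A"
  have P: "partition_on {..<k} P"
    unfolding P_def by (rule partition_col_classes)
  have fP: "finite P"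
    by (simp add: P_def col_classes_def)
  have cover: "\<exists>C\<in>P. j \<in> C" if "j < k" for j
  proof -
    have "j \<in> \<Union>P"
      using that P by (simp add: partition_on_def)
    then show ?thesis
      by blast
  qed
  let ?R = "P \<rightarrow>\<^sub>E (UNIV :: 'a set)" and ?L = "{..<m} \<rightarrow>\<^sub>E (UNIV :: 'a set)"
  have finR: "finite ?R" and finL: "finite ?L"
    using fP by (auto simp: finite_PiE)
  have indep: "r C = 0" if "\<And>i. i < m \<Longrightarrow> (\<Sum>C\<in>P. r C * a C i) = 0" "C \<in> P" for r C
    using neg that unfolding P_def by blast
  \<comment> \<open>Independence of the class columns makes \<open>\<Psi>\<close> injective, so
    there are at least as many rows as classes.\<close>
  define \<Psi> where "\<Psi> r = (\<lambda>i\<in>{..<m}. \<Sum>C\<in>P. r C * a C i)" for r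
  have "inj_on \<Psi> ?R"
  proof (rule inj_onI)
    fix r r' assume r: "r \<in> ?R" "r' \<in> ?R" and eq: "\<Psi> r = \<Psi> r'"
    have "(\<Sum>C\<in>P. (r C - r' C) * a C i) = 0" if "i < m" for i
      using fun_cong[OF eq, of i] that by (simp add: \<Psi>_def left_diff_distrib sum_subtractf)
    then have "r C - r' C = 0" if "C \<in> P" for C
      using indep[of "\<lambda>C. r C - r' C"] that by blast
    then show "r = r'"
      using r by (intro PiE_ext[of r P "\<lambda>_. UNIV" r']) auto
  qed
  then have "card ?R \<le> card ?L"
  proof (rule card_inj_on_le)
    show "\<Psi> ` ?R \<subseteq> ?L"
      unfolding \<Psi>_def by (intro image_subsetI restrict_PiE_iff[THEN iffD2]) simp
  qed (rule finL)
  \<comment> \<open>Independence of the rows makes the transposed map injective; by the previous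
    count it is then onto.\<close>
  define \<Phi> where "\<Phi> l = (\<lambda>C\<in>P. \<Sum>i<m. l i * a C i)" for l
  have \<Phi>: "(\<Sum>i<m. l i * A i j) = c j * (\<Sum>i<m. l i * a C i)" if "C \<in> P" "j \<in> C" for l C j
    using factor that by (simp add: P_def sum_distrib_left mult.left_commute)
  have inj: "inj_on \<Phi> ?L"
  proof (rule inj_onI)
    fix l l' assume l: "l \<in> ?L" "l' \<in> ?L" and eq: "\<Phi> l = \<Phi> l'"
    have rel: "(\<Sum>i<m. (l i - l' i) * A i j) = 0" if "j < k" for j
    proof -
      obtain C where C: "C \<in> P" "j \<in> C"
        using cover \<open>j < k\<close> by blast
      have "(\<Sum>i<m. (l i - l' i) * a C i) = 0"
        using fun_cong[OF eq, of C] C by (simp add: \<Phi>_def left_diff_distrib sum_subtractf)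
      then show ?thesis
        using \<Phi>[OF C, of "\<lambda>i. l i - l' i"] by simp
    qed
    have "l i - l' i = 0" if "i < m" for i
      using nd[unfolded non_degenerate_def, THEN conjunct1, rule_format, of "\<lambda>i. l i - l' i" i] rel that by blast
    then show "l = l'"
      using l by (intro PiE_ext[of l "{..<m}" "\<lambda>_. UNIV" l']) auto
  qed
  have "\<Phi> ` ?L = ?R"
  proof (rule card_seteq[OF finR])
    show "\<Phi> ` ?L \<subseteq> ?R"
      unfolding \<Phi>_def by (intro image_subsetI restrict_PiE_iff[THEN iffD2]) simp
    show "card ?R \<le> card (\<Phi> ` ?L)"
      using \<open>card ?R \<le> card ?L\<close> by (simp add: card_image[OF inj])
  qed
  \<comment> \<open>Preimages of unit vectors: the row combination belonging to \<open>C\<close> is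
    the equation with coefficients \<open>c j\<close> on \<open>C\<close> and 0 elsewhere.\<close>
  have "\<exists>l. \<forall>D\<in>P. (\<Sum>i<m. l i * a D i) = (if D = C then 1 else 0)" for C
  proof -
    have "(\<lambda>D\<in>P. if D = C then 1 else 0) \<in> \<Phi> ` ?L"
      unfolding \<open>\<Phi> ` ?L = ?R\<close> by simp
    then obtain l where eq: "(\<lambda>D\<in>P. if D = C then 1 else 0) = \<Phi> l"
      by (rule imageE)
    have "(\<Sum>i<m. l i * a D i) = (if D = C then 1 else 0)" if "D \<in> P" for D
      using fun_cong[OF eq, of D] that unfolding \<Phi>_def by (simp only: restrict_apply if_True)
    then show ?thesis
      by blast
  qed
  then obtain l where l: "\<And>C D. D \<in> P \<Longrightarrow> (\<Sum>i<m. l C i * a D i) = (if D = C then 1 else 0)"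
    by metis
  obtain e where e: "bij_betw e {..<card P} P"
    using ex_bij_betw_nat_finite[OF fP] by (auto simp: atLeast0LessThan)
  define B where "B i j = (if j \<in> e i then c j else 0)" for i j
  have disj: "C = D" if "C \<in> P" "D \<in> P" "j \<in> C" "j \<in> D" for C D j
    using P that by (auto simp: partition_on_def disjoint_def)
  have "equiv_sys k m A (card P) B"
    unfolding equiv_sys_def lin_comb_of_def
  proof (intro conjI allI impI)
    fix i assume i: "i < card P"
    have ei: "e i \<in> P"
      using e i by (auto simp: bij_betw_def)
    show "\<exists>d. \<forall>j<k. B i j = (\<Sum>i'<m. d i' * A i' j)"
    proof (intro exI[of _ "l (e i)"] allI impI)
      fix j assume "j < k"
      then obtain C where C: "C \<in> P" "j \<in> C"
        using cover \<open>j < k\<close> by blast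
      then have "j \<in> e i \<longleftrightarrow> C = e i"
        using disj ei by blast
      then show "B i j = (\<Sum>i'<m. l (e i) i' * A i' j)"
        unfolding \<Phi>[OF C] l[OF C(1)] by (auto simp: B_def)
    qed
  next
    fix i assume i: "i < m"
    show "\<exists>d. \<forall>j<k. A i j = (\<Sum>i'<card P. d i' * B i' j)"
    proof (intro exI[of _ "\<lambda>i'. a (e i') i"] allI impI)
      fix j assume "j < k"
      then obtain C where C: "C \<in> P" "j \<in> C"
        using cover \<open>j < k\<close> by blast
      have "(\<Sum>i'<card P. a (e i') i * B i' j) = (\<Sum>i'<card P. a (e i') i * (if j \<in> e i' then c j else 0))"
        by (simp add: B_def)
      also have "\<dots> = (\<Sum>D\<in>P. a D i * (if j \<in> D then c j else 0))"
        by (rule sum.reindex_bij_betw[OF e])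
      also have "\<dots> = (\<Sum>D\<in>{C}. a D i * (if j \<in> D then c j else 0))"
        using fP C disj by (intro sum.mono_neutral_right) auto
      also have "\<dots> = A i j"
        using C factor[of C j i] i by (simp add: P_def mult.commute)
      finally show "A i j = (\<Sum>i'<card P. a (e i') i * B i' j)" ..
    qed
  qed
  moreover have "\<exists>C\<in>P. \<forall>j<k. B i j \<noteq> 0 \<longrightarrow> j \<in> C" if "i < card P" for i
    using e that by (intro bexI[of _ "e i"]) (auto simp: B_def bij_betw_def)
  ultimately have "reducible m k A"
    unfolding reducible_def using P two by (intro exI[of _ "card P"] exI[of _ B] exI[of _ P]) (auto simp: P_def)
  then show False
    using irr by (simp add: irreducible_sys_def)
qed

text \<open>The condition on some class \<open>C\<close> is what the dimension count needs from the
  class that keeps all its points. The lower bound on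
  \<open>(dens n S / 2) ^ card P * real CARD('a) ^ n\<close> ensures two parameters on the dense
  line, hence a nonzero difference.\<close>

lemma exists_popular_class_values:
  fixes A :: "nat \<Rightarrow> nat \<Rightarrow> 'a::{field,finite}" and c :: "nat \<Rightarrow> 'a" and m k :: nat
  defines "P \<equiv> col_classes m k A"
  assumes c: "\<And>j. c j \<noteq> 0" and factor: "\<And>C j i. C \<in> col_classes m k A \<Longrightarrow> j \<in> C \<Longrightarrow> i < m \<Longrightarrow> A i j = c j * a C i"
    and bal: "balanced_sys m k A" and nd: "non_degenerate m k A" and irr: "irreducible_sys m k A"
  shows "\<exists>\<kappa>>0. \<exists>L. \<forall>n S. S \<subseteq> Fqn n \<longrightarrow> S \<noteq> {} \<longrightarrow> 2 \<le> (dens n S / 2) ^ card P * real CARD('a) ^ n \<longrightarrow>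
    (\<exists>h. (\<forall>i<m. \<forall>t. (\<Sum>C\<in>P. a C i * h C t) = 0) \<and>
      (card P \<ge> 2 \<longrightarrow> (\<exists>C\<in>P. (\<Sum>j\<in>C. c j) \<noteq> 0 \<or> h C \<noteq> 0)) \<and>
      (\<forall>C\<in>P. \<kappa> * dens n S ^ L * (real CARD('a) ^ n) ^ (card C - 1) \<le> reps C c S (h C)))"
proof -
  define s where "s C = (\<Sum>j\<in>C. c j)" for C
  have P: "partition_on {..<k} P"
    unfolding P_def by (rule partition_col_classes)
  have fP: "finite P"
    by (simp add: P_def col_classes_def)
  have CP: "finite C" "C \<noteq> {}" if "C \<in> P" for C
  proof (rule finite_subset)
    show "C \<subseteq> {..<k}" "C \<noteq> {}"
      using that P by (auto simp: partition_on_def)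
  qed simp
  have fac: "A i j = c j * a C i" if "C \<in> P" "j \<in> C" "i < m" for C j i
    using factor that by (simp add: P_def)
  show ?thesis
  proof (cases "card P < 2 \<or> (\<exists>C\<in>P. s C \<noteq> 0)")
    \<comment> \<open>With \<open>h C = s C *v z\<close> the sum over the classes is a row sum of
      \<open>A\<close> times \<open>z\<close>, which vanishes by balancedness.\<close>
    case True
    have "\<exists>\<kappa>>0. \<exists>L. \<forall>n T. T \<subseteq> Fqn n \<longrightarrow> T \<noteq> {} \<longrightarrow>
        (\<exists>z\<in>T. \<forall>C\<in>P. \<kappa> * dens n T ^ L * (real CARD('a) ^ n) ^ (card C - 1) \<le> reps C c T ((\<Sum>j\<in>C. c j) *v z))"
      by (rule common_popular_point[OF fP CP(1)], assumption, rule popular_nonzero) (use CP c in auto)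
    then obtain \<kappa> L where \<kappa>: "\<kappa> > 0" and main: "\<forall>n T. T \<subseteq> Fqn n \<longrightarrow> T \<noteq> {} \<longrightarrow>
        (\<exists>z\<in>T. \<forall>C\<in>P. \<kappa> * dens n T ^ L * (real CARD('a) ^ n) ^ (card C - 1) \<le> reps C c T (s C *v z))"
      unfolding s_def by blast
    have sol: "(\<Sum>C\<in>P. a C i * (s C *v z) t) = 0" if "i < m" for i t and z :: "nat \<Rightarrow> 'a"
    proof -
      have "(\<Sum>C\<in>P. a C i * (s C *v z) t) = (\<Sum>C\<in>P. \<Sum>j\<in>C. A i j) * z t"
        using fac that by (simp add: s_def sum_distrib_left sum_distrib_right mult_ac)
      also have "\<dots> = (\<Sum>j<k. A i j) * z t"
        by (simp add: sum_over_classes[OF P])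
      also have "\<dots> = 0"
        using bal that by (simp add: balanced_sys_def balanced_eq_def)
      finally show ?thesis .
    qed
    show ?thesis
    proof (intro exI[of _ \<kappa>] exI[of _ L] conjI \<kappa> allI impI)
      fix n and S :: "(nat \<Rightarrow> 'a) set" assume "S \<subseteq> Fqn n" "S \<noteq> {}"
      then obtain z where "\<forall>C\<in>P. \<kappa> * dens n S ^ L * (real CARD('a) ^ n) ^ (card C - 1) \<le> reps C c S (s C *v z)"
        using main by blast
      then show "\<exists>h. (\<forall>i<m. \<forall>t. (\<Sum>C\<in>P. a C i * h C t) = 0) \<and>
          (card P \<ge> 2 \<longrightarrow> (\<exists>C\<in>P. (\<Sum>j\<in>C. c j) \<noteq> 0 \<or> h C \<noteq> 0)) \<and>
          (\<forall>C\<in>P. \<kappa> * dens n S ^ L * (real CARD('a) ^ n) ^ (card C - 1) \<le> reps C c S (h C))"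
        using True sol by (intro exI[of _ "\<lambda>C. s C *v z"]) (auto simp: s_def[symmetric])
    qed
  next
    case False
    then have zero: "(\<Sum>j\<in>C. c j) = 0" if "C \<in> P" for C
      using that by (simp add: s_def)
    \<comment> \<open>A class with zero coefficient sum is no singleton, because its coefficients
      are nonzero.\<close>
    have two: "card C \<ge> 2" if "C \<in> P" for C
    proof (rule ccontr)
      assume "\<not> card C \<ge> 2"
      moreover have "card C \<noteq> 0"
        using CP[OF that] by simp
      ultimately have "card C = 1"
        by linarith
      then obtain j where "C = {j}"
        by (rule card_1_singletonE)
      then show False
        using zero[OF that] c[of j] by simp
    qed
    have Pne: "P \<noteq> {}"
      using False by auto
    have "\<exists>r. (\<exists>C\<in>P. r C \<noteq> 0) \<and> (\<forall>i<m. (\<Sum>C\<in>P. r C * a C i) = 0)"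
      unfolding P_def
    proof (rule irreducible_imp_dependent_class_columns[OF _ nd irr])
      show "card (col_classes m k A) \<ge> 2"
        using False by (simp add: P_def not_less)
    qed (rule factor)
    then obtain r where r: "\<exists>C\<in>P. r C \<noteq> 0" "\<forall>i<m. (\<Sum>C\<in>P. r C * a C i) = 0"
      by (elim exE conjE) (rule that)
    have "\<exists>\<kappa>>0. \<exists>L. \<forall>n T. T \<subseteq> Fqn n \<longrightarrow> 2 \<le> (dens n T / 2) ^ card P * real CARD('a) ^ n \<longrightarrow>
        (\<exists>e. e \<noteq> 0 \<and> (\<forall>C\<in>P. \<kappa> * dens n T ^ L * (real CARD('a) ^ n) ^ (card C - 1) \<le> reps C c T (r C *v e)))"
      by (rule common_popular_multiple[OF fP Pne]) (use CP two c zero in auto)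
    then obtain \<kappa> L where \<kappa>: "\<kappa> > 0" and main: "\<forall>n T. T \<subseteq> Fqn n \<longrightarrow> 2 \<le> (dens n T / 2) ^ card P * real CARD('a) ^ n \<longrightarrow>
        (\<exists>e. e \<noteq> 0 \<and> (\<forall>C\<in>P. \<kappa> * dens n T ^ L * (real CARD('a) ^ n) ^ (card C - 1) \<le> reps C c T (r C *v e)))"
      by blast
    show ?thesis
    proof (intro exI[of _ \<kappa>] exI[of _ L] conjI \<kappa> allI impI)
      fix n and S :: "(nat \<Rightarrow> 'a) set"
      assume "S \<subseteq> Fqn n" "2 \<le> (dens n S / 2) ^ card P * real CARD('a) ^ n"
      then obtain e where e: "e \<noteq> 0" "\<forall>C\<in>P. \<kappa> * dens n S ^ L * (real CARD('a) ^ n) ^ (card C - 1) \<le> reps C c S (r C *v e)"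
        using main by blast
      have "(\<Sum>C\<in>P. a C i * (r C *v e) t) = 0" if "i < m" for i t
      proof -
        have "(\<Sum>C\<in>P. a C i * (r C *v e) t) = (\<Sum>C\<in>P. r C * a C i) * e t"
          by (simp add: sum_distrib_left mult_ac)
        then show ?thesis
          using r(2) that by simp
      qed
      moreover have "\<exists>C\<in>P. r C *v e \<noteq> 0"
        using r(1) e(1) by (auto simp: fun_eq_iff)
      ultimately show "\<exists>h. (\<forall>i<m. \<forall>t. (\<Sum>C\<in>P. a C i * h C t) = 0) \<and>
          (card P \<ge> 2 \<longrightarrow> (\<exists>C\<in>P. (\<Sum>j\<in>C. c j) \<noteq> 0 \<or> h C \<noteq> 0)) \<and>
          (\<forall>C\<in>P. \<kappa> * dens n S ^ L * (real CARD('a) ^ n) ^ (card C - 1) \<le> reps C c S (h C))"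
        using e(2) by (intro exI[of _ "\<lambda>C. r C *v e"]) blast
    qed
  qed
qed

theorem theoremC:
  fixes A :: "nat \<Rightarrow> nat \<Rightarrow> 'a::{field,finite}" and m k :: nat
  assumes "type_RC m k A" and "non_degenerate m k A" and "irreducible_sys m k A"
  shows "\<exists>\<beta> \<gamma> :: real. \<beta> > 0 \<and> \<gamma> > 0 \<and> \<gamma> < real (card (UNIV :: 'a set)) \<and>
    (\<forall>n. \<forall>S \<subseteq> Fqn n. real (card S) \<ge> \<beta> * \<gamma> ^ n \<longrightarrow>
      (\<exists>x. (\<forall>j<k. x j \<in> S) \<and> is_solution m k A x \<and>
           (\<forall>b. balanced_eq k b \<and> satisfies_eq k b x \<longrightarrow> preserves_classes m k A b) \<and>
           aff_dim_pts k x \<ge> min (int k - int (card (col_classes m k A))) (int k - 2)))"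
proof -
  define P where "P = col_classes m k A"
  define p where "p = card P"
  define q where "q = real CARD('a)"
  have q: "q \<ge> 2"
    using card_field_ge_2[where 'a = 'a] unfolding q_def by simp
  have P: "partition_on {..<k} P"
    unfolding P_def by (rule partition_col_classes)
  have fP: "finite P"
    by (simp add: P_def col_classes_def)
  obtain c a where c: "\<And>j. c j \<noteq> 0"
    and factor: "\<And>C j i. C \<in> col_classes m k A \<Longrightarrow> j \<in> C \<Longrightarrow> i < m \<Longrightarrow> A i j = c j * a C i"
    using col_classes_factor[of m k A] by metis
  have bal: "balanced_sys m k A"
    using assms(1) by (simp add: type_RC_def)
  have "\<exists>\<kappa>>0. \<exists>L. \<forall>n S. S \<subseteq> Fqn n \<longrightarrow> S \<noteq> {} \<longrightarrow> 2 \<le> (dens n S / 2) ^ p * q ^ n \<longrightarrow>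
    (\<exists>h. (\<forall>i<m. \<forall>t. (\<Sum>C\<in>P. a C i * h C t) = 0) \<and>
      (p \<ge> 2 \<longrightarrow> (\<exists>C\<in>P. (\<Sum>j\<in>C. c j) \<noteq> 0 \<or> h C \<noteq> 0)) \<and>
      (\<forall>C\<in>P. \<kappa> * dens n S ^ L * (q ^ n) ^ (card C - 1) \<le> reps C c S (h C)))"
    unfolding P_def p_def q_def
    by (rule exists_popular_class_values[OF c _ bal assms(2,3)]) (rule factor)
  then obtain \<kappa> L where \<kappa>: "\<kappa> > 0"
    and main: "\<forall>n S. S \<subseteq> Fqn n \<longrightarrow> S \<noteq> {} \<longrightarrow> 2 \<le> (dens n S / 2) ^ p * q ^ n \<longrightarrow>
    (\<exists>h. (\<forall>i<m. \<forall>t. (\<Sum>C\<in>P. a C i * h C t) = 0) \<and>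
      (p \<ge> 2 \<longrightarrow> (\<exists>C\<in>P. (\<Sum>j\<in>C. c j) \<noteq> 0 \<or> h C \<noteq> 0)) \<and>
      (\<forall>C\<in>P. \<kappa> * dens n S ^ L * (q ^ n) ^ (card C - 1) \<le> reps C c S (h C)))"
    by (elim exE conjE) (rule that)
  \<comment> \<open>\<open>M\<close> exceeds \<open>L * p\<close> and \<open>p\<close>, the powers
    of the density lost in the generic-tuple count and in the two-parameter condition; as densities
    are at most 1, one bound on the \<open>M\<close>-th power serves both. \<open>Suc\<close> keeps
    the root index positive.\<close>
  define M where "M = Suc (L * p + p)"
  \<comment> \<open>In this order: 1 gives \<open>\<beta> \<le> \<beta> ^ M\<close>, the second
    entry secures two parameters on the line, and the third beats the \<open>q ^ k\<close> unwanted
    equations.\<close>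
  define \<beta> where "\<beta> = max 1 (max (2 * 2 ^ p) ((q ^ k + 1) / \<kappa> ^ p))"
  \<comment> \<open>This is \<open>q ^ (1 - 1 / M)\<close>: a set with at least
    \<open>\<beta> * \<gamma> ^ n\<close> elements has a density whose \<open>M\<close>-th power is
    at least \<open>\<beta> / q ^ n\<close>.\<close>
  define \<gamma> where "\<gamma> = q / root M q"
  have \<beta>: "\<beta> \<ge> 1" "\<beta> \<ge> 2 * 2 ^ p" "\<beta> \<ge> (q ^ k + 1) / \<kappa> ^ p"
    by (auto simp: \<beta>_def)
  have root: "root M q > 1"
    using q by (simp add: M_def)
  have solution: "\<exists>x. (\<forall>j<k. x j \<in> S) \<and> is_solution m k A x \<and>
      (\<forall>b. balanced_eq k b \<and> satisfies_eq k b x \<longrightarrow> preserves_classes m k A b) \<and>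
      aff_dim_pts k x \<ge> min (int k - int p) (int k - 2)"
    if S: "S \<subseteq> Fqn n" and large: "real (card S) \<ge> \<beta> * \<gamma> ^ n" for n and S :: "(nat \<Rightarrow> 'a) set"
  proof -
    define Q where "Q = q ^ n"
    define \<delta> where "\<delta> = dens n S"
    have Q: "Q > 0"
      using q by (simp add: Q_def)
    have \<delta>: "0 \<le> \<delta>" "\<delta> \<le> 1"
      using dens_le_1[OF S] by (auto simp: \<delta>_def)
    have "\<beta> / root M q ^ n = \<beta> * \<gamma> ^ n / Q"
      using q by (simp add: \<gamma>_def Q_def power_divide)
    also have "\<dots> \<le> \<delta>"
      unfolding \<delta>_def dens_def Q_def q_def using large by (intro divide_right_mono) auto
    finally have \<delta>_ge: "\<beta> / root M q ^ n \<le> \<delta>" .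
    have "0 < \<beta> / root M q ^ n"
      using \<beta> root by (intro divide_pos_pos) auto
    then have "0 < \<delta>"
      using \<delta>_ge by linarith
    then have Sne: "S \<noteq> {}"
      by (auto simp: \<delta>_def)
    have "(\<beta> / root M q ^ n) ^ M \<le> \<delta> ^ M"
      using \<delta>_ge \<open>0 < \<beta> / root M q ^ n\<close> by (intro power_mono) auto
    moreover have "(\<beta> / root M q ^ n) ^ M = \<beta> ^ M / Q"
    proof -
      have "(root M q ^ n) ^ M = (root M q ^ M) ^ n"
        by (simp only: power_mult[symmetric] mult.commute)
      also have "root M q ^ M = q"
        using q by (intro real_root_pow_pos2) (auto simp: M_def)
      finally show ?thesis
        by (simp add: power_divide Q_def)
    qed
    moreover have "\<beta> ^ 1 \<le> \<beta> ^ M"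
      using \<beta>(1) by (intro power_increasing) (auto simp: M_def)
    then have "\<beta> / Q \<le> \<beta> ^ M / Q"
      using Q by (intro divide_right_mono) auto
    ultimately have "\<beta> / Q \<le> \<delta> ^ M"
      by linarith
    then have \<delta>M: "\<beta> \<le> \<delta> ^ M * Q"
      using Q by (simp add: pos_divide_le_eq)
    have "2 * 2 ^ p \<le> \<delta> ^ M * Q"
      using \<beta>(2) \<delta>M by linarith
    also have "\<dots> \<le> \<delta> ^ p * Q"
      using \<delta> Q by (intro mult_right_mono power_decreasing) (auto simp: M_def)
    finally have eps: "2 \<le> (\<delta> / 2) ^ p * Q"
      by (simp add: power_divide field_simps)
    obtain h where h: "\<forall>i<m. \<forall>t. (\<Sum>C\<in>P. a C i * h C t) = 0"
        "p \<ge> 2 \<longrightarrow> (\<exists>C\<in>P. (\<Sum>j\<in>C. c j) \<noteq> 0 \<or> h C \<noteq> 0)"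
        "\<forall>C\<in>P. \<kappa> * \<delta> ^ L * Q ^ (card C - 1) \<le> reps C c S (h C)"
      using main[THEN spec, THEN spec, THEN mp, THEN mp, OF S Sne, folded \<delta>_def Q_def, THEN mp, OF eps]
      by (elim exE conjE) (rule that)
    have tau: "q ^ k < (\<kappa> * \<delta> ^ L) ^ p * Q"
    proof -
      have "q ^ k + 1 \<le> \<kappa> ^ p * \<beta>"
        using \<beta>(3) \<kappa> by (simp add: pos_divide_le_eq mult.commute)
      also have "\<dots> \<le> \<kappa> ^ p * (\<delta> ^ M * Q)"
        using \<delta>M \<kappa> by (intro mult_left_mono) auto
      also have "\<dots> \<le> \<kappa> ^ p * (\<delta> ^ (L * p) * Q)"
        using \<delta> Q \<kappa> by (intro mult_left_mono mult_right_mono power_decreasing) (auto simp: M_def)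
      also have "\<dots> = (\<kappa> * \<delta> ^ L) ^ p * Q"
        by (simp add: power_mult_distrib power_mult)
      finally show ?thesis
        by simp
    qed
    have "\<exists>x. (\<forall>j<k. x j \<in> S) \<and> (\<forall>C\<in>P. (\<Sum>j\<in>C. c j *v x j) = h C) \<and>
      (\<forall>b. satisfies_eq k b x \<longrightarrow> (\<forall>C\<in>P. \<forall>j\<in>C. \<forall>j'\<in>C. b j * c j' = b j' * c j))"
    proof (rule exists_generic_tuple[OF P c S])
      show "0 \<le> \<kappa> * \<delta> ^ L"
        using \<kappa> \<delta>(1) by simp
      show "real CARD('a) ^ k < (\<kappa> * \<delta> ^ L) ^ card P * real CARD('a) ^ n"
        using tau by (simp add: p_def q_def Q_def)
      show "\<kappa> * \<delta> ^ L * (real CARD('a) ^ n) ^ (card C - 1) \<le> reps C c S (h C)" if "C \<in> P" for C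
        using h(3) that by (simp add: q_def Q_def)
    qed
    then obtain x where x: "\<forall>j<k. x j \<in> S" "\<forall>C\<in>P. (\<Sum>j\<in>C. c j *v x j) = h C"
      and gen: "\<forall>b. satisfies_eq k b x \<longrightarrow> (\<forall>C\<in>P. \<forall>j\<in>C. \<forall>j'\<in>C. b j * c j' = b j' * c j)"
      by (elim exE conjE) (rule that)
    have hC: "(\<Sum>j\<in>C. c j * x j t) = h C t" if "C \<in> P" for C t
    proof -
      have "(\<Sum>j\<in>C. c j *v x j) t = h C t"
        using x(2) that by simp
      then show ?thesis
        by (simp add: sum_fun_apply)
    qed
    have "is_solution m k A x"
      unfolding is_solution_def satisfies_eq_def
    proof (intro allI impI)
      fix i t assume i: "i < m"
      have "(\<Sum>j<k. A i j * x j t) = (\<Sum>C\<in>P. \<Sum>j\<in>C. A i j * x j t)"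
        by (rule sum_over_classes[OF P])
      also have "\<dots> = (\<Sum>C\<in>P. a C i * (\<Sum>j\<in>C. c j * x j t))"
        using factor i by (simp add: P_def sum_distrib_left mult_ac)
      also have "\<dots> = 0"
        using h(1) i by (simp add: hC)
      finally show "(\<Sum>j<k. A i j * x j t) = 0" .
    qed
    moreover have "preserves_classes m k A b" if "satisfies_eq k b x" for b
      by (rule preserves_classes_if_proportional[OF c factor]) (use gen that in \<open>auto simp: P_def\<close>)
    moreover have "min (int k - int p) (int k - 2) \<le> aff_dim_pts k x"
    proof (cases "p \<ge> 2")
      \<comment> \<open>Keeping \<open>C\<close> intact removes only \<open>p - 1\<close> points, so
        the dimension is at least \<open>k - (p - 1) - 1 = k - p\<close>.\<close>
      case True
      then obtain C where C: "C \<in> P" "(\<Sum>j\<in>C. c j) \<noteq> 0 \<or> h C \<noteq> 0"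
        using h(2) by blast
      have "int k - int (card (P - {C})) - 1 \<le> aff_dim_pts k x"
        by (rule aff_dim_pts_ge_removed[OF P, where c = c]) (use c gen C x(2) in auto)
      moreover have "card (P - {C}) = p - 1"
        using C(1) fP by (simp add: p_def)
      ultimately show ?thesis
        using True by simp
    next
      \<comment> \<open>Every class loses a point here; with at most one class this still gives
        \<open>k - p - 1 \<ge> k - 2\<close>.\<close>
      case False
      have "int k - int (card P) - 1 \<le> aff_dim_pts k x"
        by (rule aff_dim_pts_ge_removed[OF P, where c = c]) (use c gen in auto)
      then show ?thesis
        using False by (simp add: p_def)
    qed
    ultimately show ?thesis
      using x(1) by blast
  qed
  show ?thesis
  proof (rule exI[of _ \<beta>], rule exI[of _ \<gamma>], intro conjI allI impI)
    show "\<beta> > 0"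
      using \<beta>(1) by linarith
    show "\<gamma> > 0" "\<gamma> < real CARD('a)"
      using root q by (simp_all add: \<gamma>_def pos_divide_less_eq flip: q_def)
    fix n and S :: "(nat \<Rightarrow> 'a) set"
    assume "S \<subseteq> Fqn n" "\<beta> * \<gamma> ^ n \<le> real (card S)"
    from solution[OF this]
    show "\<exists>x. (\<forall>j<k. x j \<in> S) \<and> is_solution m k A x \<and>
        (\<forall>b. balanced_eq k b \<and> satisfies_eq k b x \<longrightarrow> preserves_classes m k A b) \<and>
        aff_dim_pts k x \<ge> min (int k - int (card (col_classes m k A))) (int k - 2)"
      unfolding p_def P_def .
  qed
qed

end
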